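(* Let $d\ge1$, let $n\ge2$, and let $G$ be a length-weighted Sobolev metric of order $n$ with coefficient functions $a_0,\dots,a_n$. If $(\mathcal I^n(S^1,\mathbb R^d),\operatorname{dist})$ is metrically complete, then at least one of the integrals $$\int_1^\infty r^{1/2-k}\sqrt{a_k(r)}\,\mathrm{d}r,\qquad 0\le k\le n,$$ diverges (equals $\infty$), and at least one of the integrals $$\int_0^1 r^{1/2-k}\sqrt{a_k(r)}\,\mathrm{d}r,\qquad 0\le k\le n,$$ diverges (equals $\infty$).
   Context: $S^1=\mathbb R/2\pi\mathbb Z$ with parameter $\theta$, and $'=\partial_\theta$. For $n\ge2$, $\mathcal I^n(S^1,\mathbb R^d)=\{c\in H^n(S^1,\mathbb R^d): c'(\theta)\ne0 \text{ for all }\theta\}$, an open subset of the Sobolev space $H^n(S^1,\mathbb R^d)$, hence a Hilbert manifold with tangent space $H^n(S^1,\mathbb R^d)$ at each point. For a curve $c$: $D_s=\frac1{|c'|}\partial_\theta$ and $\mathrm{d}s=|c'|\,\mathrm{d}\theta$ are differentiation and integration with respect to arc length, and $\ell_c=\int_{S^1}1\,\mathrm{d}s$ is the length of $c$. A length-weighted Sobolev metric of order $n$ is a Riemannian metric of the form $$G_c(h,k)=\sum_{j=0}^n\int_{S^1}a_j(\ell_c)\langle D_s^jh,D_s^jk\rangle\,\mathrm{d}s,$$ where the coefficients are smooth functions $a_j\in C^\infty(\mathbb R_{>0},\mathbb R_{\ge0})$ with $a_0(\ell)>0$ and $a_n(\ell)>0$ for all $\ell>0$; for $n\ge 2$ it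 is a smooth strong Riemannian metric on $\mathcal I^n(S^1,\mathbb R^d)$. $\operatorname{dist}$ is the geodesic distance induced by $G$ on $\mathcal I^n(S^1,\mathbb R^d)$: $\operatorname{dist}(c_0,c_1)$ is the infimum of $\int_0^1\sqrt{G_c(\partial_tc,\partial_tc)}\,\mathrm{d}t$ over piecewise smooth paths in $\mathcal I^n(S^1,\mathbb R^d)$ from $c_0$ to $c_1$ (and $\infty$ if $c_0,c_1$ lie in different connected components).
   Formalization: The space of immersions is assumed non-empty; this is automatic for d ≥ 2 (circles) and excludes d = 1, where there are no immersed closed curves, the empty space is vacuously complete, and the claim fails, e.g. for a_j(r) = r^{2n} e^{-r}. *)

theory Defs
  imports "HOL-Analysis.Analysis"
begin

section \<open>Functions on the circle\<close>

text \<open>Functions on $S^1 = R / 2 \pi Z$ are represented by $2\pi$-periodic functions on the reals.\<close>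

definition periodic :: "(real \<Rightarrow> 'b) \<Rightarrow> bool" where
  "periodic f \<longleftrightarrow> (\<forall>\<theta>. f (\<theta> + 2 * pi) = f \<theta>)"

definition circle_integral :: "(real \<Rightarrow> 'b) \<Rightarrow> 'b :: {banach, second_countable_topology}" where
  "circle_integral f = (LINT \<theta>:{0..2*pi}|lebesgue. f \<theta>)"

definition L2_circle :: "(real \<Rightarrow> real ^ 'd) set" where
  "L2_circle = {g. periodic g \<and> g \<in> borel_measurable lebesgue \<and>
                   set_integrable lebesgue {0..2*pi} (\<lambda>\<theta>. (norm (g \<theta>))\<^sup>2)}"

definition smooth_fun_on :: "real set \<Rightarrow> (real \<Rightarrow> real) \<Rightarrow> bool" \<comment> \<open>only used for open sets\<close> where
  "smooth_fun_on S f \<longleftrightarrow> (\<forall>k. \<forall>x\<in>S. (deriv ^^ k) f differentiable (at x))"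

definition weak_deriv :: "nat \<Rightarrow> (real \<Rightarrow> real ^ 'd) \<Rightarrow> (real \<Rightarrow> real ^ 'd) \<Rightarrow> bool" where
  "weak_deriv j f g \<longleftrightarrow>
     (\<forall>\<phi>. smooth_fun_on UNIV \<phi> \<and> periodic \<phi> \<longrightarrow>
        circle_integral (\<lambda>\<theta>. (deriv ^^ j) \<phi> \<theta> *\<^sub>R f \<theta>)
          = (-1) ^ j *\<^sub>R circle_integral (\<lambda>\<theta>. \<phi> \<theta> *\<^sub>R g \<theta>))"

text \<open>
  The Sobolev space $H^n(S^1, R^d)$, for $n \ge 1$.  Every class contains exactly one continuous
  function, and this function is taken as the element; so equality in $H^n$ is equality of functions,
  and pointwise conditions on $c'$ make sense for $n \ge 2$.
\<close>

definition sobolev :: "nat \<Rightarrow> (real \<Rightarrow> real ^ 'd) set" where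
  "sobolev n = {c. periodic c \<and> continuous_on UNIV c \<and>
                   (\<forall>j\<le>n. \<exists>g\<in>L2_circle. weak_deriv j c g)}"

text \<open>
  The derivative in $\theta$ is the pointwise one.  For the continuous representative of an
  element of $H^n$, the derivatives of order below $n$ exist everywhere and are absolutely continuous.
  The $n$-th one exists almost everywhere and agrees there with the weak derivative; its values on
  the exceptional null set are arbitrary and only enter through integrals.
\<close>

definition d_theta :: "(real \<Rightarrow> real ^ 'd) \<Rightarrow> real \<Rightarrow> real ^ 'd" where
  "d_theta h \<theta> = vector_derivative h (at \<theta>)"

definition sobolev_norm :: "nat \<Rightarrow> (real \<Rightarrow> real ^ 'd) \<Rightarrow> real" where
  "sobolev_norm n h = sqrt (\<Sum>j\<le>n. circle_integral (\<lambda>\<theta>. (norm ((d_theta ^^ j) h \<theta>))\<^sup>2))"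

section \<open>Immersed curves and length-weighted Sobolev metrics\<close>

text \<open>For $n \ge 2$, the set of immersions contains the circles when $d \ge 2$, and is empty when
  $d = 1$, by Rolle's theorem.  The empty space is vacuously complete, so nonemptiness is required
  explicitly where completeness is assumed.\<close>

definition immersions :: "nat \<Rightarrow> (real \<Rightarrow> real ^ 'd) set" where
  "immersions n = {c \<in> sobolev n. \<forall>\<theta>. d_theta c \<theta> \<noteq> 0}"

definition D_s :: "(real \<Rightarrow> real ^ 'd) \<Rightarrow> (real \<Rightarrow> real ^ 'd) \<Rightarrow> real \<Rightarrow> real ^ 'd" where
  "D_s c h \<theta> = (1 / norm (d_theta c \<theta>)) *\<^sub>R d_theta h \<theta>"

definition arclength_integral :: "(real \<Rightarrow> real ^ 'd) \<Rightarrow> (real \<Rightarrow> real) \<Rightarrow> real" where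
  "arclength_integral c f = circle_integral (\<lambda>\<theta>. f \<theta> * norm (d_theta c \<theta>))"

definition curve_length :: "(real \<Rightarrow> real ^ 'd) \<Rightarrow> real" where
  "curve_length c = arclength_integral c (\<lambda>\<theta>. 1)"

definition admissible_coefficients :: "nat \<Rightarrow> (nat \<Rightarrow> real \<Rightarrow> real) \<Rightarrow> bool" where
  "admissible_coefficients n a \<longleftrightarrow>
     (\<forall>j\<le>n. smooth_fun_on {0<..} (a j) \<and> (\<forall>l>0. a j l \<ge> 0)) \<and>
     (\<forall>l>0. a 0 l > 0 \<and> a n l > 0)"

definition sobolev_metric ::
  "nat \<Rightarrow> (nat \<Rightarrow> real \<Rightarrow> real) \<Rightarrow> (real \<Rightarrow> real ^ 'd) \<Rightarrow>
    (real \<Rightarrow> real ^ 'd) \<Rightarrow> (real \<Rightarrow> real ^ 'd) \<Rightarrow> real" where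
  "sobolev_metric n a c h k =
     (\<Sum>j\<le>n. arclength_integral c
        (\<lambda>\<theta>. a j (curve_length c) * ((D_s c ^^ j) h \<theta> \<bullet> (D_s c ^^ j) k \<theta>)))"

section \<open>Paths and geodesic distance\<close>

definition has_sobolev_derivative ::
  "nat \<Rightarrow> (real \<Rightarrow> real \<Rightarrow> real ^ 'd) \<Rightarrow> (real \<Rightarrow> real ^ 'd) \<Rightarrow> real \<Rightarrow> real set \<Rightarrow> bool" where
  "has_sobolev_derivative n \<gamma> v t S \<longleftrightarrow>
     ((\<lambda>u. sobolev_norm n (\<lambda>\<theta>. (1 / (u - t)) *\<^sub>R (\<gamma> u \<theta> - \<gamma> t \<theta>) - v \<theta>)) \<longlongrightarrow> 0) (at t within S)"

text \<open>Smoothness as a map from an interval into $H^n$; \<open>\<Gamma> k\<close> is the \<open>k\<close>-th derivative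
  (one-sided at the end points).\<close>

definition smooth_path_on :: "nat \<Rightarrow> real set \<Rightarrow> (real \<Rightarrow> real \<Rightarrow> real ^ 'd) \<Rightarrow> bool" where
  "smooth_path_on n S \<gamma> \<longleftrightarrow>
     (\<exists>\<Gamma>. \<Gamma> 0 = \<gamma> \<and>
        (\<forall>k. \<forall>t\<in>S. \<Gamma> k t \<in> sobolev n \<and> has_sobolev_derivative n (\<Gamma> k) (\<Gamma> (Suc k) t) t S))"

definition piecewise_smooth_path :: "nat \<Rightarrow> (real \<Rightarrow> real \<Rightarrow> real ^ 'd) \<Rightarrow> bool" where
  "piecewise_smooth_path n \<gamma> \<longleftrightarrow>
     (\<exists>N \<tau>. \<tau> 0 = 0 \<and> \<tau> N = 1 \<and>
        (\<forall>i<N. \<tau> i < \<tau> (Suc i) \<and> smooth_path_on n {\<tau> i..\<tau> (Suc i)} \<gamma>))"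

definition immersion_paths ::
  "nat \<Rightarrow> (real \<Rightarrow> real ^ 'd) \<Rightarrow> (real \<Rightarrow> real ^ 'd) \<Rightarrow> (real \<Rightarrow> real \<Rightarrow> real ^ 'd) set" where
  "immersion_paths n c0 c1 =
     {\<gamma>. piecewise_smooth_path n \<gamma> \<and> (\<forall>t\<in>{0..1}. \<gamma> t \<in> immersions n) \<and> \<gamma> 0 = c0 \<and> \<gamma> 1 = c1}"

text \<open>Since convergence in $H^n$ implies pointwise convergence, the derivative of a path in $H^n$ can
  be computed pointwise; its values at the finitely many break points do not affect the length.\<close>

definition d_t :: "(real \<Rightarrow> real \<Rightarrow> real ^ 'd) \<Rightarrow> real \<Rightarrow> real \<Rightarrow> real ^ 'd" where
  "d_t \<gamma> t \<theta> = vector_derivative (\<lambda>u. \<gamma> u \<theta>) (at t within {0..1})"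

definition path_length ::
  "nat \<Rightarrow> (nat \<Rightarrow> real \<Rightarrow> real) \<Rightarrow> (real \<Rightarrow> real \<Rightarrow> real ^ 'd) \<Rightarrow> ennreal" where
  "path_length n a \<gamma> =
     (\<integral>\<^sup>+t\<in>{0..1}. ennreal (sqrt (sobolev_metric n a (\<gamma> t) (d_t \<gamma> t) (d_t \<gamma> t))) \<partial>lebesgue)"

text \<open>The infimum over the empty set is \<open>\<infinity>\<close>, which is the value for curves in different components.\<close>

definition geodesic_dist ::
  "nat \<Rightarrow> (nat \<Rightarrow> real \<Rightarrow> real) \<Rightarrow> (real \<Rightarrow> real ^ 'd) \<Rightarrow> (real \<Rightarrow> real ^ 'd) \<Rightarrow> ennreal" where
  "geodesic_dist n a c0 c1 = (INF \<gamma>\<in>immersion_paths n c0 c1. path_length n a \<gamma>)"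

text \<open>\<open>Metric_space.mcomplete\<close> is for real-valued distances, whereas \<open>geodesic_dist\<close> may be \<open>\<infinity>\<close>.\<close>

definition metrically_complete :: "'p set \<Rightarrow> ('p \<Rightarrow> 'p \<Rightarrow> ennreal) \<Rightarrow> bool" where
  "metrically_complete M \<delta> \<longleftrightarrow>
     (\<forall>x :: nat \<Rightarrow> 'p.
        (\<forall>i. x i \<in> M) \<and> (\<forall>\<epsilon>>0. \<exists>N. \<forall>i\<ge>N. \<forall>j\<ge>N. \<delta> (x i) (x j) < \<epsilon>)
        \<longrightarrow> (\<exists>l\<in>M. (\<lambda>i. \<delta> (x i) l) \<longlonglongrightarrow> 0))"

end

(*
  Let c be an immersion of length 1.  Along the radial path r c the metric is
  sum_k a_k(r) r^(1-2k) E_k, where E_k is the k-th arc length energy of c, so the distance from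
  r c to s c is at most a linear combination of the integrals of r^(1/2-k) sqrt(a_k(r)) over [r,s].
  If these integrals are all finite at infinity (or at 0), then (i+1) c (or c/(i+1)) is a Cauchy
  sequence whose lengths tend to infinity (or to 0).

  Such a sequence has no limit l: changing the length away from that of l has a positive cost.
  As D_s^j h has mean zero for 1 <= j < n, its supremum is bounded by the integral of |D_s^(j+1) h|,
  hence |D_s h|^2 <= L^(2n-3) / a_n(L) * G_c(h,h) on curves of length L.  But |D_s h| bounds the
  logarithmic time derivative of |c'| at each single parameter value; so while the length stays
  between half and twice that of l, a short path changes |c'|, and thereby the length, only by a
  factor close to 1.
*)
theory Submission
  imports Defs
begin

text \<open>Membership in H^n is defined by weak derivatives, while the metric is built from
  pointwise derivatives, which have default values where they do not exist. Much of the work is the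
  bridge between the two: a function with weak derivatives is recognized as an iterated indefinite
  integral (\<open>loc_sobolev\<close>), for which the pointwise derivatives are the right ones up
  to a null set. Products and reciprocals are studied within this class, because \<open>D_s\<close>
  divides by the speed, which in general has only n - 1 derivatives itself.

  The lower bound for the distance uses no time derivative of the length. Each parameter value gives
  a differential inequality for the logarithm of the speed, and for the length continuity in time
  suffices. The constant of this inequality depends on the length and on \<open>a n\<close> at the
  length, so it is uniform only while the length stays in a compact interval of positive numbers.
  This is why a path is followed only from its last moment outside such an interval.\<close>

subsection \<open>Indefinite integrals on the line\<close>

text \<open>The Vitali covering theorem selects disjoint intervals on which the difference quotient is bad,
  and Henstock's lemma bounds their total length.\<close>

lemma negligible_not_vector_derivative_integral:
  fixes f F :: "real \<Rightarrow> 'a::euclidean_space"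
  assumes F: "\<And>a b. a \<le> b \<Longrightarrow> (f has_integral F b - F a) {a..b}"
  shows "negligible {x. \<not> (F has_vector_derivative f x) (at x)}"
proof -
  define bad where "bad e x y \<longleftrightarrow> y \<noteq> x \<and> e * \<bar>y - x\<bar> \<le> norm (F y - F x - (y - x) *\<^sub>R f x)" for e x y
  \<comment> \<open>Non-differentiability is split into countably many sets with a fixed error
    \<open>1 / Suc m\<close> inside a bounded interval: Henstock's lemma works on one compact
    interval and with one tolerance at a time.\<close>
  define E where "E m N = {x \<in> {- real N<..<real N}. \<forall>d>0. \<exists>y. \<bar>y - x\<bar> < d \<and> bad (1 / Suc m) x y}" for m N :: nat
  have neg: "negligible (E m N)" for m N
    unfolding negligible_outer_le
  proof (intro allI impI)
    fix \<eta> :: real assume "\<eta> > 0"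
    define e where "e = 1 / real (Suc m)"
    have "e > 0" by (simp add: e_def)
    have int: "f integrable_on cbox (- real N) (real N)"
      using F[of "- real N" "real N"] by (auto simp: integrable_on_def)
    \<comment> \<open>The factor \<open>e\<close> in the tolerance cancels against the Henstock term
      of a bad interval, which is at least \<open>e\<close> times its length; total length at most
      \<open>\<eta>\<close> remains.\<close>
    obtain \<gamma> where "gauge \<gamma>" and \<gamma>: "\<And>p. \<lbrakk>p tagged_partial_division_of cbox (- real N) (real N); \<gamma> fine p\<rbrakk> \<Longrightarrow>
             sum (\<lambda>(x,k). norm (measure lborel k *\<^sub>R f x - integral k f)) p < \<eta> * e"
      by (rule Henstock_lemma[OF int, of "\<eta> * e"]) (use \<open>\<eta> > 0\<close> \<open>e > 0\<close> in auto)
    \<comment> \<open>Ordered pairs instead of intervals: the tag has to be the point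
      \<open>x\<close> at which the quotient is bad, and this may be either end of the
      interval.\<close>
    define K where "K = {(x, y). x \<in> {- real N<..<real N} \<and> y \<in> {- real N<..<real N} \<and>
       {min x y..max x y} \<subseteq> \<gamma> x \<and> bad e x y}"
    define ctr where "ctr = (\<lambda>(x::real, y). (x + y) / 2)"
    define rad where "rad = (\<lambda>(x::real, y). \<bar>y - x\<bar> / 2)"
    have cb: "cball (ctr i) (rad i) = {min (fst i) (snd i)..max (fst i) (snd i)}" for i
      by (cases i) (auto simp: ctr_def rad_def cball_eq_atLeastAtMost min_def max_def field_simps abs_if)
    have r: "0 < rad i" if "i \<in> K" for i
      using that by (auto simp: K_def rad_def bad_def)
    have cov: "\<exists>i. i \<in> K \<and> x \<in> cball (ctr i) (rad i) \<and> rad i < d"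
      if xE: "x \<in> E m N" and dpos: "0 < d" for x d
    proof -
      have x: "x \<in> {- real N<..<real N}" using xE by (simp add: E_def)
      have "open (\<gamma> x \<inter> {- real N<..<real N})" "x \<in> \<gamma> x \<inter> {- real N<..<real N}"
        using \<open>gauge \<gamma>\<close> x by (auto simp: gauge_def)
      then obtain d1 where d1: "d1 > 0" "ball x d1 \<subseteq> \<gamma> x \<inter> {- real N<..<real N}"
        using open_contains_ball by blast
      obtain y where y: "\<bar>y - x\<bar> < min d d1" "bad e x y"
        using xE dpos d1(1) unfolding E_def e_def mem_Collect_eq by (metis min_less_iff_conj)
      have sub: "{min x y..max x y} \<subseteq> ball x d1"
        using y by (auto simp: dist_real_def min_def max_def split: if_splits)
      have "y \<in> ball x d1" using y by (auto simp: dist_real_def)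
      then have "(x, y) \<in> K" unfolding K_def using d1(2) y x sub by auto
      moreover have "x \<in> cball (ctr (x, y)) (rad (x, y))" unfolding cb by auto
      moreover have "rad (x, y) < d" using y by (auto simp: rad_def)
      ultimately show ?thesis by blast
    qed
    obtain C where C: "countable C" "C \<subseteq> K"
      and disj: "pairwise (\<lambda>i j. disjnt (cball (ctr i) (rad i)) (cball (ctr j) (rad j))) C"
      and negC: "negligible (E m N - (\<Union>i\<in>C. cball (ctr i) (rad i)))"
      using Vitali_covering_theorem_cballs[OF r cov] by blast
    \<comment> \<open>Divisions are finite, so the estimate is made for finite subfamilies. It does
      not depend on \<open>J\<close> and therefore passes to the countable union.\<close>
    have fin: "measure lebesgue (\<Union>i\<in>J. cball (ctr i) (rad i)) \<le> \<eta>" if J: "J \<subseteq> C" "finite J" for J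
    proof -
      let ?T = "\<lambda>i. cball (ctr i) (rad i)"
      define p where "p = (\<lambda>i. (fst i, ?T i)) ` J"
      have JK: "J \<subseteq> K" using J C by auto
      have inj: "inj_on ?T J"
      proof (rule inj_onI, rule ccontr)
        fix i j assume ij: "i \<in> J" "j \<in> J" "?T i = ?T j" "i \<noteq> j"
        then have "disjnt (?T i) (?T j)" using disj J unfolding pairwise_def by blast
        then have "?T j = {}" using ij(3) by (simp add: disjnt_def)
          then show False using less_imp_le[OF r[of j]] ij JK by (auto simp del: cball_eq_empty simp: cball_eq_empty not_less)
      qed
      then have injp: "inj_on (\<lambda>i. (fst i, ?T i)) J" by (auto simp: inj_on_def)
      have tp: "p tagged_partial_division_of cbox (- real N) (real N)"
        unfolding tagged_partial_division_of_def
      proof (intro conjI allI impI)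
        show "finite p" using J by (simp add: p_def)
      next
        fix x k assume "(x, k) \<in> p"
        then obtain i where i: "i \<in> J" "x = fst i" "k = ?T i" by (auto simp: p_def)
        then show "x \<in> k" by (simp add: cb)
        show "k \<subseteq> cbox (- real N) (real N)" using i JK by (force simp: cb K_def)
        show "\<exists>a b. k = cbox a b" using i by (auto simp: cb)
      next
        fix x1 k1 x2 k2 assume "(x1, k1) \<in> p \<and> (x2, k2) \<in> p \<and> (x1, k1) \<noteq> (x2, k2)"
        then obtain i j where i: "i \<in> J" "k1 = ?T i" "j \<in> J" "k2 = ?T j" "i \<noteq> j" by (auto simp: p_def)
        then have "disjnt k1 k2" using disj J unfolding pairwise_def by blast
        then show "interior k1 \<inter> interior k2 = {}"
          using interior_subset by (fastforce simp: disjnt_def)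
      qed
      have fp: "\<gamma> fine p" using JK by (fastforce simp: fine_def p_def cb K_def)
      have ct: "measure lborel (?T i) = \<bar>snd i - fst i\<bar>" for i
        by (simp add: cb max_def min_def)
      have tm: "e * measure lborel (?T i) \<le> norm (measure lborel (?T i) *\<^sub>R f (fst i) - integral (?T i) f)" if "i \<in> J" for i
      proof -
        obtain x y where i: "i = (x, y)" by fastforce
        have b: "bad e x y" using that JK by (auto simp: i K_def)
        have I: "integral (?T i) f = F (max x y) - F (min x y)"
          unfolding cb i by (auto intro!: integral_unique F)
        have "norm (measure lborel (?T i) *\<^sub>R f (fst i) - integral (?T i) f) = norm (F y - F x - (y - x) *\<^sub>R f x)"
        proof (cases "x \<le> y")
          case True
          then show ?thesis unfolding I ct by (simp add: i norm_minus_commute)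
        next
          case False
          then have "measure lborel (?T i) *\<^sub>R f (fst i) - integral (?T i) f = F y - F x - (y - x) *\<^sub>R f x"
            unfolding I ct by (simp add: i algebra_simps)
          then show ?thesis by simp
        qed
        then show ?thesis using b by (simp add: bad_def ct i)
      qed
      have "e * (\<Sum>i\<in>J. measure lborel (?T i)) \<le> (\<Sum>i\<in>J. norm (measure lborel (?T i) *\<^sub>R f (fst i) - integral (?T i) f))"
        unfolding sum_distrib_left by (intro sum_mono tm)
      also have "\<dots> = sum (\<lambda>(x,k). norm (measure lborel k *\<^sub>R f x - integral k f)) p"
        unfolding p_def by (subst sum.reindex[OF injp]) (simp add: o_def)
      also have "\<dots> < \<eta> * e" by (rule \<gamma>[OF tp fp])
      finally have "(\<Sum>i\<in>J. measure lborel (?T i)) \<le> \<eta>" using \<open>e > 0\<close> by (simp add: mult.commute)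
      moreover have "measure lebesgue (\<Union>i\<in>J. ?T i) \<le> (\<Sum>i\<in>J. measure lebesgue (?T i))"
        by (rule measure_UNION_le) (use J in auto)
      ultimately show ?thesis by (simp add: measure_completion)
    qed
    define U where "U = (\<Union>i\<in>C. cball (ctr i) (rad i))"
    have U: "U \<in> lmeasurable" "measure lebesgue U \<le> \<eta>"
      unfolding U_def
      using fmeasurable_UN_bound[OF C(1), of "\<lambda>i. cball (ctr i) (rad i)" lebesgue \<eta>]
        measure_UN_bound[OF C(1), of "\<lambda>i. cball (ctr i) (rad i)" lebesgue \<eta>] fin
      by auto
    have N: "(E m N - U) \<in> lmeasurable" "measure lebesgue (E m N - U) = 0"
      using negC by (simp_all add: U_def negligible_imp_measurable negligible_imp_measure0)
    show "\<exists>T. E m N \<subseteq> T \<and> T \<in> lmeasurable \<and> measure lebesgue T \<le> \<eta>"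
    proof (intro exI conjI)
      show "E m N \<subseteq> U \<union> (E m N - U)" by auto
      show "U \<union> (E m N - U) \<in> lmeasurable" by (intro fmeasurable.Un U N)
      have "measure lebesgue (U \<union> (E m N - U)) \<le> measure lebesgue U + measure lebesgue (E m N - U)"
        by (intro measure_Un_le fmeasurableD U N)
      then show "measure lebesgue (U \<union> (E m N - U)) \<le> \<eta>" using U N by simp
    qed
  qed
  have "x \<in> (\<Union>m. \<Union>N. E m N)" if "\<not> (F has_vector_derivative f x) (at x)" for x
  proof -
    obtain N :: nat where N: "\<bar>x\<bar> < real N" using reals_Archimedean2 by blast
    have "\<not> (\<forall>e>0. \<exists>d>0. \<forall>y. norm (y - x) < d \<longrightarrow> norm (F y - F x - (y - x) *\<^sub>R f x) \<le> e * norm (y - x))"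
      using that unfolding has_vector_derivative_def has_derivative_at_alt
      by (simp add: bounded_linear_scaleR_left)
    then obtain e where e: "e > 0" "\<And>d. d > 0 \<Longrightarrow> \<exists>y. \<bar>y - x\<bar> < d \<and> e * \<bar>y - x\<bar> < norm (F y - F x - (y - x) *\<^sub>R f x)"
      by (auto simp: not_le)
    obtain m where m: "1 / real (Suc m) < e" using nat_approx_posE[OF e(1)] by blast
    have "\<exists>y. \<bar>y - x\<bar> < d \<and> bad (1 / Suc m) x y" if dp: "d > 0" for d
    proof -
      obtain y where y: "\<bar>y - x\<bar> < d" "e * \<bar>y - x\<bar> < norm (F y - F x - (y - x) *\<^sub>R f x)"
        using e(2)[OF dp] by blast
      moreover have "1 / Suc m * \<bar>y - x\<bar> \<le> e * \<bar>y - x\<bar>"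
        using m by (intro mult_right_mono) auto
      moreover have "y \<noteq> x" using y by auto
      ultimately show ?thesis unfolding bad_def by (intro exI[of _ y]) auto
    qed
    then have "x \<in> E m N" using N by (auto simp: E_def)
    then show ?thesis by blast
  qed
  then have "{x. \<not> (F has_vector_derivative f x) (at x)} \<subseteq> (\<Union>m. \<Union>N. E m N)" by blast
  moreover have "negligible (\<Union>m. \<Union>N. E m N)"
    by (intro negligible_countable_Union) (auto intro!: neg negligible_countable_Union)
  ultimately show ?thesis by (rule negligible_subset[rotated])
qed

text \<open>Absolute continuity enters as domination of the increments by an integral.  Once \<open>g\<close> is replaced
  by 0 on \<open>N\<close>, Henstock's lemma for \<open>g\<close> bounds the contribution of the tags in \<open>N\<close>.\<close>

lemma has_integral_controlled_vector_derivative: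
  fixes f F :: "real \<Rightarrow> 'a::euclidean_space" and g :: "real \<Rightarrow> real"
  assumes "a \<le> b" and N: "negligible N"
    and D: "\<And>x. x \<in> {a..b} - N \<Longrightarrow> (F has_vector_derivative f x) (at x)"
    and g: "g integrable_on {a..b}"
    and ctrl: "\<And>x y. a \<le> x \<Longrightarrow> x \<le> y \<Longrightarrow> y \<le> b \<Longrightarrow> norm (F y - F x) \<le> integral {x..y} g"
  shows "(f has_integral F b - F a) {a..b}"
proof -
  define g0 where "g0 x = (if x \<in> N then 0 else g x)" for x
  define f0 where "f0 x = (if x \<in> N then 0 else f x)" for x
  have g0: "g0 integrable_on cbox a b"
    using integrable_spike[OF g N, of g0] by (simp add: g0_def)
  have int0: "integral {x..y} g0 = integral {x..y} g" for x y
    by (rule integral_spike[OF N]) (simp add: g0_def)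
  have "(f0 has_integral F b - F a) {a..b}"
    unfolding has_integral_real
  proof (intro allI impI)
    fix e :: real assume "e > 0"
    \<comment> \<open>The added 1 keeps the denominator positive for \<open>a = b\<close> and makes
      \<open>e1 * (b - a) < e / 2\<close> strict.\<close>
    define e1 where "e1 = e / (2 * (b - a + 1))"
    have "e1 > 0" using \<open>e > 0\<close> \<open>a \<le> b\<close> by (simp add: e1_def)
    obtain \<gamma> where "gauge \<gamma>" and \<gamma>: "\<And>p. \<lbrakk>p tagged_partial_division_of cbox a b; \<gamma> fine p\<rbrakk> \<Longrightarrow>
             sum (\<lambda>(x,k). norm (measure lborel k *\<^sub>R g0 x - integral k g0)) p < e / 2"
      by (rule Henstock_lemma[OF g0, of "e / 2"]) (use \<open>e > 0\<close> in auto)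
    have "\<exists>d>0. \<forall>y. \<bar>y - x\<bar> < d \<longrightarrow> norm (F y - F x - (y - x) *\<^sub>R f x) \<le> e1 * \<bar>y - x\<bar>"
      if "x \<in> {a..b} - N" for x
      using D[OF that] \<open>e1 > 0\<close> unfolding has_vector_derivative_def has_derivative_at_alt by auto
    then obtain d where d: "\<And>x. x \<in> {a..b} - N \<Longrightarrow> d x > 0 \<and>
        (\<forall>y. \<bar>y - x\<bar> < d x \<longrightarrow> norm (F y - F x - (y - x) *\<^sub>R f x) \<le> e1 * \<bar>y - x\<bar>)"
      by metis
    \<comment> \<open>For a tag off \<open>N\<close> the gauge enforces the linear approximation by
      the derivative; for a tag in \<open>N\<close>, where no derivative is available, it enforces
      the Henstock estimate for \<open>g0\<close>.\<close>
    define \<delta> where "\<delta> x = (if x \<in> {a..b} - N then ball x (d x) else \<gamma> x)" for x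
    have "gauge \<delta>" using d \<open>gauge \<gamma>\<close> by (auto simp: gauge_def \<delta>_def)
    show "\<exists>\<gamma>. gauge \<gamma> \<and> (\<forall>\<D>. \<D> tagged_division_of {a..b} \<and> \<gamma> fine \<D> \<longrightarrow>
          norm ((\<Sum>(x, k)\<in>\<D>. measure lborel k *\<^sub>R f0 x) - (F b - F a)) < e)"
    proof (intro exI[of _ \<delta>] conjI allI impI \<open>gauge \<delta>\<close>)
      fix p assume p: "p tagged_division_of {a..b} \<and> \<delta> fine p"
      then have tag: "p tagged_division_of {a..b}" and fine: "\<delta> fine p" by auto
      note p' = tagged_division_ofD[OF tag]
        have FF: "(\<Sum>(x,k)\<in>p. F (Sup k) - F (Inf k)) = F b - F a"
        using additive_tagged_division_1[OF \<open>a \<le> b\<close> tag, of F] by simp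
      define q where "q = {t \<in> p. fst t \<in> N}"
      have "q \<subseteq> p" by (auto simp: q_def)
      have "(\<Sum>(x,k)\<in>p. measure lborel k *\<^sub>R f0 x) - (F b - F a)
            = (\<Sum>(x,k)\<in>p. measure lborel k *\<^sub>R f0 x - (F (Sup k) - F (Inf k)))"
        unfolding FF[symmetric] by (simp add: split_def sum_subtractf)
      then have 1: "norm ((\<Sum>(x,k)\<in>p. measure lborel k *\<^sub>R f0 x) - (F b - F a))
            \<le> (\<Sum>(x,k)\<in>p. norm (measure lborel k *\<^sub>R f0 x - (F (Sup k) - F (Inf k))))"
        by (simp add: split_def norm_sum)
      have kform: "\<exists>u v. k = {u..v} \<and> u \<le> x \<and> x \<le> v \<and> a \<le> u \<and> v \<le> b" if xk: "(x, k) \<in> p" for x k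
      proof -
        obtain u v where "k = {u..v}" using p'(4)[OF xk] by (auto simp only: cbox_interval)
        moreover have "x \<in> k" "k \<subseteq> {a..b}" using p'(2,3)[OF xk] by auto
        ultimately show ?thesis by auto
      qed
      have bound: "norm (measure lborel k *\<^sub>R f0 x - (F (Sup k) - F (Inf k)))
           \<le> (if x \<in> N then norm (measure lborel k *\<^sub>R g0 x - integral k g0) else e1 * measure lborel k)"
        if xk: "(x, k) \<in> p" for x k
      proof -
        obtain u v where k: "k = {u..v}" "u \<le> x" "x \<le> v" "a \<le> u" "v \<le> b" using kform[OF xk] by blast
        show ?thesis
        proof (cases "x \<in> N")
          case True
          have "norm (F v - F u) \<le> integral {u..v} g0" unfolding int0 using k by (intro ctrl) auto
          then show ?thesis using True k by (simp add: f0_def g0_def norm_minus_commute)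
        next
          case False
          then have x: "x \<in> {a..b} - N" using k by auto
          have "k \<subseteq> \<delta> x" using fine xk unfolding fine_def by blast
          then have "{u..v} \<subseteq> ball x (d x)" using x k(1) by (simp add: \<delta>_def)
          then have "u \<in> ball x (d x)" "v \<in> ball x (d x)" using k
            by (auto simp: subset_iff simp del: mem_ball)
          then have "\<bar>u - x\<bar> < d x" "\<bar>v - x\<bar> < d x"
            by (auto simp: dist_real_def abs_minus_commute)
          then have "norm (F u - F x - (u - x) *\<^sub>R f x) \<le> e1 * \<bar>u - x\<bar>"
             "norm (F v - F x - (v - x) *\<^sub>R f x) \<le> e1 * \<bar>v - x\<bar>"
            using d[OF x] by auto
          \<comment> \<open>The tag lies between \<open>u\<close> and \<open>v\<close>. Subtracting
            the two expansions at the tag removes \<open>F x\<close>, and the two error terms add up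
            to \<open>e1\<close> times the length of the interval.\<close>
          then have "norm ((F u - F x - (u - x) *\<^sub>R f x) - (F v - F x - (v - x) *\<^sub>R f x)) \<le> e1 * \<bar>u - x\<bar> + e1 * \<bar>v - x\<bar>"
            by (meson norm_triangle_ineq4 order_trans add_mono)
          also have "(F u - F x - (u - x) *\<^sub>R f x) - (F v - F x - (v - x) *\<^sub>R f x) = (v - u) *\<^sub>R f x - (F v - F u)"
            by (simp add: algebra_simps)
          also have "e1 * \<bar>u - x\<bar> + e1 * \<bar>v - x\<bar> = e1 * (v - u)" using k by (simp add: algebra_simps)
          finally show ?thesis using False k by (simp add: f0_def)
        qed
      qed
      have "(\<Sum>(x,k)\<in>p. norm (measure lborel k *\<^sub>R f0 x - (F (Sup k) - F (Inf k))))
         \<le> (\<Sum>(x,k)\<in>p. if x \<in> N then norm (measure lborel k *\<^sub>R g0 x - integral k g0) else e1 * measure lborel k)"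
        using bound by (intro sum_mono) auto
      also have "\<dots> \<le> (\<Sum>(x,k)\<in>p. (if x \<in> N then norm (measure lborel k *\<^sub>R g0 x - integral k g0) else 0) + e1 * measure lborel k)"
        using \<open>e1 > 0\<close> by (intro sum_mono) auto
      also have "\<dots> = (\<Sum>(x,k)\<in>q. norm (measure lborel k *\<^sub>R g0 x - integral k g0)) + e1 * (\<Sum>(x,k)\<in>p. measure lborel k)"
        unfolding split_def sum.distrib sum_distrib_left q_def
        using p'(1) by (simp add: sum.inter_filter cong: if_cong)
      also have "(\<Sum>(x,k)\<in>p. measure lborel k) = b - a"
        using additive_content_tagged_division[of p a b] tag \<open>a \<le> b\<close> by simp
      also have "(\<Sum>(x,k)\<in>q. norm (measure lborel k *\<^sub>R g0 x - integral k g0)) < e / 2"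
      proof (rule \<gamma>)
        show "q tagged_partial_division_of cbox a b"
          using tag tagged_partial_division_subset[OF _ \<open>q \<subseteq> p\<close>] by (simp add: tagged_division_of_def)
        show "\<gamma> fine q" using fine unfolding fine_def q_def \<delta>_def by (fastforce split: if_splits)
      qed
      also have "e1 * (b - a) < e / 2"
      proof -
        have "e1 * (b - a) < e1 * (b - a + 1)" using \<open>e1 > 0\<close> by simp
        also have "\<dots> = e / 2" using \<open>a \<le> b\<close> by (simp add: e1_def field_simps)
        finally show ?thesis .
      qed
      finally show "norm ((\<Sum>(x,k)\<in>p. measure lborel k *\<^sub>R f0 x) - (F b - F a)) < e" using 1 by simp
    qed
  qed
  then show ?thesis
    by (rule has_integral_spike[OF N, rotated]) (simp add: f0_def)
qed

subsection \<open>Local Sobolev regularity\<close>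

lemma absolutely_integrable_dominated:
  fixes f :: "real \<Rightarrow> 'a::euclidean_space"
  assumes "f \<in> borel_measurable lebesgue" "g integrable_on {a..b}" "\<And>x. x \<in> {a..b} \<Longrightarrow> norm (f x) \<le> g x"
  shows "f absolutely_integrable_on {a..b}"
  by (rule measurable_bounded_by_integrable_imp_absolutely_integrable[OF _ _ assms(2)])
    (use assms in \<open>auto intro: measurable_restrict_space1\<close>)

text \<open>The pointwise \<open>vector_derivative\<close> has junk values where the derivative does not exist; by Lebesgue's
  differentiation theorem this affects only a null set, which order 0 ignores.\<close>

primrec loc_sobolev :: "nat \<Rightarrow> (real \<Rightarrow> 'a::euclidean_space) \<Rightarrow> bool" where
  "loc_sobolev 0 f \<longleftrightarrow> f \<in> borel_measurable lebesgue \<and> (\<forall>a b. (\<lambda>x. (norm (f x))\<^sup>2) absolutely_integrable_on {a..b})"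
| "loc_sobolev (Suc k) f \<longleftrightarrow> loc_sobolev k (\<lambda>x. vector_derivative f (at x)) \<and>
     (\<forall>a b. a \<le> b \<longrightarrow> ((\<lambda>x. vector_derivative f (at x)) has_integral f b - f a) {a..b})"

lemma continuous_bounded_interval:
  fixes f :: "real \<Rightarrow> 'a::real_normed_vector"
  assumes "continuous_on UNIV f"
  obtains M where "M > 0" "\<And>x. x \<in> {a..b} \<Longrightarrow> norm (f x) \<le> M"
proof -
  have "bounded (f ` {a..b})"
    using assms by (intro compact_imp_bounded compact_continuous_image) (auto intro: continuous_on_subset)
  then show ?thesis using that unfolding bounded_pos by auto
qed

lemma loc_sobolev_0I:
  fixes f :: "real \<Rightarrow> 'a::euclidean_space"
  assumes "f \<in> borel_measurable lebesgue" "\<And>a b. \<exists>g. g integrable_on {a..b} \<and> (\<forall>x\<in>{a..b}. (norm (f x))\<^sup>2 \<le> g x)"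
  shows "loc_sobolev 0 f"
proof -
  have "(\<lambda>x. (norm (f x))\<^sup>2) absolutely_integrable_on {a..b}" for a b
  proof -
    obtain g where g: "g integrable_on {a..b}" "\<forall>x\<in>{a..b}. (norm (f x))\<^sup>2 \<le> g x" using assms(2) by blast
    show ?thesis
      by (rule absolutely_integrable_dominated[OF _ g(1)]) (use g(2) assms(1) in auto)
  qed
  then show ?thesis using assms(1) by simp
qed

lemma loc_sobolev_0_square_integrable:
  "loc_sobolev 0 f \<Longrightarrow> (\<lambda>x. (norm (f x))\<^sup>2) integrable_on {a..b}"
  using set_lebesgue_integral_eq_integral(1) by (metis loc_sobolev.simps(1))

lemma loc_sobolev_0_absolutely_integrable:
  fixes f :: "real \<Rightarrow> 'a::euclidean_space"
  assumes "loc_sobolev 0 f"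
  shows "f absolutely_integrable_on {a..b}"
proof (rule absolutely_integrable_dominated)
  show "(\<lambda>x. 1 + (norm (f x))\<^sup>2) integrable_on {a..b}"
    by (intro integrable_add loc_sobolev_0_square_integrable assms) (auto intro: integrable_on_const)
  show "norm (f x) \<le> 1 + (norm (f x))\<^sup>2" for x
    using zero_le_power2[of "norm (f x) - 1"] by (simp add: power2_diff) (smt (verit) norm_ge_zero)
qed (use assms in simp)

text \<open>Needed because the pointwise derivative of an indefinite integral agrees with the
  integrand only off a null set.\<close>

lemma loc_sobolev_0_cong:
  fixes f g :: "real \<Rightarrow> 'a::euclidean_space"
  assumes f: "loc_sobolev 0 f" and N: "negligible N" "\<And>x. x \<notin> N \<Longrightarrow> f x = g x"
  shows "loc_sobolev 0 g"
proof -
  have ae: "AE x in lebesgue. f x = g x"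
    unfolding eventually_ae_filter_negligible using N by auto
  have m: "g \<in> borel_measurable lebesgue"
    using borel_measurable_AE[OF _ ae] f by simp
  have "(\<lambda>x. (norm (g x))\<^sup>2) absolutely_integrable_on {a..b}" for a b
    using f m ae by (subst set_integrable_cong_AE[of _ _ "\<lambda>x. (norm (f x))\<^sup>2"]) (auto)
  then show ?thesis using m by simp
qed

lemma continuous_imp_measurable_lebesgue:
  "continuous_on UNIV f \<Longrightarrow> f \<in> borel_measurable lebesgue"
  by (simp add: borel_measurable_continuous_onI measurable_completion)

lemma loc_sobolev_0_bilinear:
  fixes f :: "real \<Rightarrow> 'a::euclidean_space" and g :: "real \<Rightarrow> 'b::euclidean_space"
    and prod :: "'a \<Rightarrow> 'b \<Rightarrow> 'c::euclidean_space"
  assumes bl: "bounded_bilinear prod" and f: "continuous_on UNIV f" and g: "loc_sobolev 0 g"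
  shows "loc_sobolev 0 (\<lambda>x. prod (f x) (g x))"
proof (rule loc_sobolev_0I)
  interpret bounded_bilinear prod by fact
  show "(\<lambda>x. prod (f x) (g x)) \<in> borel_measurable lebesgue"
    by (rule borel_measurable_continuous_Pair)
      (use f g in \<open>auto intro!: continuous_imp_measurable_lebesgue continuous_on continuous_intros\<close>)
  fix a b
  obtain K where K: "K > 0" "\<And>a b. norm (prod a b) \<le> norm a * norm b * K" using pos_bounded by blast
  obtain M where M: "M > 0" "\<And>x. x \<in> {a..b} \<Longrightarrow> norm (f x) \<le> M" using continuous_bounded_interval[OF f] by blast
  show "\<exists>h. h integrable_on {a..b} \<and> (\<forall>x\<in>{a..b}. (norm (prod (f x) (g x)))\<^sup>2 \<le> h x)"
  proof (intro exI conjI ballI)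
    show "(\<lambda>x. (M * K)\<^sup>2 * (norm (g x))\<^sup>2) integrable_on {a..b}"
      by (intro integrable_on_mult_right loc_sobolev_0_square_integrable g)
    fix x assume "x \<in> {a..b}"
    have "norm (prod (f x) (g x)) \<le> norm (f x) * norm (g x) * K" by (rule K)
    also have "\<dots> \<le> M * norm (g x) * K" using M(2)[OF \<open>x \<in> {a..b}\<close>] K(1) by (intro mult_right_mono) auto
    finally have "(norm (prod (f x) (g x)))\<^sup>2 \<le> (M * norm (g x) * K)\<^sup>2" by (intro power_mono) auto
    then show "(norm (prod (f x) (g x)))\<^sup>2 \<le> (M * K)\<^sup>2 * (norm (g x))\<^sup>2" by (simp add: power_mult_distrib mult_ac)
  qed
qed

lemma loc_sobolev_0_continuous:
  fixes f :: "real \<Rightarrow> 'a::euclidean_space"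
  assumes f: "continuous_on UNIV f"
  shows "loc_sobolev 0 f"
proof (rule loc_sobolev_0I)
  show "f \<in> borel_measurable lebesgue" by (rule continuous_imp_measurable_lebesgue[OF f])
  fix a b
  show "\<exists>g. g integrable_on {a..b} \<and> (\<forall>x\<in>{a..b}. (norm (f x))\<^sup>2 \<le> g x)"
    by (intro exI[of _ "\<lambda>x. (norm (f x))\<^sup>2"] conjI integrable_continuous_real continuous_intros)
      (use f in \<open>auto intro: continuous_on_subset\<close>)
qed

lemma loc_sobolev_0_add:
  fixes f g :: "real \<Rightarrow> 'a::euclidean_space"
  assumes f: "loc_sobolev 0 f" and g: "loc_sobolev 0 g"
  shows "loc_sobolev 0 (\<lambda>x. f x + g x)"
proof (rule loc_sobolev_0I)
  show "(\<lambda>x. f x + g x) \<in> borel_measurable lebesgue" using f g by (auto intro: borel_measurable_add)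
  fix a b
  show "\<exists>h. h integrable_on {a..b} \<and> (\<forall>x\<in>{a..b}. (norm (f x + g x))\<^sup>2 \<le> h x)"
  proof (intro exI conjI ballI)
    show "(\<lambda>x. 2 * (norm (f x))\<^sup>2 + 2 * (norm (g x))\<^sup>2) integrable_on {a..b}"
      by (intro integrable_add integrable_on_mult_right loc_sobolev_0_square_integrable f g)
    fix x
    have "(norm (f x + g x))\<^sup>2 \<le> (norm (f x) + norm (g x))\<^sup>2" by (intro power_mono norm_triangle_ineq) auto
    also have "\<dots> \<le> 2 * (norm (f x))\<^sup>2 + 2 * (norm (g x))\<^sup>2"
      using zero_le_power2[of "norm (f x) - norm (g x)"] by (simp add: power2_sum power2_diff)
    finally show "(norm (f x + g x))\<^sup>2 \<le> 2 * (norm (f x))\<^sup>2 + 2 * (norm (g x))\<^sup>2" .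
  qed
qed

lemma indefinite_integral_continuous_UNIV:
  fixes f F :: "real \<Rightarrow> 'a::euclidean_space"
  assumes F: "\<And>a b. a \<le> b \<Longrightarrow> (f has_integral F b - F a) {a..b}"
  shows "continuous_on UNIV F"
proof -
  have "isCont F x" for x
  proof -
    have "f integrable_on {x - 1..x + 1}" using F[of "x - 1" "x + 1"] by (auto simp: integrable_on_def)
    then have "continuous_on {x - 1..x + 1} (\<lambda>t. F (x - 1) + integral {x - 1..t} f)"
      by (intro continuous_intros indefinite_integral_continuous_1)
    moreover have "F (x - 1) + integral {x - 1..t} f = F t" if "t \<in> {x - 1..x + 1}" for t
      using integral_unique[OF F[of "x - 1" t]] that by simp
    ultimately have "continuous_on {x - 1..x + 1} F" by (rule continuous_on_eq)
    then show ?thesis by (rule continuous_on_interior) simp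
  qed
  then show ?thesis by (simp add: continuous_on_eq_continuous_at)
qed

lemma loc_sobolev_Suc_continuous:
  "loc_sobolev (Suc k) f \<Longrightarrow> continuous_on UNIV f"
  by (rule indefinite_integral_continuous_UNIV) auto

lemma loc_sobolev_SucD:
  "loc_sobolev (Suc k) f \<Longrightarrow> loc_sobolev k f"
proof (induction k arbitrary: f)
  case 0
  then show ?case using loc_sobolev_0_continuous loc_sobolev_Suc_continuous by blast
next
  case (Suc k)
  then have "loc_sobolev (Suc k) (\<lambda>x. vector_derivative f (at x))" by simp
  then have "loc_sobolev k (\<lambda>x. vector_derivative f (at x))" by (rule Suc.IH)
  then show ?case using Suc.prems by simp
qed

lemma loc_sobolev_mono:
  assumes "loc_sobolev k f" "j \<le> k" shows "loc_sobolev j f"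
  using assms(2,1) by (induction rule: dec_induct) (blast dest: loc_sobolev_SucD)+

lemma loc_sobolev_continuous:
  assumes "loc_sobolev k f" "k > 0"
  shows "continuous_on UNIV f"
  using assms loc_sobolev_Suc_continuous by (cases k) auto

lemma loc_sobolev_has_integral:
  assumes "loc_sobolev k f" "k > 0" "a \<le> b"
  shows "((\<lambda>x. vector_derivative f (at x)) has_integral f b - f a) {a..b}"
  using assms by (cases k) auto

lemma continuous_integrand_has_vector_derivative:
  fixes f F :: "real \<Rightarrow> 'a::euclidean_space"
  assumes F: "\<And>a b. a \<le> b \<Longrightarrow> (f has_integral F b - F a) {a..b}" and f: "continuous_on UNIV f"
  shows "(F has_vector_derivative f x) (at x)"
proof -
  have "((\<lambda>t. F (x - 1) + integral {x - 1..t} f) has_vector_derivative 0 + f x) (at x within {x - 1..x + 1})"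
    by (intro derivative_intros integral_has_vector_derivative) (auto intro: continuous_on_subset[OF f])
  then have D: "((\<lambda>t. F (x - 1) + integral {x - 1..t} f) has_vector_derivative f x) (at x)"
    using at_within_interior[of x "{x - 1..x + 1}"] by simp
  have "F (x - 1) + integral {x - 1..t} f = F t" if "t \<in> {x - 1<..<x + 1}" for t
    using integral_unique[OF F[of "x - 1" t]] that by simp
  then show ?thesis
    by (intro has_vector_derivative_transform_within_open[OF D, of "{x - 1<..<x + 1}"]) auto
qed

lemma loc_sobolev_negligible:
  assumes "loc_sobolev k f" "k > 0"
  shows "negligible {x. \<not> (f has_vector_derivative vector_derivative f (at x)) (at x)}"
  by (rule negligible_not_vector_derivative_integral) (use assms loc_sobolev_has_integral in blast)

lemma loc_sobolev_deriv:
  assumes "loc_sobolev (Suc k) f"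
  shows "loc_sobolev k (\<lambda>x. vector_derivative f (at x))"
  using assms by simp

text \<open>From order 2 on the derivative is itself an indefinite integral, hence continuous, and
  no null set has to be excluded.\<close>

lemma loc_sobolev_has_vector_derivative:
  assumes "loc_sobolev k f" "k > 1"
  shows "(f has_vector_derivative vector_derivative f (at x)) (at x)"
proof (rule continuous_integrand_has_vector_derivative)
  obtain j where k: "k = Suc (Suc j)" using assms(2) by (metis less_imp_Suc_add add_Suc plus_1_eq_Suc)
  show "continuous_on UNIV (\<lambda>x. vector_derivative f (at x))"
    using loc_sobolev_Suc_continuous loc_sobolev_deriv assms(1) unfolding k by blast
qed (use assms loc_sobolev_has_integral in auto)

text \<open>The way to raise the order: any integrand \<open>g\<close> of order \<open>k\<close>
  will do, as the pointwise derivative is then recovered from it. At order 0 it agrees with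
  \<open>g\<close> almost everywhere; from order 1 on \<open>g\<close> is continuous and the
  agreement is everywhere.\<close>

lemma loc_sobolev_SucI:
  fixes f g :: "real \<Rightarrow> 'a::euclidean_space"
  assumes g: "loc_sobolev k g" and F: "\<And>a b. a \<le> b \<Longrightarrow> (g has_integral f b - f a) {a..b}"
  shows "loc_sobolev (Suc k) f"
    and "negligible {x. vector_derivative f (at x) \<noteq> g x}"
    and "k > 0 \<Longrightarrow> vector_derivative f (at x) = g x"
proof -
  have "negligible {x. \<not> (f has_vector_derivative g x) (at x)}"
    by (rule negligible_not_vector_derivative_integral[OF F])
  then show N: "negligible {x. vector_derivative f (at x) \<noteq> g x}"
    by (rule negligible_subset) (auto simp: vector_derivative_at)
  show E: "vector_derivative f (at x) = g x" if "k > 0" for x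
    by (intro vector_derivative_at continuous_integrand_has_vector_derivative F
         loc_sobolev_continuous[OF g that])
  have "loc_sobolev k (\<lambda>x. vector_derivative f (at x))"
  proof (cases "k = 0")
    case True
    then show ?thesis using g by (auto intro!: loc_sobolev_0_cong[OF _ N, of g] simp del: loc_sobolev.simps)
  next
    case False
    then show ?thesis using E g by simp
  qed
  moreover have "((\<lambda>x. vector_derivative f (at x)) has_integral f b - f a) {a..b}" if "a \<le> b" for a b
    using F[OF that] by (rule has_integral_spike[OF N, rotated]) auto
  ultimately show "loc_sobolev (Suc k) f" by simp
qed

lemma loc_sobolev_add:
  fixes f g :: "real \<Rightarrow> 'a::euclidean_space"
  assumes "loc_sobolev k f" "loc_sobolev k g"
  shows "loc_sobolev k (\<lambda>x. f x + g x)"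
  using assms
proof (induction k arbitrary: f g)
  case 0
  then show ?case by (rule loc_sobolev_0_add)
next
  case (Suc k)
  have "loc_sobolev k (\<lambda>x. vector_derivative f (at x) + vector_derivative g (at x))"
    by (intro Suc.IH loc_sobolev_deriv Suc.prems)
  then show ?case
  proof (rule loc_sobolev_SucI(1))
    fix a b :: real assume "a \<le> b"
    then show "((\<lambda>x. vector_derivative f (at x) + vector_derivative g (at x)) has_integral f b + g b - (f a + g a)) {a..b}"
      using has_integral_add[of "\<lambda>x. vector_derivative f (at x)" "f b - f a" "{a..b}" "\<lambda>x. vector_derivative g (at x)" "g b - g a"]
        Suc.prems by (simp add: algebra_simps)
  qed
qed

lemma loc_sobolev_const: "loc_sobolev k (\<lambda>x. c)"
proof (cases k)
  case (Suc j)
  have "loc_sobolev j (\<lambda>x. 0 :: 'a)" for j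
  proof (induction j)
    case (Suc j) then show ?case by (rule loc_sobolev_SucI(1)) auto
  qed simp
  then show ?thesis unfolding Suc by (rule loc_sobolev_SucI(1)) auto
qed (auto intro: absolutely_integrable_on_const loc_sobolev_0_continuous simp del: loc_sobolev.simps)

text \<open>Supplies the domination of increments that
  \<open>has_integral_controlled_vector_derivative\<close> asks for in the rules for products and
  reciprocals.\<close>

lemma loc_sobolev_1_increment:
  fixes f :: "real \<Rightarrow> 'a::euclidean_space"
  assumes "loc_sobolev k f" "k > 0"
  shows "(\<lambda>x. norm (vector_derivative f (at x))) integrable_on {a..b}"
    and "a \<le> b \<Longrightarrow> norm (f b - f a) \<le> integral {a..b} (\<lambda>x. norm (vector_derivative f (at x)))"
proof -
  have "loc_sobolev (Suc 0) f" using assms by (intro loc_sobolev_mono[OF assms(1)]) auto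
  then have "(\<lambda>x. vector_derivative f (at x)) absolutely_integrable_on {a..b}"
    by (intro loc_sobolev_0_absolutely_integrable loc_sobolev_deriv)
  then show i: "(\<lambda>x. norm (vector_derivative f (at x))) integrable_on {a..b}"
    by (simp add: absolutely_integrable_on_def)
  assume "a \<le> b"
  have "((\<lambda>x. vector_derivative f (at x)) has_integral f b - f a) {a..b}"
    using loc_sobolev_has_integral[OF assms \<open>a \<le> b\<close>] .
  then have "f b - f a = integral {a..b} (\<lambda>x. vector_derivative f (at x))"
    and "(\<lambda>x. vector_derivative f (at x)) integrable_on {a..b}"
    by (simp_all add: integral_unique has_integral_integrable)
  then show "norm (f b - f a) \<le> integral {a..b} (\<lambda>x. norm (vector_derivative f (at x)))"
    using integral_norm_bound_integral[OF _ i] by auto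
qed

text \<open>The product rule holds wherever both factors are differentiable, so almost everywhere.
  Both factors are bounded on the interval, hence the increments of the product are dominated by
  those of the factors.\<close>

lemma loc_sobolev_bilinear_has_integral:
  fixes f :: "real \<Rightarrow> 'a::euclidean_space" and g :: "real \<Rightarrow> 'b::euclidean_space"
    and prod :: "'a \<Rightarrow> 'b \<Rightarrow> 'c::euclidean_space"
  assumes bl: "bounded_bilinear prod" and f: "loc_sobolev j f" "j > 0" and g: "loc_sobolev k g" "k > 0"
    and ab: "a \<le> b"
  shows "((\<lambda>x. prod (f x) (vector_derivative g (at x)) + prod (vector_derivative f (at x)) (g x))
           has_integral prod (f b) (g b) - prod (f a) (g a)) {a..b}"
proof -
  interpret bounded_bilinear prod by fact
  let ?f' = "\<lambda>x. vector_derivative f (at x)" and ?g' = "\<lambda>x. vector_derivative g (at x)"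
  let ?N = "{x. \<not> (f has_vector_derivative ?f' x) (at x)} \<union> {x. \<not> (g has_vector_derivative ?g' x) (at x)}"
  obtain K where K: "K > 0" "\<And>a b. norm (prod a b) \<le> norm a * norm b * K" using pos_bounded by blast
  obtain M1 where M1: "M1 > 0" "\<And>x. x \<in> {a..b} \<Longrightarrow> norm (f x) \<le> M1"
    using continuous_bounded_interval[OF loc_sobolev_continuous[OF f]] by blast
  obtain M2 where M2: "M2 > 0" "\<And>x. x \<in> {a..b} \<Longrightarrow> norm (g x) \<le> M2"
    using continuous_bounded_interval[OF loc_sobolev_continuous[OF g]] by blast
  let ?c = "\<lambda>x. M1 * K * norm (?g' x) + M2 * K * norm (?f' x)"
  show ?thesis
  proof (rule has_integral_controlled_vector_derivative[OF ab])
    show "negligible ?N" by (intro negligible_Un loc_sobolev_negligible[OF f] loc_sobolev_negligible[OF g])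
    show "((\<lambda>x. prod (f x) (g x)) has_vector_derivative prod (f x) (?g' x) + prod (?f' x) (g x)) (at x)"
      if "x \<in> {a..b} - ?N" for x
      using that by (intro has_vector_derivative) auto
    show "?c integrable_on {a..b}"
      by (intro integrable_add integrable_on_mult_right loc_sobolev_1_increment[OF f] loc_sobolev_1_increment[OF g])
    fix x y assume xy: "a \<le> x" "x \<le> y" "y \<le> b"
    have "prod (f y) (g y) - prod (f x) (g x) = prod (f y) (g y - g x) + prod (f y - f x) (g x)"
      by (simp add: diff_left diff_right)
    also have "norm \<dots> \<le> norm (f y) * norm (g y - g x) * K + norm (f y - f x) * norm (g x) * K"
      by (rule norm_triangle_le[OF add_mono[OF K(2) K(2)]])
    also have "\<dots> \<le> M1 * norm (g y - g x) * K + norm (f y - f x) * M2 * K"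
      using xy K(1) M1 M2 by (intro add_mono mult_right_mono mult_left_mono) auto
    also have "\<dots> \<le> M1 * integral {x..y} (\<lambda>t. norm (?g' t)) * K + integral {x..y} (\<lambda>t. norm (?f' t)) * M2 * K"
      using K(1) M1(1) M2(1) xy
      by (intro add_mono mult_right_mono mult_left_mono loc_sobolev_1_increment(2)[OF f] loc_sobolev_1_increment(2)[OF g]) auto
    also have "\<dots> = integral {x..y} ?c"
      by (subst integral_add) (auto intro!: integrable_on_mult_right loc_sobolev_1_increment[OF f] loc_sobolev_1_increment[OF g])
    finally show "norm (prod (f y) (g y) - prod (f x) (g x)) \<le> integral {x..y} ?c" .
  qed
qed

text \<open>A product of two square integrable functions need not be square integrable, so at order
  0 one factor must be continuous; this is the \<open>max k 1\<close>. Differentiation lowers the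
  order of either factor in turn, and the induction therefore runs over a hypothesis that allows the
  weaker factor on both sides.\<close>

lemma loc_sobolev_bilinear_mixed:
  fixes f :: "real \<Rightarrow> 'a::euclidean_space" and g :: "real \<Rightarrow> 'b::euclidean_space"
    and prod :: "'a \<Rightarrow> 'b \<Rightarrow> 'c::euclidean_space"
  assumes "bounded_bilinear prod" "loc_sobolev (max k 1) f" "loc_sobolev k g"
  shows "loc_sobolev k (\<lambda>x. prod (f x) (g x))"
proof -
  have "loc_sobolev k (\<lambda>x. prod (f x) (g x))"
    if "bounded_bilinear prod" "loc_sobolev (max k 1) f \<and> loc_sobolev k g \<or> loc_sobolev k f \<and> loc_sobolev (max k 1) g"
    for prod :: "'a \<Rightarrow> 'b \<Rightarrow> 'c" and f g
    using that
  proof (induction k arbitrary: f g)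
    case 0
    show ?case
    proof (cases "loc_sobolev 1 f \<and> loc_sobolev 0 g")
      case True
      then show ?thesis by (intro loc_sobolev_0_bilinear[OF 0(1)] loc_sobolev_continuous[of 1 f]) auto
    next
      case False
      then have fg: "loc_sobolev 0 f" "loc_sobolev 1 g" using 0(2) unfolding max_0L by blast+
      show ?thesis
        by (rule loc_sobolev_0_bilinear[OF bounded_bilinear.flip[OF 0(1)] loc_sobolev_continuous[OF fg(2)] fg(1)]) simp
    qed
  next
    case (Suc k)
    then have f: "loc_sobolev (Suc k) f" and g: "loc_sobolev (Suc k) g" by auto
    have "max k 1 \<le> Suc k" by simp
    then have f1: "loc_sobolev (max k 1) f" and g1: "loc_sobolev (max k 1) g"
      using f g loc_sobolev_mono by blast+
    have "loc_sobolev k (\<lambda>x. prod (f x) (vector_derivative g (at x)) + prod (vector_derivative f (at x)) (g x))"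
      by (intro loc_sobolev_add Suc.IH Suc.prems) (use f g f1 g1 in auto)
    then show ?case
      by (rule loc_sobolev_SucI(1)) (rule loc_sobolev_bilinear_has_integral[OF Suc.prems(1) f _ g], auto)
  qed
  then show ?thesis using assms by blast
qed

lemma loc_sobolev_scaleR:
  fixes g :: "real \<Rightarrow> 'b::euclidean_space"
  assumes "loc_sobolev (max k 1) f" "loc_sobolev k g"
  shows "loc_sobolev k (\<lambda>x. f x *\<^sub>R g x)"
  using loc_sobolev_bilinear_mixed[OF bounded_bilinear_scaleR assms] .

lemma loc_sobolev_cmul:
  fixes g :: "real \<Rightarrow> 'b::euclidean_space"
  assumes "loc_sobolev k g"
  shows "loc_sobolev k (\<lambda>x. c *\<^sub>R g x)"
  using loc_sobolev_scaleR[OF loc_sobolev_const assms] .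

lemma loc_sobolev_diff:
  fixes f g :: "real \<Rightarrow> 'a::euclidean_space"
  assumes "loc_sobolev k f" "loc_sobolev k g"
  shows "loc_sobolev k (\<lambda>x. f x - g x)"
  using loc_sobolev_add[OF assms(1) loc_sobolev_cmul[OF assms(2), of "-1"]] by simp

lemma norm_inverse_diff_le:
  fixes u v :: "'a::real_normed_vector"
  assumes "m > 0" "m \<le> norm u" "m \<le> norm v"
  shows "norm (1 / norm v - 1 / norm u) \<le> norm (v - u) / m\<^sup>2"
proof -
  have pos: "norm u > 0" "norm v > 0" using assms by linarith+
  have "1 / norm v - 1 / norm u = (norm u - norm v) / (norm v * norm u)" using pos by (simp add: field_simps)
  then have "norm (1 / norm v - 1 / norm u) = \<bar>norm u - norm v\<bar> / (norm v * norm u)" by (simp add: abs_mult)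
  also have "\<dots> \<le> norm (v - u) / m\<^sup>2"
    unfolding power2_eq_square using assms pos norm_triangle_ineq3[of u v]
    by (intro frac_le mult_mono) (auto simp: norm_minus_commute)
  finally show ?thesis .
qed

text \<open>A continuous \<open>v\<close> without zeros has norm bounded away from 0 on the
  interval, and there the reciprocal of the norm is Lipschitz as a function of \<open>v\<close>. So
  its increments are dominated by those of \<open>v\<close>.\<close>

lemma loc_sobolev_inverse_norm_has_integral:
  fixes v :: "real \<Rightarrow> 'a::euclidean_space"
  assumes v: "loc_sobolev k v" "k > 0" and nz: "\<And>x. v x \<noteq> 0" and ab: "a \<le> b"
  shows "((\<lambda>x. - ((1 / norm (v x)) ^ 3 * (v x \<bullet> vector_derivative v (at x)))) has_integral 1 / norm (v b) - 1 / norm (v a)) {a..b}"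
proof -
  let ?v' = "\<lambda>x. vector_derivative v (at x)"
  have cv: "continuous_on UNIV v" using loc_sobolev_continuous[OF v] .
  have "continuous_on UNIV (\<lambda>x. 1 / norm (v x))" using cv nz by (intro continuous_intros) auto
  then obtain M where M: "M > 0" "\<And>x. x \<in> {a..b} \<Longrightarrow> norm (1 / norm (v x)) \<le> M"
    using continuous_bounded_interval by blast
  have low: "1 / M \<le> norm (v x)" if "x \<in> {a..b}" for x
    using M(2)[OF that] M(1) nz[of x] by (simp add: field_simps)
  show ?thesis
  proof (rule has_integral_controlled_vector_derivative[OF ab loc_sobolev_negligible[OF v]])
    show "(\<lambda>x. M\<^sup>2 * norm (?v' x)) integrable_on {a..b}"
      by (intro integrable_on_mult_right loc_sobolev_1_increment[OF v])
    show "norm (1 / norm (v y) - 1 / norm (v x)) \<le> integral {x..y} (\<lambda>x. M\<^sup>2 * norm (?v' x))"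
      if "a \<le> x" "x \<le> y" "y \<le> b" for x y
    proof -
      have "norm (1 / norm (v y) - 1 / norm (v x)) \<le> norm (v y - v x) / (1 / M)\<^sup>2"
        using M(1) that by (intro norm_inverse_diff_le low) auto
      also have "\<dots> = M\<^sup>2 * norm (v y - v x)" by (simp add: power_one_over)
      also have "\<dots> \<le> M\<^sup>2 * integral {x..y} (\<lambda>x. norm (?v' x))"
        by (intro mult_left_mono loc_sobolev_1_increment(2)[OF v]) (use that in auto)
      finally show ?thesis by simp
    qed
    fix x assume "x \<in> {a..b} - {x. \<not> (v has_vector_derivative ?v' x) (at x)}"
    then have "(v has_derivative (\<lambda>h. h *\<^sub>R ?v' x)) (at x)" by (simp add: has_vector_derivative_def)
    from has_derivative_compose[OF this has_derivative_norm[OF nz]]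
    have "((\<lambda>x. norm (v x)) has_derivative (\<lambda>h. (h *\<^sub>R ?v' x) \<bullet> sgn (v x))) (at x)" .
    moreover have "norm (v x) > 0" using nz by simp
    ultimately have "((\<lambda>x. 1 / norm (v x)) has_derivative (\<lambda>h. h *\<^sub>R (- ((1 / norm (v x)) ^ 3 * (v x \<bullet> ?v' x))))) (at x)"
      by (auto intro!: derivative_eq_intros simp: nz fun_eq_iff sgn_div_norm power3_eq_cube field_simps inner_commute power2_eq_square)
    then show "((\<lambda>x. 1 / norm (v x)) has_vector_derivative - ((1 / norm (v x)) ^ 3 * (v x \<bullet> ?v' x))) (at x)"
      by (simp only: has_vector_derivative_def)
  qed
qed

text \<open>The derivative is a product of three copies of the reciprocal itself, of
  \<open>v\<close> and of the derivative of \<open>v\<close>. By induction the reciprocal already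
  has the order of the derivative of \<open>v\<close>, and products preserve that order. At the
  bottom the reciprocal is merely continuous, which suffices at order 0.\<close>

lemma loc_sobolev_inverse_norm:
  fixes v :: "real \<Rightarrow> 'a::euclidean_space"
  assumes "loc_sobolev (Suc k) v" "\<And>x. v x \<noteq> 0"
  shows "loc_sobolev (Suc k) (\<lambda>x. 1 / norm (v x))"
  using assms(1)
proof (induction k)
  case 0
  let ?v' = "\<lambda>x. vector_derivative v (at x)"
  have cv: "continuous_on UNIV v" using loc_sobolev_continuous[OF 0] by simp
  have "loc_sobolev 0 (\<lambda>x. v x \<bullet> ?v' x)"
    by (rule loc_sobolev_0_bilinear[OF bounded_bilinear_inner cv loc_sobolev_deriv[OF 0]])
  then have "loc_sobolev 0 (\<lambda>x. - ((1 / norm (v x)) ^ 3 * (v x \<bullet> ?v' x)))"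
    using loc_sobolev_0_bilinear[OF bounded_bilinear_mult, of "\<lambda>x. - ((1 / norm (v x)) ^ 3)"]
      continuous_on_minus[OF continuous_on_power[OF continuous_on_divide[OF continuous_on_const continuous_on_norm[OF cv]]]]
      assms(2) by fastforce
  then show ?case
    by (rule loc_sobolev_SucI(1)) (rule loc_sobolev_inverse_norm_has_integral[OF 0 _ assms(2)], auto)
next
  case (Suc k)
  let ?v' = "\<lambda>x. vector_derivative v (at x)" and ?r = "\<lambda>x. 1 / norm (v x)"
  have v: "loc_sobolev (Suc k) v" by (rule loc_sobolev_SucD[OF Suc.prems])
  have r: "loc_sobolev (Suc k) ?r" by (rule Suc.IH[OF v])
  have mul: "loc_sobolev (Suc k) (\<lambda>x. f x * g x)" if "loc_sobolev (Suc k) f" "loc_sobolev (Suc k) g"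
    for f g :: "real \<Rightarrow> real"
    using loc_sobolev_bilinear_mixed[OF bounded_bilinear_mult, of "Suc k" f g] that by simp
  have "loc_sobolev (Suc k) (\<lambda>x. v x \<bullet> ?v' x)"
    using loc_sobolev_bilinear_mixed[OF bounded_bilinear_inner, of "Suc k" v ?v'] v Suc.prems by simp
  then have "loc_sobolev (Suc k) (\<lambda>x. (?r x * (?r x * ?r x)) * (v x \<bullet> ?v' x))"
    by (rule mul[OF mul[OF r mul[OF r r]]])
  then have "loc_sobolev (Suc k) (\<lambda>x. - ((1 / norm (v x)) ^ 3 * (v x \<bullet> ?v' x)))"
    using loc_sobolev_cmul[of "Suc k" _ "-1"] by (fastforce simp: power3_eq_cube mult_ac)
  then show ?case
    by (rule loc_sobolev_SucI(1)) (rule loc_sobolev_inverse_norm_has_integral[OF Suc.prems _ assms(2)], auto)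
qed

subsection \<open>Periodic functions\<close>

lemma integrable_continuous_UNIV:
  fixes f :: "real \<Rightarrow> 'a::banach"
  shows "continuous_on UNIV f \<Longrightarrow> f integrable_on {a..b}"
  by (rule integrable_continuous_real) (rule continuous_on_subset, auto)

lemma periodic_int_shift:
  assumes "periodic f"
  shows "f (x + 2 * pi * of_int k) = f x"
proof (induction k rule: int_induct[where k = 0])
  case (step1 i)
  have "f (x + 2 * pi * of_int (i + 1)) = f ((x + 2 * pi * of_int i) + 2 * pi)" by (simp add: algebra_simps)
  also have "\<dots> = f (x + 2 * pi * of_int i)" using assms unfolding periodic_def by blast
  finally show ?case using step1 by simp
next
  case (step2 i)
  have "f (x + 2 * pi * of_int i) = f ((x + 2 * pi * of_int (i - 1)) + 2 * pi)" by (simp add: algebra_simps)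
  also have "\<dots> = f (x + 2 * pi * of_int (i - 1))" using assms unfolding periodic_def by blast
  finally show ?case using step2 by simp
qed simp

lemma periodic_reduce:
  obtains y where "y \<in> {0..2 * pi}" "\<And>f :: real \<Rightarrow> 'b. periodic f \<Longrightarrow> f x = f y"
proof -
  define k where "k = \<lfloor>x / (2 * pi)\<rfloor>"
  define y where "y = x - 2 * pi * of_int k"
  have "of_int k \<le> x / (2 * pi)" "x / (2 * pi) < of_int k + 1" unfolding k_def by linarith+
  then have "y \<in> {0..2 * pi}" by (simp add: y_def field_simps)
  moreover have "f x = f y" if "periodic f" for f :: "real \<Rightarrow> 'b"
    using periodic_int_shift[OF that, of y k] by (simp add: y_def)
  ultimately show thesis using that by blast
qed

lemma periodic_vector_derivative:
  fixes f :: "real \<Rightarrow> 'b::real_normed_vector"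
  assumes "periodic f"
  shows "periodic (\<lambda>x. vector_derivative f (at x))"
proof -
  have D: "(f has_vector_derivative D) (at (x + c))" if "(f has_vector_derivative D) (at x)" "\<And>y. f (y - c) = f y" for x D c
  proof -
    have "((\<lambda>y. y - c) has_vector_derivative 1) (at (x + c))" by (auto intro!: derivative_eq_intros)
    then have "(f \<circ> (\<lambda>y. y - c) has_vector_derivative 1 *\<^sub>R D) (at (x + c))"
      by (rule vector_diff_chain_at) (use that in simp)
    then show ?thesis using that(2) by (simp add: o_def)
  qed
  have "f (y - 2 * pi) = f y" for y using assms unfolding periodic_def by (metis diff_add_cancel)
  then have "(f has_vector_derivative D) (at (x + 2 * pi)) \<longleftrightarrow> (f has_vector_derivative D) (at x)" for x D
    using D[of D x "2 * pi"] D[of D "x + 2 * pi" "- (2 * pi)"] assms by (auto simp: periodic_def)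
  then show ?thesis by (simp add: periodic_def vector_derivative_def)
qed

lemma has_integral_periodic_shift:
  assumes "periodic f"
  shows "(f has_integral I) {a + 2 * pi..b + 2 * pi} \<longleftrightarrow> (f has_integral I) {a..b}"
proof -
  have "f \<circ> (+) (2 * pi) = f" using assms by (auto simp: periodic_def add.commute fun_eq_iff)
  then show ?thesis using has_integral_shift_Icc_real[of f "2 * pi" I a b] by simp
qed

lemma integrable_on_periodic:
  fixes f :: "real \<Rightarrow> 'b::banach"
  assumes per: "periodic f" and f: "f integrable_on {0..2 * pi}"
  shows "f integrable_on {a..b}"
proof -
  have shift: "f integrable_on {a + 2 * pi..b + 2 * pi} \<longleftrightarrow> f integrable_on {a..b}" for a b
    using has_integral_periodic_shift[OF per] by (simp add: integrable_on_def)
  have r: "f integrable_on {0..2 * pi * real N}" for N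
  proof (induction N)
    case (Suc N)
    have "f integrable_on {2 * pi * real N..2 * pi * real N + 2 * pi}"
    proof (induction N)
      case (Suc N)
      then show ?case using shift[of "2 * pi * real N" "2 * pi * real N + 2 * pi"] by (simp add: algebra_simps)
    qed (use f in simp)
    then show ?case
      using Henstock_Kurzweil_Integration.integrable_combine[of 0 "2 * pi * real N" "2 * pi * real N + 2 * pi" f] Suc by (simp add: algebra_simps)
  qed (use integrable_on_refl[of f 0] in simp)
  have l: "f integrable_on {2 * pi * (real M - real N)..2 * pi * real M}" for N M
  proof (induction N)
    case (Suc N)
    have "f integrable_on {2 * pi * (real M - real N) - 2 * pi..2 * pi * real M - 2 * pi}"
      using Suc shift[of "2 * pi * (real M - real N) - 2 * pi" "2 * pi * real M - 2 * pi"] by simp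
    moreover have "f integrable_on {2 * pi * (real M - 1)..2 * pi * real M}"
    proof (induction M)
      case 0
      then show ?case using f shift[of "- (2 * pi)" 0] by simp
    next
      case (Suc M)
      then show ?case using shift[of "2 * pi * (real M - 1)" "2 * pi * real M"] by (simp add: algebra_simps)
    qed
    ultimately show ?case
      using Henstock_Kurzweil_Integration.integrable_combine[of "2 * pi * (real M - real (Suc N))" "2 * pi * (real M - 1)" "2 * pi * real M" f]
      by (simp add: algebra_simps)
  qed (use integrable_on_refl[of f "2 * pi * real M"] in simp)
  obtain N :: nat where "\<bar>a\<bar> + \<bar>b\<bar> \<le> real N" using real_arch_simple by blast
  moreover have "1 * real N \<le> (2 * pi) * real N" using pi_gt3 by (intro mult_right_mono) auto
  ultimately have "{a..b} \<subseteq> {2 * pi * (real N - real (2 * N))..2 * pi * real N}" by auto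
  then show ?thesis by (rule integrable_on_subinterval[OF l])
qed

lemma L2_circle_loc_sobolev:
  assumes "g \<in> L2_circle"
  shows "loc_sobolev 0 g" and "periodic g"
proof -
  show per: "periodic g" using assms by (simp add: L2_circle_def)
  then have per2: "periodic (\<lambda>x. (norm (g x))\<^sup>2)" by (simp add: periodic_def)
  have "(\<lambda>x. (norm (g x))\<^sup>2) integrable_on {0..2 * pi}"
    using assms set_lebesgue_integral_eq_integral(1) by (auto simp: L2_circle_def)
  then show "loc_sobolev 0 g"
    using assms integrable_on_periodic[OF per2] by (intro loc_sobolev_0I) (auto simp: L2_circle_def)
qed

lemma circle_integral_eq_integral:
  fixes f :: "real \<Rightarrow> 'a::euclidean_space"
  assumes "f absolutely_integrable_on {0..2 * pi}"
  shows "circle_integral f = integral {0..2 * pi} f"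
  using assms by (simp add: circle_integral_def set_lebesgue_integral_eq_integral)

lemma circle_integral_loc_sobolev:
  "loc_sobolev k f \<Longrightarrow> circle_integral f = integral {0..2 * pi} f"
  by (intro circle_integral_eq_integral loc_sobolev_0_absolutely_integrable) (use loc_sobolev_mono in blast)

text \<open>Mean zero of \<open>g\<close> is what makes its primitive periodic. The primitive is
  normalized to mean zero in turn, so that the construction can be iterated.\<close>

lemma loc_sobolev_primitive:
  fixes g :: "real \<Rightarrow> 'a::euclidean_space"
  assumes g: "loc_sobolev k g" "periodic g" "integral {0..2 * pi} g = 0"
  obtains F where "loc_sobolev (Suc k) F" "periodic F" "integral {0..2 * pi} F = 0"
    "\<And>a b. a \<le> b \<Longrightarrow> (g has_integral F b - F a) {a..b}"
proof -
  have "loc_sobolev 0 g" using loc_sobolev_mono[OF g(1)] by blast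
  then have int: "g integrable_on {a..b}" for a b
    using loc_sobolev_0_absolutely_integrable set_lebesgue_integral_eq_integral(1) by blast
  \<comment> \<open>The integral over \<open>{0..x}\<close> is that over an empty set when
    \<open>x\<close> is negative, so the oriented integral is put together by cases.\<close>
  define P where "P x = (if 0 \<le> x then integral {0..x} g else - integral {x..0} g)" for x
  have P: "(g has_integral P b - P a) {a..b}" if "a \<le> b" for a b
  proof -
    have "integral {a..b} g = P b - P a"
      using that Henstock_Kurzweil_Integration.integral_combine[of 0 a b g] Henstock_Kurzweil_Integration.integral_combine[of a 0 b g]
        Henstock_Kurzweil_Integration.integral_combine[of a b 0 g] int
      by (cases "0 \<le> a"; cases "0 \<le> b") (auto simp: P_def algebra_simps)
    then show ?thesis using int[of a b] by (metis integrable_integral)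
  qed
  have "P (x + 2 * pi) = P x" for x
  proof -
    have *: "P (b + 2 * pi) - P (a + 2 * pi) = P b - P a" if "a \<le> b" for a b
      using has_integral_unique[OF P[of "a + 2 * pi" "b + 2 * pi"]] P[OF that] that
        has_integral_periodic_shift[OF g(2)] by force
    have "P (0 + 2 * pi) = P 0" using g(3) by (simp add: P_def)
    then show ?thesis using *[of 0 x] *[of x 0] by (cases "0 \<le> x") auto
  qed
  then have per: "periodic P" by (simp add: periodic_def)
  define F where "F x = P x - (1 / (2 * pi)) *\<^sub>R integral {0..2 * pi} P" for x
  have FP: "F b - F a = P b - P a" for a b by (simp add: F_def)
  have int_P: "P integrable_on {0..2 * pi}"
    by (intro integrable_continuous_UNIV indefinite_integral_continuous_UNIV[OF P])
  show thesis
  proof (rule that[of F])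
    show "loc_sobolev (Suc k) F" by (rule loc_sobolev_SucI(1)[OF g(1)]) (simp add: P FP)
    show "periodic F" using per by (simp add: F_def periodic_def)
    show "integral {0..2 * pi} F = 0"
      unfolding F_def using int_P by (subst Henstock_Kurzweil_Integration.integral_diff) auto
  qed (simp add: P FP)
qed

subsection \<open>Test functions\<close>

definition test_fun :: "(real \<Rightarrow> real) \<Rightarrow> bool" where
  "test_fun \<phi> \<longleftrightarrow> smooth_fun_on UNIV \<phi> \<and> periodic \<phi>"

lemma test_fun_DERIV:
  assumes "test_fun \<phi>"
  shows "(\<phi> has_real_derivative deriv \<phi> x) (at x)"
proof -
  have "(deriv ^^ 0) \<phi> differentiable (at x)" using assms unfolding test_fun_def smooth_fun_on_def by blast
  then show ?thesis by (simp add: DERIV_deriv_iff_real_differentiable)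
qed

lemma test_fun_vector_derivative:
  "test_fun \<phi> \<Longrightarrow> vector_derivative \<phi> (at x) = deriv \<phi> x"
  using test_fun_DERIV has_real_derivative_iff_has_vector_derivative vector_derivative_at by blast

lemma test_fun_deriv:
  assumes "test_fun \<phi>"
  shows "test_fun (deriv \<phi>)"
  unfolding test_fun_def
proof
  show "smooth_fun_on UNIV (deriv \<phi>)"
    unfolding smooth_fun_on_def
  proof (intro allI ballI)
    fix k x
    have "(deriv ^^ Suc k) \<phi> differentiable (at x)" using assms unfolding test_fun_def smooth_fun_on_def by blast
    then show "(deriv ^^ k) (deriv \<phi>) differentiable (at x)" by (simp add: funpow_swap1)
  qed
  show "periodic (deriv \<phi>)"
    using periodic_vector_derivative[of \<phi>] assms test_fun_vector_derivative[OF assms] by (simp add: test_fun_def)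
qed

lemma test_fun_funpow_deriv:
  "test_fun \<phi> \<Longrightarrow> test_fun ((deriv ^^ k) \<phi>)"
  by (induction k) (auto intro: test_fun_deriv)

lemma test_fun_continuous: "test_fun \<phi> \<Longrightarrow> continuous_on UNIV \<phi>"
  using test_fun_DERIV by (auto intro!: continuous_at_imp_continuous_on intro: DERIV_isCont)

lemma test_fun_loc_sobolev_1:
  assumes "test_fun \<phi>"
  shows "loc_sobolev 1 \<phi>"
proof -
  have "loc_sobolev 0 (deriv \<phi>)" by (intro loc_sobolev_0_continuous test_fun_continuous test_fun_deriv assms)
  then have "loc_sobolev (Suc 0) \<phi>"
  proof (rule loc_sobolev_SucI(1))
    fix a b :: real assume "a \<le> b"
    then show "(deriv \<phi> has_integral \<phi> b - \<phi> a) {a..b}"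
    proof (rule fundamental_theorem_of_calculus)
      fix x
      show "(\<phi> has_vector_derivative deriv \<phi> x) (at x within {a..b})"
        using test_fun_DERIV[OF assms, of x] unfolding has_real_derivative_iff_has_vector_derivative
        by (rule has_vector_derivative_at_within)
    qed
  qed
  then show ?thesis by simp
qed

lemma test_fun_primitive:
  assumes "test_fun \<psi>" "integral {0..2 * pi} \<psi> = 0"
  obtains \<phi> where "test_fun \<phi>" "integral {0..2 * pi} \<phi> = 0" "deriv \<phi> = \<psi>"
proof -
  have per: "periodic \<psi>" using assms(1) by (simp add: test_fun_def)
  obtain F where "loc_sobolev (Suc 1) F" and F: "periodic F" "integral {0..2 * pi} F = 0" "\<And>a b. a \<le> b \<Longrightarrow> (\<psi> has_integral F b - F a) {a..b}"
    by (rule loc_sobolev_primitive[OF test_fun_loc_sobolev_1[OF assms(1)] per assms(2)]) (rule that)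
  have D: "(F has_real_derivative \<psi> x) (at x)" for x
    unfolding has_real_derivative_iff_has_vector_derivative
    by (rule continuous_integrand_has_vector_derivative[OF F(3) test_fun_continuous[OF assms(1)]])
  then have dF: "deriv F = \<psi>" by (auto intro!: DERIV_imp_deriv)
  have "smooth_fun_on UNIV F"
    unfolding smooth_fun_on_def
  proof (intro allI ballI)
    fix k x
    show "(deriv ^^ k) F differentiable (at x)"
    proof (cases k)
      case 0
      then show ?thesis using D real_differentiable_def by auto
    next
      case (Suc j)
      have "(deriv ^^ j) \<psi> differentiable (at x)" using assms(1) unfolding test_fun_def smooth_fun_on_def by blast
      then show ?thesis by (simp add: Suc funpow_swap1 dF)
    qed
  qed
  then show thesis using that F dF unfolding test_fun_def by blast
qed

text \<open>A weak equation of order \<open>n\<close> can only be tested with \<open>n\<close>-th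
  derivatives; by this lemma that includes every test function of mean zero.\<close>

lemma test_fun_iterated_primitive:
  assumes "test_fun \<psi>" "integral {0..2 * pi} \<psi> = 0"
  obtains \<phi> where "test_fun \<phi>" "(deriv ^^ n) \<phi> = \<psi>"
proof -
  have "\<exists>\<phi>. test_fun \<phi> \<and> integral {0..2 * pi} \<phi> = 0 \<and> (deriv ^^ n) \<phi> = \<psi>"
  proof (induction n)
    case 0
    then show ?case using assms by auto
  next
    case (Suc n)
    then obtain \<xi> where \<xi>: "test_fun \<xi>" "integral {0..2 * pi} \<xi> = 0" "(deriv ^^ n) \<xi> = \<psi>" by blast
    obtain \<phi> where "test_fun \<phi>" "integral {0..2 * pi} \<phi> = 0" "deriv \<phi> = \<xi>"
      using test_fun_primitive[OF \<xi>(1,2)] by blast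
    then show ?case using \<xi> by (intro exI[of _ \<phi>]) (simp add: funpow_swap1)
  qed
  then show thesis using that by blast
qed

text \<open>Closed under differentiation, so smoothness comes by iteration, and closed under sums
  and products, so Stone-Weierstrass gives density. These functions serve here where bump functions
  are customary.\<close>

inductive trig_poly :: "(real \<Rightarrow> real) \<Rightarrow> bool" where
  trig_const: "trig_poly (\<lambda>x. c)"
| trig_sin: "trig_poly sin"
| trig_cos: "trig_poly cos"
| trig_add: "trig_poly f \<Longrightarrow> trig_poly g \<Longrightarrow> trig_poly (\<lambda>x. f x + g x)"
| trig_mult: "trig_poly f \<Longrightarrow> trig_poly g \<Longrightarrow> trig_poly (\<lambda>x. f x * g x)"

lemma trig_poly_derivative:
  "trig_poly f \<Longrightarrow> \<exists>f'. trig_poly f' \<and> (\<forall>x. (f has_real_derivative f' x) (at x))"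
proof (induction rule: trig_poly.induct)
  case (trig_const c)
  then show ?case by (intro exI[of _ "\<lambda>x. 0"]) (auto intro: trig_poly.intros)
next
  case trig_sin
  then show ?case by (intro exI[of _ cos]) (auto intro: trig_poly.intros DERIV_sin)
next
  case trig_cos
  then show ?case
    by (intro exI[of _ "\<lambda>x. -1 * sin x"] conjI trig_poly.intros) (auto intro!: derivative_eq_intros)
next
  case (trig_add f g)
  then obtain f' g' where "trig_poly f'" "\<forall>x. (f has_real_derivative f' x) (at x)"
      "trig_poly g'" "\<forall>x. (g has_real_derivative g' x) (at x)" by blast
  then show ?case by (intro exI[of _ "\<lambda>x. f' x + g' x"]) (auto intro!: trig_poly.intros DERIV_add)
next
  case (trig_mult f g)
  then obtain f' g' where "trig_poly f'" "\<forall>x. (f has_real_derivative f' x) (at x)"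
      "trig_poly g'" "\<forall>x. (g has_real_derivative g' x) (at x)" by blast
  then show ?case using trig_mult
    by (intro exI[of _ "\<lambda>x. f' x * g x + g' x * f x"]) (auto intro!: trig_poly.intros DERIV_mult)
qed

lemma trig_poly_test_fun:
  assumes "trig_poly f"
  shows "test_fun f"
  unfolding test_fun_def
proof
  have d: "trig_poly (deriv g) \<and> (\<forall>x. g differentiable (at x))" if g: "trig_poly g" for g
  proof -
    obtain g' where g': "trig_poly g'" "\<And>x. (g has_real_derivative g' x) (at x)" using trig_poly_derivative[OF g] by blast
    then have "deriv g = g'" by (auto intro!: DERIV_imp_deriv)
    then show ?thesis using g' real_differentiable_def by blast
  qed
  have "trig_poly ((deriv ^^ k) f)" for k by (induction k) (use assms d in auto)
  then show "smooth_fun_on UNIV f" unfolding smooth_fun_on_def using d by blast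
  show "periodic f" using assms by (induction rule: trig_poly.induct) (auto simp: periodic_def)
qed

text \<open>Near any point of the circle one of the two angles \<open>Arg\<close> and
  \<open>Arg2pi\<close> is continuous: their jumps lie on opposite half-axes. They differ by a
  multiple of the period, so \<open>f\<close> does not distinguish them.\<close>

lemma continuous_on_circle_factor:
  fixes f :: "real \<Rightarrow> 'b::topological_space"
  assumes per: "periodic f" and f: "continuous_on UNIV f"
  shows "continuous_on (sphere 0 1) (\<lambda>z. f (Arg z))" and "f (Arg (cis \<theta>)) = f \<theta>"
proof -
  have eq: "f x = f y" if "cis x = cis y" for x y
  proof -
    have "sin x = sin y \<and> cos x = cos y" using that by (simp add: complex_eq_iff)
    then obtain n :: int where "x = y + 2 * pi * n" using sin_cos_eq_iff by blast
    then show ?thesis using periodic_int_shift[OF per] by simp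
  qed
  show "f (Arg (cis \<theta>)) = f \<theta>" by (rule eq) (simp add: cis_Arg sgn_eq)
  have fc: "continuous (at x) f" for x using f by (simp add: continuous_on_eq_continuous_at)
  have "continuous (at z within sphere 0 1) (\<lambda>z. f (Arg z))" if z: "z \<in> sphere 0 1" for z
  proof (cases "z \<in> \<real>\<^sub>\<le>\<^sub>0")
    case False
    then show ?thesis
      using continuous_at_compose[OF continuous_at_Arg[OF False] fc, unfolded o_def] continuous_at_imp_continuous_at_within by blast
  next
    case True
    then have "z \<notin> \<real>\<^sub>\<ge>\<^sub>0" using z by (auto simp: nonneg_Reals_def nonpos_Reals_def)
    then have "continuous (at z within sphere 0 1) (\<lambda>z. f (Arg2pi z))"
      using continuous_at_compose[OF continuous_at_Arg2pi fc, unfolded o_def] continuous_at_imp_continuous_at_within by blast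
    moreover have "f (Arg2pi w) = f (Arg w)" if "w \<in> sphere 0 1" for w
    proof (rule eq)
      have w: "norm w = 1" "w \<noteq> 0" using that by auto
      then have "cis (Arg w) = w" by (simp add: cis_Arg sgn_eq)
      moreover have "cis (Arg2pi w) = w" using Arg2pi_eq[of w] w(1) by (metis cis_conv_exp mult_1 of_real_1)
      ultimately show "cis (Arg2pi w) = cis (Arg w)" by simp
    qed
    ultimately show ?thesis by (rule continuous_transform_within[OF _ zero_less_one z])
  qed
  then show "continuous_on (sphere 0 1) (\<lambda>z. f (Arg z))" by (simp add: continuous_on_eq_continuous_within)
qed

text \<open>On the unit circle the real linear functionals of the plane are combinations of
  \<open>cos\<close> and \<open>sin\<close>, so real polynomials there are trigonometric
  polynomials.\<close>

lemma trig_poly_approximation: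
  assumes "periodic f" "continuous_on UNIV f" "e > 0"
  obtains p where "trig_poly p" "\<And>x. \<bar>f x - p x\<bar> < e"
proof -
  obtain g where g: "real_polynomial_function g" "\<And>z. z \<in> sphere 0 1 \<Longrightarrow> \<bar>f (Arg z) - g z\<bar> < e"
    using Stone_Weierstrass_real_polynomial_function[OF compact_sphere continuous_on_circle_factor(1)[OF assms(1,2)] assms(3)]
    by blast
  have "trig_poly (\<lambda>x. g (cis x))"
    using g(1)
  proof (induction rule: real_polynomial_function.induct)
    case (linear h)
    then interpret bounded_linear h .
    have "h (cis x) = h 1 * cos x + h \<i> * sin x" for x
    proof -
      have "cis x = cos x *\<^sub>R 1 + sin x *\<^sub>R \<i>" by (simp add: complex_eq_iff)
      then show ?thesis by (simp add: add scaleR)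
    qed
    then show ?case by (auto intro!: trig_poly.intros)
  qed (auto intro: trig_poly.intros)
  moreover have "\<bar>f x - g (cis x)\<bar> < e" for x
    using g(2)[of "cis x"] continuous_on_circle_factor(2)[OF assms(1,2)] by simp
  ultimately show thesis using that by blast
qed

subsection \<open>Regularity of Sobolev functions\<close>

text \<open>For a trigonometric polynomial \<open>p\<close> close to \<open>f\<close>, the integral
  of the square of \<open>f\<close> equals that of \<open>(f - p) * f\<close> and is small. The
  tolerance below is \<open>e\<close> divided by the period and by a bound of \<open>f\<close>.
  Continuity then excludes nonzero values.\<close>

lemma orthogonal_to_trig_poly_imp_zero:
  fixes f :: "real \<Rightarrow> real"
  assumes per: "periodic f" and f: "continuous_on UNIV f"
    and orth: "\<And>p. trig_poly p \<Longrightarrow> integral {0..2 * pi} (\<lambda>x. p x * f x) = 0"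
  shows "f x = 0"
proof -
  let ?I = "integral {0..2 * pi}"
  note int = integrable_continuous_UNIV
  obtain M where M: "M > 0" "\<And>x. x \<in> {0..2 * pi} \<Longrightarrow> norm (f x) \<le> M" using continuous_bounded_interval[OF f] by blast
  have "?I (\<lambda>x. f x * f x) \<le> e" if e: "e > 0" for e
  proof -
    have pos: "e / (2 * pi * M) > 0" using e M(1) by simp
    obtain p where p: "trig_poly p" "\<And>x. \<bar>f x - p x\<bar> < e / (2 * pi * M)"
      by (rule trig_poly_approximation[OF per f pos]) (rule that)
    have pc: "continuous_on UNIV p" using p(1) trig_poly_test_fun test_fun_continuous by blast
    have "?I (\<lambda>x. f x * f x) = ?I (\<lambda>x. (f x - p x) * f x + p x * f x)"
      by (simp add: algebra_simps)
    also have "\<dots> = ?I (\<lambda>x. (f x - p x) * f x) + ?I (\<lambda>x. p x * f x)"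
      by (intro integral_add int continuous_intros f pc)
    also have "\<dots> = ?I (\<lambda>x. (f x - p x) * f x)" using orth[OF p(1)] by simp
    also have "\<dots> \<le> ?I (\<lambda>x. e / (2 * pi))"
    proof (rule integral_le)
      fix x assume x: "x \<in> {0..2 * pi}"
      have "(f x - p x) * f x \<le> \<bar>f x - p x\<bar> * \<bar>f x\<bar>" by (metis abs_ge_self abs_mult)
      also have "\<dots> \<le> e / (2 * pi * M) * M" using p(2)[of x] M x by (intro mult_mono) (auto simp: less_imp_le)
      finally show "(f x - p x) * f x \<le> e / (2 * pi)" using M(1) by simp
    qed (auto intro!: int continuous_intros f pc)
    finally show ?thesis by simp
  qed
  then have "?I (\<lambda>x. f x * f x) \<le> 0" by (metis field_le_epsilon add.left_neutral)
  moreover have "?I (\<lambda>x. f x * f x) \<ge> 0" by (intro integral_nonneg int continuous_intros f) auto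
  ultimately have z: "\<forall>x\<in>{0..2 * pi}. f x * f x = 0"
    by (subst integral_eq_0_iff[symmetric]) (auto intro!: continuous_intros continuous_on_subset[OF f])
  obtain y where y: "y \<in> {0..2 * pi}" "\<And>f :: real \<Rightarrow> real. periodic f \<Longrightarrow> f x = f y" using periodic_reduce[of x, where 'b = real] by blast
  have "f y = 0" using z y(1) by auto
  then show ?thesis using y(2)[OF per] by simp
qed

text \<open>A du Bois-Reymond lemma of order \<open>n\<close>. A trigonometric polynomial minus its
  mean \<open>q\<close> is an \<open>n\<close>-th derivative of a test function, and the constant
  \<open>q\<close> is orthogonal to \<open>C - m\<close> when \<open>m\<close> is the mean of
  \<open>C\<close>. So \<open>C - m\<close> is orthogonal to all trigonometric polynomials.\<close>

lemma weakly_constant_imp_constant: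
  fixes C :: "real \<Rightarrow> 'a::euclidean_space"
  assumes per: "periodic C" and C: "continuous_on UNIV C"
    and orth: "\<And>\<phi>. test_fun \<phi> \<Longrightarrow> integral {0..2 * pi} (\<lambda>x. (deriv ^^ n) \<phi> x *\<^sub>R C x) = 0"
  shows "\<exists>m. C = (\<lambda>x. m)"
proof -
  let ?I = "integral {0..2 * pi}"
  note int = integrable_continuous_UNIV
  define m where "m = (1 / (2 * pi)) *\<^sub>R ?I C"
  have Im: "?I (\<lambda>x. C x - m) = 0"
    unfolding m_def using int[OF C] by (subst Henstock_Kurzweil_Integration.integral_diff) auto
  have p0: "?I (\<lambda>x. p x *\<^sub>R (C x - m)) = 0" if "trig_poly p" for p
  proof -
    define q where "q = (1 / (2 * pi)) * ?I p"
    have pc: "continuous_on UNIV p" using that trig_poly_test_fun test_fun_continuous by blast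
    have t: "test_fun (\<lambda>x. p x + - q)" by (intro trig_poly_test_fun trig_poly.intros that)
    have z: "?I (\<lambda>x. p x + - q) = 0"
      unfolding q_def using int[OF pc] by (subst integral_add) auto
    obtain \<phi> where \<phi>: "test_fun \<phi>" "(deriv ^^ n) \<phi> = (\<lambda>x. p x + - q)" using test_fun_iterated_primitive[OF t z] by blast
    have 1: "?I (\<lambda>x. (p x - q) *\<^sub>R C x) = 0" using orth[OF \<phi>(1)] \<phi>(2) by simp
    have pq: "(\<lambda>x. p x - q) integrable_on {0..2 * pi}" by (intro int continuous_intros pc)
    have 2: "?I (\<lambda>x. (p x - q) *\<^sub>R m) = 0"
      using z integral_linear[OF pq bounded_linear_scaleR_left[of m]] by (simp add: o_def)
    have "(\<lambda>x. p x *\<^sub>R (C x - m)) = (\<lambda>x. ((p x - q) *\<^sub>R C x - (p x - q) *\<^sub>R m) + q *\<^sub>R (C x - m))"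
      by (auto simp: algebra_simps)
    then have "?I (\<lambda>x. p x *\<^sub>R (C x - m)) = ?I (\<lambda>x. ((p x - q) *\<^sub>R C x - (p x - q) *\<^sub>R m) + q *\<^sub>R (C x - m))"
      by (rule arg_cong)
    also have "\<dots> = (?I (\<lambda>x. (p x - q) *\<^sub>R C x) - ?I (\<lambda>x. (p x - q) *\<^sub>R m)) + q *\<^sub>R ?I (\<lambda>x. C x - m)"
    proof -
      have "(\<lambda>x. (p x - q) *\<^sub>R C x) integrable_on {0..2 * pi}" "(\<lambda>x. (p x - q) *\<^sub>R m) integrable_on {0..2 * pi}"
        "(\<lambda>x. C x - m) integrable_on {0..2 * pi}" by (intro int continuous_intros pc C)+
      then show ?thesis
        by (simp add: integral_add Henstock_Kurzweil_Integration.integral_diff Henstock_Kurzweil_Integration.integrable_diff integrable_cmul)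
    qed
    finally show ?thesis using 1 2 Im by simp
  qed
  have "C x = m" for x
  proof (rule euclidean_eqI)
    fix b :: 'a assume "b \<in> Basis"
    have "(C x - m) \<bullet> b = 0"
    proof (rule orthogonal_to_trig_poly_imp_zero[of "\<lambda>x. (C x - m) \<bullet> b"])
      show "periodic (\<lambda>x. (C x - m) \<bullet> b)" using per by (simp add: periodic_def)
      show "continuous_on UNIV (\<lambda>x. (C x - m) \<bullet> b)" by (intro continuous_intros C)
      fix p assume p: "trig_poly p"
      have "continuous_on UNIV (\<lambda>x. p x *\<^sub>R (C x - m))"
        using p trig_poly_test_fun test_fun_continuous by (intro continuous_intros C) blast
      then show "?I (\<lambda>x. p x * ((C x - m) \<bullet> b)) = 0"
        using integral_linear[OF int bounded_linear_inner_left[of b]] p0[OF p]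
        by (fastforce simp: o_def)
    qed
    then show "C x \<bullet> b = m \<bullet> b" by (simp add: inner_diff_left)
  qed
  then show ?thesis by blast
qed

lemma integral_by_parts_test_fun:
  fixes F g :: "real \<Rightarrow> 'a::euclidean_space"
  assumes \<phi>: "test_fun \<phi>" and g: "loc_sobolev k g" and F: "periodic F"
    and gF: "\<And>a b. a \<le> b \<Longrightarrow> (g has_integral F b - F a) {a..b}"
  shows "integral {0..2 * pi} (\<lambda>x. deriv \<phi> x *\<^sub>R F x) = - integral {0..2 * pi} (\<lambda>x. \<phi> x *\<^sub>R g x)"
proof -
  have g0: "loc_sobolev 0 g" using loc_sobolev_mono[OF g] by blast
  have F1: "loc_sobolev (Suc 0) F" "negligible {x. vector_derivative F (at x) \<noteq> g x}"
    by (rule loc_sobolev_SucI[OF g0 gF]; assumption)+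
  have "((\<lambda>x. \<phi> x *\<^sub>R vector_derivative F (at x) + vector_derivative \<phi> (at x) *\<^sub>R F x) has_integral
      \<phi> (2 * pi) *\<^sub>R F (2 * pi) - \<phi> 0 *\<^sub>R F 0) {0..2 * pi}"
    by (rule loc_sobolev_bilinear_has_integral[OF bounded_bilinear_scaleR test_fun_loc_sobolev_1[OF \<phi>] _ F1(1)]) auto
  moreover have "\<phi> (2 * pi) = \<phi> 0" "F (2 * pi) = F 0"
    using \<phi> F by (auto simp: test_fun_def periodic_def dest: spec[of _ 0])
  ultimately have "((\<lambda>x. \<phi> x *\<^sub>R vector_derivative F (at x) + deriv \<phi> x *\<^sub>R F x) has_integral 0) {0..2 * pi}"
    by (simp add: test_fun_vector_derivative[OF \<phi>])
  then have "((\<lambda>x. \<phi> x *\<^sub>R g x + deriv \<phi> x *\<^sub>R F x) has_integral 0) {0..2 * pi}"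
    by (rule has_integral_spike[OF F1(2), rotated]) auto
  then have "integral {0..2 * pi} (\<lambda>x. \<phi> x *\<^sub>R g x + deriv \<phi> x *\<^sub>R F x) = 0" by (rule integral_unique)
  moreover have "(\<lambda>x. \<phi> x *\<^sub>R g x) integrable_on {0..2 * pi}"
    using loc_sobolev_0_absolutely_integrable[OF loc_sobolev_0_bilinear[OF bounded_bilinear_scaleR test_fun_continuous[OF \<phi>] g0]]
      set_lebesgue_integral_eq_integral(1) by blast
  moreover have "(\<lambda>x. deriv \<phi> x *\<^sub>R F x) integrable_on {0..2 * pi}"
    by (intro integrable_continuous_UNIV continuous_on_scaleR
        test_fun_continuous test_fun_deriv \<phi> loc_sobolev_Suc_continuous[OF F1(1)])
  ultimately show ?thesis by (simp add: integral_add eq_neg_iff_add_eq_0 add.commute)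
qed

lemma iterated_primitive_weak_deriv:
  fixes g :: "real \<Rightarrow> 'a::euclidean_space"
  assumes g: "loc_sobolev 0 g" "periodic g" "integral {0..2 * pi} g = 0"
  shows "\<exists>F. loc_sobolev n F \<and> periodic F \<and> integral {0..2 * pi} F = 0 \<and>
    (\<forall>\<phi>. test_fun \<phi> \<longrightarrow> integral {0..2 * pi} (\<lambda>x. (deriv ^^ n) \<phi> x *\<^sub>R F x)
        = (-1) ^ n *\<^sub>R integral {0..2 * pi} (\<lambda>x. \<phi> x *\<^sub>R g x))"
proof (induction n)
  case 0
  then show ?case using g by (intro exI[of _ g]) simp
next
  case (Suc n)
  then obtain G where G: "loc_sobolev n G" "periodic G" "integral {0..2 * pi} G = 0"
    and w: "\<And>\<phi>. test_fun \<phi> \<Longrightarrow> integral {0..2 * pi} (\<lambda>x. (deriv ^^ n) \<phi> x *\<^sub>R G x)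
        = (-1) ^ n *\<^sub>R integral {0..2 * pi} (\<lambda>x. \<phi> x *\<^sub>R g x)" by blast
  obtain F where F: "loc_sobolev (Suc n) F" "periodic F" "integral {0..2 * pi} F = 0"
      "\<And>a b. a \<le> b \<Longrightarrow> (G has_integral F b - F a) {a..b}"
    using loc_sobolev_primitive[OF G] by blast
  have "integral {0..2 * pi} (\<lambda>x. (deriv ^^ Suc n) \<phi> x *\<^sub>R F x) = (-1) ^ Suc n *\<^sub>R integral {0..2 * pi} (\<lambda>x. \<phi> x *\<^sub>R g x)"
    if "test_fun \<phi>" for \<phi>
    using integral_by_parts_test_fun[OF test_fun_funpow_deriv[OF that, of n] G(1) F(2,4)] w[OF that] by simp
  then show ?case using F by blast
qed

text \<open>The difference of \<open>c\<close> and the \<open>n\<close>-fold mean-zero primitive of its weak \<open>n\<close>-th derivative is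
  continuous and orthogonal to all \<open>n\<close>-th derivatives of test functions, hence constant.\<close>

lemma sobolev_loc_sobolev:
  assumes c: "c \<in> sobolev n" and n: "n \<ge> 1"
  shows "loc_sobolev n c"
proof -
  have per: "periodic c" and cont: "continuous_on UNIV c" using c by (auto simp: sobolev_def)
  obtain g where g: "g \<in> L2_circle" "weak_deriv n c g" using c by (auto simp: sobolev_def)
  note g0 = L2_circle_loc_sobolev[OF g(1)]
  have ci: "circle_integral (\<lambda>x. \<phi> x *\<^sub>R f x) = integral {0..2 * pi} (\<lambda>x. \<phi> x *\<^sub>R f x)"
    if "test_fun \<phi>" "loc_sobolev 0 f" for \<phi> and f :: "real \<Rightarrow> real ^ 'a"
    by (rule circle_integral_loc_sobolev[OF loc_sobolev_0_bilinear[OF bounded_bilinear_scaleR test_fun_continuous[OF that(1)] that(2)]])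
  have c0: "loc_sobolev 0 c" by (rule loc_sobolev_0_continuous[OF cont])
  have w: "integral {0..2 * pi} (\<lambda>x. (deriv ^^ n) \<phi> x *\<^sub>R c x) = (-1) ^ n *\<^sub>R integral {0..2 * pi} (\<lambda>x. \<phi> x *\<^sub>R g x)"
    if "test_fun \<phi>" for \<phi>
    using g(2) that ci[OF test_fun_funpow_deriv[OF that, of n] c0] ci[OF that g0(1)]
    unfolding weak_deriv_def test_fun_def by simp
  \<comment> \<open>Testing with the constant 1 shows that a weak derivative of positive order has
    mean zero, as its periodic primitives require.\<close>
  have "(deriv ^^ Suc k) (\<lambda>x::real. 1::real) = (\<lambda>x. 0)" for k
    by (induction k) (simp_all)
  then have "(deriv ^^ n) (\<lambda>x::real. 1::real) = (\<lambda>x. 0)" using n by (cases n) auto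
  then have "integral {0..2 * pi} g = 0"
    using w[OF trig_poly_test_fun[OF trig_const[of 1]]] by simp
  then obtain F where F: "loc_sobolev n F" "periodic F"
    and wF: "\<And>\<phi>. test_fun \<phi> \<Longrightarrow> integral {0..2 * pi} (\<lambda>x. (deriv ^^ n) \<phi> x *\<^sub>R F x)
        = (-1) ^ n *\<^sub>R integral {0..2 * pi} (\<lambda>x. \<phi> x *\<^sub>R g x)"
    using iterated_primitive_weak_deriv[OF g0] by blast
  have Fc: "continuous_on UNIV F" using loc_sobolev_continuous[OF F(1)] n by simp
  have "\<exists>m. (\<lambda>x. c x - F x) = (\<lambda>x. m)"
  proof (rule weakly_constant_imp_constant)
    show "periodic (\<lambda>x. c x - F x)" using per F(2) by (simp add: periodic_def)
    show "continuous_on UNIV (\<lambda>x. c x - F x)" by (intro continuous_intros cont Fc)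
    fix \<phi> assume t: "test_fun \<phi>"
    have pc: "continuous_on UNIV ((deriv ^^ n) \<phi>)" by (intro test_fun_continuous test_fun_funpow_deriv t)
    have i: "(\<lambda>x. (deriv ^^ n) \<phi> x *\<^sub>R f x) integrable_on {0..2 * pi}" if "continuous_on UNIV f" for f :: "real \<Rightarrow> real ^ 'a"
      by (intro integrable_continuous_UNIV continuous_on_scaleR pc that)
    show "integral {0..2 * pi} (\<lambda>x. (deriv ^^ n) \<phi> x *\<^sub>R (c x - F x)) = 0"
      using w[OF t] wF[OF t] i[OF cont] i[OF Fc] by (simp add: scaleR_diff_right Henstock_Kurzweil_Integration.integral_diff)
  qed
  then obtain m where "(\<lambda>x. c x - F x) = (\<lambda>x. m)" by blast
  then have "c = (\<lambda>x. F x + m)" by (auto simp: fun_eq_iff diff_eq_eq add.commute)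
  then show ?thesis using loc_sobolev_add[OF F(1) loc_sobolev_const[of n m]] by simp
qed

subsection \<open>Bounds on arc length derivatives\<close>

lemma periodic_endpoints: "periodic f \<Longrightarrow> f (2 * pi) = f 0"
  unfolding periodic_def by (metis add_0)

lemma loc_sobolev_0_integrable:
  "loc_sobolev 0 f \<Longrightarrow> f integrable_on {a..b}" "loc_sobolev 0 f \<Longrightarrow> (\<lambda>x. norm (f x)) integrable_on {a..b}"
  using loc_sobolev_0_absolutely_integrable[of f a b] by (auto simp: absolutely_integrable_on_def)

lemma weighted_square_integrable:
  fixes f :: "real \<Rightarrow> 'a::euclidean_space"
  assumes s: "continuous_on UNIV s" "\<And>x. s x \<ge> 0" and f: "loc_sobolev 0 f"
  shows "(\<lambda>x. s x * (norm (f x))\<^sup>2) absolutely_integrable_on {a..b}"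
    and "(\<lambda>x. s x * norm (f x)) integrable_on {a..b}"
proof -
  have "loc_sobolev 0 (\<lambda>x. sqrt (s x) *\<^sub>R f x)"
    by (intro loc_sobolev_0_bilinear[OF bounded_bilinear_scaleR] continuous_intros s f)
  then have "(\<lambda>x. (norm (sqrt (s x) *\<^sub>R f x))\<^sup>2) absolutely_integrable_on {a..b}" by simp
  then show "(\<lambda>x. s x * (norm (f x))\<^sup>2) absolutely_integrable_on {a..b}"
    using s(2) by (simp add: power_mult_distrib)
  have "loc_sobolev 0 (\<lambda>x. s x *\<^sub>R f x)"
    by (intro loc_sobolev_0_bilinear[OF bounded_bilinear_scaleR] s f)
  then show "(\<lambda>x. s x * norm (f x)) integrable_on {a..b}"
    using loc_sobolev_0_integrable(2) s(2) by fastforce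
qed

lemma weighted_Cauchy_Schwarz:
  fixes f :: "real \<Rightarrow> 'a::euclidean_space"
  assumes s: "continuous_on UNIV s" "\<And>x. s x \<ge> 0" and f: "loc_sobolev 0 f"
    and L: "integral {a..b} s = L" "L > 0"
  shows "(integral {a..b} (\<lambda>x. s x * norm (f x)))\<^sup>2 \<le> L * integral {a..b} (\<lambda>x. s x * (norm (f x))\<^sup>2)"
proof -
  let ?I = "integral {a..b}"
  define B where "B = ?I (\<lambda>x. s x * norm (f x))"
  define Q where "Q = ?I (\<lambda>x. s x * (norm (f x))\<^sup>2)"
  define t where "t = B / L" \<comment> \<open>minimizes the integral of \<open>s (\<bar>f\<bar> - t)\<^sup>2\<close>\<close>
  have i1: "(\<lambda>x. s x * (norm (f x))\<^sup>2) integrable_on {a..b}"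
    using weighted_square_integrable(1)[OF s f] set_lebesgue_integral_eq_integral(1) by blast
  have i2: "(\<lambda>x. s x * norm (f x)) integrable_on {a..b}" by (rule weighted_square_integrable(2)[OF s f])
  have i3: "s integrable_on {a..b}" by (rule integrable_continuous_UNIV[OF s(1)])
  have h: "((\<lambda>x. s x * (norm (f x))\<^sup>2 - (2 * t) * (s x * norm (f x)) + t\<^sup>2 * s x) has_integral Q - (2 * t) * B + t\<^sup>2 * L) {a..b}"
    unfolding Q_def B_def L(1)[symmetric]
    by (intro has_integral_add has_integral_diff has_integral_mult_right integrable_integral i1 i2 i3)
  have "0 \<le> Q - (2 * t) * B + t\<^sup>2 * L"
  proof (rule has_integral_nonneg[OF h])
    fix x
    have "s x * (norm (f x))\<^sup>2 - (2 * t) * (s x * norm (f x)) + t\<^sup>2 * s x = s x * (norm (f x) - t)\<^sup>2"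
      by (simp add: power2_eq_square algebra_simps)
    then show "0 \<le> s x * (norm (f x))\<^sup>2 - (2 * t) * (s x * norm (f x)) + t\<^sup>2 * s x" using s(2)[of x] by simp
  qed
  then have "0 \<le> L * (Q - (2 * t) * B + t\<^sup>2 * L)" using L(2) by simp
  also have "\<dots> = L * Q - B\<^sup>2" using L(2) by (simp add: t_def power2_eq_square field_simps)
  finally show ?thesis by (simp add: B_def Q_def)
qed

text \<open>As \<open>f\<close> has weighted mean zero, its value at a point is the weighted mean of
  the differences to its other values, and each of these is at most the total variation over a
  period. The weight will be the speed, for means with respect to arc length, or the constant
  1.\<close>

lemma weighted_mean_zero_bound:
  fixes f :: "real \<Rightarrow> 'a::euclidean_space"
  assumes s: "continuous_on UNIV s" "\<And>x. s x > 0" and f: "loc_sobolev k f" "k > 0" "periodic f"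
    and mean: "integral {0..2 * pi} (\<lambda>x. s x *\<^sub>R f x) = 0"
  shows "norm (f \<theta>) \<le> integral {0..2 * pi} (\<lambda>x. norm (vector_derivative f (at x)))"
proof -
  let ?I = "integral {0..2 * pi}"
  let ?V = "?I (\<lambda>x. norm (vector_derivative f (at x)))"
  have fc: "continuous_on UNIV f" by (rule loc_sobolev_continuous[OF f(1,2)])
  obtain y where y: "y \<in> {0..2 * pi}" "\<And>f :: real \<Rightarrow> 'a. periodic f \<Longrightarrow> f \<theta> = f y"
    by (rule periodic_reduce[of \<theta>]) (rule that)
  have inc: "norm (f b - f a) \<le> ?V" if "0 \<le> a" "a \<le> b" "b \<le> 2 * pi" for a b
  proof -
    have "norm (f b - f a) \<le> integral {a..b} (\<lambda>x. norm (vector_derivative f (at x)))"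
      by (rule loc_sobolev_1_increment(2)[OF f(1,2) that(2)])
    also have "\<dots> \<le> ?V"
      by (rule integral_subset_le) (use that loc_sobolev_1_increment(1)[OF f(1,2)] in auto)
    finally show ?thesis .
  qed
  have osc: "norm (f y - f x) \<le> ?V" if "x \<in> {0..2 * pi}" for x
    using inc[of x y] inc[of y x] that y(1) by (cases "x \<le> y") (auto simp: norm_minus_commute)
  define L where "L = ?I s"
  have "?I s \<noteq> 0"
    using integral_eq_0_iff[of 0 "2 * pi" s] continuous_on_subset[OF s(1)] s(2)
    by (metis (no_types, opaque_lifting) UNIV_I atLeastAtMost_iff less_eq_real_def order_less_irrefl pi_gt_zero mult_pos_pos subsetI zero_less_numeral)
  moreover have "?I s \<ge> 0" by (intro integral_nonneg integrable_continuous_UNIV s(1)) (simp add: s(2) less_imp_le)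
  ultimately have Lpos: "L > 0" by (simp add: L_def)
  have si: "(s has_integral L) {0..2 * pi}"
    unfolding L_def by (intro integrable_integral integrable_continuous_UNIV s(1))
  have "((\<lambda>x. s x *\<^sub>R f x) has_integral 0) {0..2 * pi}"
    unfolding mean[symmetric] by (intro integrable_integral integrable_continuous_UNIV continuous_on_scaleR s(1) fc)
  then have "((\<lambda>x. s x *\<^sub>R f y - s x *\<^sub>R f x) has_integral L *\<^sub>R f y - 0) {0..2 * pi}"
    by (intro has_integral_diff has_integral_scaleR_left si)
  then have h1: "((\<lambda>x. s x *\<^sub>R (f y - f x)) has_integral L *\<^sub>R f y) {0..2 * pi}" by (simp add: scaleR_diff_right)
  have h2: "((\<lambda>x. s x * ?V) has_integral L * ?V) {0..2 * pi}" by (intro has_integral_mult_left si)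
  have "norm (integral {0..2 * pi} (\<lambda>x. s x *\<^sub>R (f y - f x))) \<le> integral {0..2 * pi} (\<lambda>x. s x * ?V)"
  proof (rule integral_norm_bound_integral)
    show "(\<lambda>x. s x *\<^sub>R (f y - f x)) integrable_on {0..2 * pi}" using h1 by (rule has_integral_integrable)
    show "(\<lambda>x. s x * ?V) integrable_on {0..2 * pi}" using h2 by (rule has_integral_integrable)
    show "norm (s x *\<^sub>R (f y - f x)) \<le> s x * ?V" if "x \<in> {0..2 * pi}" for x
      using osc[OF that] s(2)[of x] by (simp add: mult_left_mono)
  qed
  then have "norm (L *\<^sub>R f y) \<le> L * ?V" by (simp only: integral_unique[OF h1] integral_unique[OF h2])
  then have "norm (f y) \<le> ?V" using Lpos by simp
  then show ?thesis using y(2)[OF f(3)] by simp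
qed

lemma d_theta_eq: "d_theta h = (\<lambda>x. vector_derivative h (at x))"
  by (simp add: fun_eq_iff d_theta_def)

lemma periodic_d_theta: "periodic h \<Longrightarrow> periodic (d_theta h)"
  unfolding d_theta_eq by (rule periodic_vector_derivative)

lemma loc_sobolev_d_theta: "loc_sobolev (Suc k) h \<Longrightarrow> loc_sobolev k (d_theta h)"
  unfolding d_theta_eq by (rule loc_sobolev_deriv)

lemma loc_sobolev_funpow_d_theta:
  assumes "loc_sobolev n h" "j \<le> n"
  shows "loc_sobolev (n - j) ((d_theta ^^ j) h)"
  using assms(2)
proof (induction j)
  case (Suc j)
  then have "loc_sobolev (Suc (n - Suc j)) ((d_theta ^^ j) h)" by (simp add: Suc_diff_Suc)
  then show ?case by (simp add: loc_sobolev_d_theta)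
qed (use assms in simp)

lemma circle_integral_nonneg:
  fixes f :: "real \<Rightarrow> real"
  assumes "\<And>x. f x \<ge> 0"
  shows "circle_integral f \<ge> 0"
  unfolding circle_integral_def set_lebesgue_integral_def using assms by (intro Bochner_Integration.integral_nonneg) auto

lemma immersionsD:
  assumes "c \<in> immersions n" "n \<ge> 2"
  shows "loc_sobolev n c" "periodic c" "d_theta c \<theta> \<noteq> 0" "c \<in> sobolev n"
  using assms sobolev_loc_sobolev[of c n] by (auto simp: immersions_def sobolev_def)

context
  fixes c :: "real \<Rightarrow> real ^ 'd" and n :: nat
  assumes c: "c \<in> immersions n" and n: "n \<ge> 2"
begin

lemma continuous_speed: "continuous_on UNIV (\<lambda>\<theta>. norm (d_theta c \<theta>))"
proof -
  have "loc_sobolev (Suc (n - 1)) c" using immersionsD(1)[OF c n] n by simp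
  then have "loc_sobolev (n - 1) (d_theta c)" by (rule loc_sobolev_d_theta)
  then have "continuous_on UNIV (d_theta c)" by (rule loc_sobolev_continuous) (use n in auto)
  then show ?thesis by (intro continuous_intros)
qed

lemma speed_pos: "norm (d_theta c \<theta>) > 0"
  using immersionsD(3)[OF c n] by simp

lemma curve_length_has_integral: "((\<lambda>\<theta>. norm (d_theta c \<theta>)) has_integral curve_length c) {0..2 * pi}"
proof -
  have "curve_length c = integral {0..2 * pi} (\<lambda>\<theta>. norm (d_theta c \<theta>))"
    unfolding curve_length_def arclength_integral_def
    using circle_integral_loc_sobolev[OF loc_sobolev_0_continuous[OF continuous_speed]] by simp
  then show ?thesis using integrable_continuous_UNIV[OF continuous_speed] by (simp add: integrable_integral)
qed

lemma curve_length_pos: "curve_length c > 0"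
proof -
  have "integral {0..2 * pi} (\<lambda>\<theta>. norm (d_theta c \<theta>)) \<noteq> 0"
    using integral_eq_0_iff[of 0 "2 * pi" "\<lambda>\<theta>. norm (d_theta c \<theta>)"] continuous_on_subset[OF continuous_speed]
      speed_pos[of 0] by force
  moreover have "curve_length c \<ge> 0" by (rule has_integral_nonneg[OF curve_length_has_integral]) simp
  ultimately show ?thesis using integral_unique[OF curve_length_has_integral] by simp
qed

text \<open>The reciprocal of the speed has order \<open>n - 1\<close>, which covers every
  \<open>k\<close> with \<open>Suc k \<le> n\<close>. At \<open>k = 0\<close> the product rule asks
  for a factor of order 1, and \<open>n \<ge> 2\<close> provides it.\<close>

lemma loc_sobolev_D_s:
  assumes "loc_sobolev (Suc k) h" "Suc k \<le> n"
  shows "loc_sobolev k (D_s c h)"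
proof -
  obtain m where m: "n = Suc (Suc m)" using n by (metis add_2_eq_Suc le_Suc_ex)
  have "loc_sobolev (Suc m) (d_theta c)"
    by (rule loc_sobolev_d_theta) (use immersionsD(1)[OF c n] m in simp)
  then have "loc_sobolev (Suc m) (\<lambda>\<theta>. 1 / norm (d_theta c \<theta>))"
    using immersionsD(3)[OF c n] by (rule loc_sobolev_inverse_norm)
  then have "loc_sobolev (max k 1) (\<lambda>\<theta>. 1 / norm (d_theta c \<theta>))"
    by (rule loc_sobolev_mono) (use assms(2) m in auto)
  then show ?thesis
    using loc_sobolev_scaleR[OF _ loc_sobolev_d_theta[OF assms(1)]] by (simp add: D_s_def[abs_def])
qed

lemma loc_sobolev_funpow_D_s:
  assumes "loc_sobolev n h" "j \<le> n"
  shows "loc_sobolev (n - j) ((D_s c ^^ j) h)"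
  using assms(2)
proof (induction j)
  case (Suc j)
  then have "loc_sobolev (Suc (n - Suc j)) ((D_s c ^^ j) h)" by (simp add: Suc_diff_Suc)
  then show ?case using loc_sobolev_D_s Suc.prems by simp
qed (use assms in simp)

lemma periodic_funpow_D_s:
  assumes "periodic h"
  shows "periodic ((D_s c ^^ j) h)"
proof (induction j)
  case (Suc j)
  then show ?case
    using periodic_d_theta[OF immersionsD(2)[OF c n]] periodic_d_theta[OF Suc] by (simp add: periodic_def D_s_def)
qed (use assms in simp)

lemma speed_D_s: "norm (d_theta c \<theta>) *\<^sub>R D_s c h \<theta> = d_theta h \<theta>"
  using immersionsD(3)[OF c n] by (simp add: D_s_def)

lemma sobolev_metric_eq:
  assumes h: "loc_sobolev n h"
  shows "sobolev_metric n a c h h = (\<Sum>j\<le>n. a j (curve_length c) *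
    integral {0..2 * pi} (\<lambda>\<theta>. norm (d_theta c \<theta>) * (norm ((D_s c ^^ j) h \<theta>))\<^sup>2))"
  unfolding sobolev_metric_def
proof (rule sum.cong[OF refl])
  fix j assume "j \<in> {..n}"
  then have "loc_sobolev 0 ((D_s c ^^ j) h)"
    by (intro loc_sobolev_mono[OF loc_sobolev_funpow_D_s[OF h, of j]]) auto
  then have i: "(\<lambda>\<theta>. norm (d_theta c \<theta>) * (norm ((D_s c ^^ j) h \<theta>))\<^sup>2) absolutely_integrable_on {0..2 * pi}"
    by (intro weighted_square_integrable(1) continuous_speed) auto
  have "arclength_integral c (\<lambda>\<theta>. a j (curve_length c) * ((D_s c ^^ j) h \<theta> \<bullet> (D_s c ^^ j) h \<theta>))
      = circle_integral (\<lambda>\<theta>. a j (curve_length c) * (norm (d_theta c \<theta>) * (norm ((D_s c ^^ j) h \<theta>))\<^sup>2))"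
    by (simp add: arclength_integral_def power2_norm_eq_inner mult_ac)
  also have "\<dots> = a j (curve_length c) * integral {0..2 * pi} (\<lambda>\<theta>. norm (d_theta c \<theta>) * (norm ((D_s c ^^ j) h \<theta>))\<^sup>2)"
    unfolding circle_integral_def using i by (simp add: set_lebesgue_integral_eq_integral)
  finally show "arclength_integral c (\<lambda>\<theta>. a j (curve_length c) * ((D_s c ^^ j) h \<theta> \<bullet> (D_s c ^^ j) h \<theta>))
      = a j (curve_length c) * integral {0..2 * pi} (\<lambda>\<theta>. norm (d_theta c \<theta>) * (norm ((D_s c ^^ j) h \<theta>))\<^sup>2)" .
qed

lemma arclength_square_nonneg: "0 \<le> integral {0..2 * pi} (\<lambda>\<theta>. norm (d_theta c \<theta>) * (norm (h \<theta>))\<^sup>2)"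
  by (cases "(\<lambda>\<theta>. norm (d_theta c \<theta>) * (norm (h \<theta>))\<^sup>2) integrable_on {0..2 * pi}")
    (auto intro: integral_nonneg simp: not_integrable_integral)

lemma sobolev_metric_ge_top:
  assumes h: "loc_sobolev n h" and a: "\<And>j. j \<le> n \<Longrightarrow> a j (curve_length c) \<ge> 0"
  shows "a n (curve_length c) * integral {0..2 * pi} (\<lambda>\<theta>. norm (d_theta c \<theta>) * (norm ((D_s c ^^ n) h \<theta>))\<^sup>2)
     \<le> sobolev_metric n a c h h"
  unfolding sobolev_metric_eq[OF h]
  by (rule member_le_sum) (auto intro!: mult_nonneg_nonneg arclength_square_nonneg a)

text \<open>The speed in the arc length element cancels the denominator of \<open>D_s\<close>. So
  the arc length integral of a derivative is the increment of a periodic function over one period,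
  and the mean-zero bound applies with the speed as weight.\<close>

lemma D_s_bound_by_next:
  assumes h: "loc_sobolev n h" "periodic h" and j: "Suc j < n"
  shows "norm ((D_s c ^^ Suc j) h \<theta>) \<le> integral {0..2 * pi} (\<lambda>\<theta>. norm (d_theta c \<theta>) * norm ((D_s c ^^ Suc (Suc j)) h \<theta>))"
proof -
  let ?f = "\<lambda>j. (D_s c ^^ j) h"
  have "((\<lambda>x. vector_derivative (?f j) (at x)) has_integral ?f j (2 * pi) - ?f j 0) {0..2 * pi}"
    by (rule loc_sobolev_has_integral[OF loc_sobolev_funpow_D_s[OF h(1)]]) (use j in auto)
  then have "(d_theta (?f j) has_integral 0) {0..2 * pi}"
    using periodic_endpoints[OF periodic_funpow_D_s[OF h(2)]] by (simp add: d_theta_eq)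
  then have "integral {0..2 * pi} (\<lambda>\<theta>. norm (d_theta c \<theta>) *\<^sub>R ?f (Suc j) \<theta>) = 0"
    by (simp add: speed_D_s integral_unique)
  then have "norm (?f (Suc j) \<theta>) \<le> integral {0..2 * pi} (\<lambda>x. norm (vector_derivative (?f (Suc j)) (at x)))"
    by (intro weighted_mean_zero_bound[OF continuous_speed speed_pos loc_sobolev_funpow_D_s[OF h(1)]] periodic_funpow_D_s h)
      (use j in auto)
  \<comment> \<open>This holds at every point: where the derivative fails to exist, which can happen
    at the top order, both sides contain the same default value.\<close>
  also have "(\<lambda>x. norm (vector_derivative (?f (Suc j)) (at x))) = (\<lambda>x. norm (d_theta c x) * norm (?f (Suc (Suc j)) x))"
  proof
    fix x
    have "vector_derivative (?f (Suc j)) (at x) = norm (d_theta c x) *\<^sub>R ?f (Suc (Suc j)) x"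
      using speed_D_s[of x "?f (Suc j)"] by (simp add: d_theta_eq)
    then show "norm (vector_derivative (?f (Suc j)) (at x)) = norm (d_theta c x) * norm (?f (Suc (Suc j)) x)"
      by (simp only: norm_scaleR abs_norm_cancel)
  qed
  finally show ?thesis .
qed

text \<open>Descending from order \<open>n - 1\<close> to order 1 takes \<open>n - 2\<close> steps,
  each with a factor of the length; Cauchy-Schwarz at order \<open>n\<close> contributes one more
  factor after squaring. This makes the exponent \<open>2 * (n - 2) + 1 = 2 * n - 3\<close>.\<close>

lemma D_s_norm_le_metric:
  assumes h: "loc_sobolev n h" "periodic h" and a: "\<And>j. j \<le> n \<Longrightarrow> a j (curve_length c) \<ge> 0"
  shows "a n (curve_length c) * (norm (D_s c h \<theta>))\<^sup>2 \<le> curve_length c ^ (2 * n - 3) * sobolev_metric n a c h h"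
proof -
  let ?f = "\<lambda>j. (D_s c ^^ j) h" and ?s = "\<lambda>\<theta>. norm (d_theta c \<theta>)" and ?L = "curve_length c"
  define B where "B = integral {0..2 * pi} (\<lambda>\<theta>. ?s \<theta> * norm (?f n \<theta>))"
  define Q where "Q = integral {0..2 * pi} (\<lambda>\<theta>. ?s \<theta> * (norm (?f n \<theta>))\<^sup>2)"
  have fn: "loc_sobolev 0 (?f n)" using loc_sobolev_funpow_D_s[OF h(1), of n] by simp
  have BQ: "B\<^sup>2 \<le> ?L * Q" unfolding B_def Q_def
    by (rule weighted_Cauchy_Schwarz[OF continuous_speed _ fn integral_unique[OF curve_length_has_integral] curve_length_pos]) simp
  \<comment> \<open>Here \<open>j\<close> counts the steps below order \<open>n - 1\<close>, the
    highest order with a pointwise bound; order \<open>n\<close> is controlled in the mean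
    only.\<close>
  have bnd: "norm (?f (n - 1 - j) \<theta>) \<le> ?L ^ j * B" if "j \<le> n - 2" for j \<theta>
    using that
  proof (induction j arbitrary: \<theta>)
    case 0
    have "Suc (n - 2) = n - 1" "Suc (Suc (n - 2)) = n" using n by auto
    then show ?case using D_s_bound_by_next[OF h, of "n - 2" \<theta>] n by (simp add: B_def)
  next
    case (Suc j)
    define i where "i = n - 1 - Suc (Suc j)"
    have i: "Suc i = n - 1 - Suc j" "Suc (Suc i) = n - 1 - j" "Suc i < n" using Suc.prems n by (auto simp: i_def)
    have fi: "loc_sobolev 0 (?f (Suc (Suc i)))"
      by (rule loc_sobolev_mono[OF loc_sobolev_funpow_D_s[OF h(1)]]) (use i in auto)
    have "norm (?f (Suc i) \<theta>) \<le> integral {0..2 * pi} (\<lambda>\<theta>. ?s \<theta> * norm (?f (Suc (Suc i)) \<theta>))"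
      by (rule D_s_bound_by_next[OF h i(3)])
    also have "\<dots> \<le> integral {0..2 * pi} (\<lambda>\<theta>. ?s \<theta> * (?L ^ j * B))"
    proof (rule integral_le)
      show "(\<lambda>\<theta>. ?s \<theta> * norm (?f (Suc (Suc i)) \<theta>)) integrable_on {0..2 * pi}"
        by (intro weighted_square_integrable(2) continuous_speed fi) simp
      show "(\<lambda>\<theta>. ?s \<theta> * (?L ^ j * B)) integrable_on {0..2 * pi}"
        by (intro integrable_on_mult_left integrable_continuous_UNIV continuous_speed)
      show "?s \<theta> * norm (?f (Suc (Suc i)) \<theta>) \<le> ?s \<theta> * (?L ^ j * B)" for \<theta>
        unfolding i(2) using Suc.IH Suc.prems by (intro mult_left_mono) auto
    qed
    also have "\<dots> = ?L * (?L ^ j * B)"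
      using integral_unique[OF has_integral_mult_left[OF curve_length_has_integral]] .
    finally show ?case unfolding i(1) by (simp add: mult.assoc)
  qed
  have "norm (D_s c h \<theta>) \<le> ?L ^ (n - 2) * B" using bnd[of "n - 2" \<theta>] n by (simp add: numeral_2_eq_2)
  then have "(norm (D_s c h \<theta>))\<^sup>2 \<le> (?L ^ (n - 2) * B)\<^sup>2" by (intro power_mono) auto
  also have "\<dots> = ?L ^ (2 * (n - 2)) * B\<^sup>2" by (simp add: power_mult_distrib power_even_eq)
  also have "\<dots> \<le> ?L ^ (2 * (n - 2)) * (?L * Q)" using curve_length_pos by (intro mult_left_mono BQ) auto
  also have "\<dots> = ?L ^ (2 * n - 3) * Q"
  proof -
    have "2 * n - 3 = Suc (2 * (n - 2))" using n by simp
    then show ?thesis by simp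
  qed
  finally have "a n ?L * (norm (D_s c h \<theta>))\<^sup>2 \<le> a n ?L * (?L ^ (2 * n - 3) * Q)"
    using a by (intro mult_left_mono) auto
  also have "\<dots> = ?L ^ (2 * n - 3) * (a n ?L * Q)" by simp
  also have "\<dots> \<le> ?L ^ (2 * n - 3) * sobolev_metric n a c h h"
    unfolding Q_def using curve_length_pos by (intro mult_left_mono sobolev_metric_ge_top h a) auto
  finally show ?thesis .
qed

end

section \<open>The Sobolev embedding on the circle\<close>

lemma sobolev_norm_L1_bound:
  assumes h: "loc_sobolev n h" and j: "j \<le> n"
  shows "integral {0..2 * pi} (\<lambda>x. norm ((d_theta ^^ j) h x)) \<le> sqrt (2 * pi) * sobolev_norm n h"
proof -
  let ?g = "(d_theta ^^ j) h"
  let ?t = "\<lambda>j. circle_integral (\<lambda>\<theta>. (norm ((d_theta ^^ j) h \<theta>))\<^sup>2)"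
  have g: "loc_sobolev 0 ?g" by (rule loc_sobolev_mono[OF loc_sobolev_funpow_d_theta[OF h j]]) simp
  have "(integral {0..2 * pi} (\<lambda>x. 1 * norm (?g x)))\<^sup>2 \<le> (2 * pi) * integral {0..2 * pi} (\<lambda>x. 1 * (norm (?g x))\<^sup>2)"
    by (rule weighted_Cauchy_Schwarz[OF _ _ g]) auto
  also have "integral {0..2 * pi} (\<lambda>x. 1 * (norm (?g x))\<^sup>2) = ?t j"
    using g by (simp add: circle_integral_eq_integral)
  also have "?t j \<le> (\<Sum>j\<le>n. ?t j)"
    by (rule member_le_sum) (use j in \<open>auto intro: circle_integral_nonneg\<close>)
  finally have "(integral {0..2 * pi} (\<lambda>x. norm (?g x)))\<^sup>2 \<le> (2 * pi) * (\<Sum>j\<le>n. ?t j)" by simp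
  then have "integral {0..2 * pi} (\<lambda>x. norm (?g x)) \<le> sqrt ((2 * pi) * (\<Sum>j\<le>n. ?t j))"
    by (rule real_le_rsqrt)
  then show ?thesis by (simp add: sobolev_norm_def real_sqrt_mult)
qed

lemma sobolev_norm_nonneg: "sobolev_norm n h \<ge> 0"
  unfolding sobolev_norm_def by (intro real_sqrt_ge_zero sum_nonneg circle_integral_nonneg) auto

text \<open>The derivative of a periodic function has mean zero and is bounded through the second
  derivative. The function itself need not have mean zero; its mean is estimated separately, which
  doubles the constant. The first bound carries the same constant so that both can be compared with
  one null function of time.\<close>

lemma sobolev_embedding:
  assumes h: "loc_sobolev n h" "periodic h" and n: "n \<ge> 2"
  shows "norm (d_theta h \<theta>) \<le> 2 * sqrt (2 * pi) * sobolev_norm n h"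
    and "norm (h \<theta>) \<le> 2 * sqrt (2 * pi) * sobolev_norm n h"
proof -
  let ?I = "integral {0..2 * pi}" and ?N = "sqrt (2 * pi) * sobolev_norm n h"
  obtain k where k: "n = Suc (Suc k)" using n by (metis add_2_eq_Suc le_Suc_ex)
  have Nn: "0 \<le> ?N" using sobolev_norm_nonneg[of n h] by (intro mult_nonneg_nonneg) auto
  have d1: "loc_sobolev (Suc k) (d_theta h)" using loc_sobolev_d_theta h(1) k by blast
  have "(d_theta h has_integral 0) {0..2 * pi}"
    using loc_sobolev_has_integral[OF h(1), of 0 "2 * pi"] periodic_endpoints[OF h(2)] n by (simp add: d_theta_eq)
  then have "norm (d_theta h \<theta>) \<le> ?I (\<lambda>x. norm (vector_derivative (d_theta h) (at x)))"
    by (intro weighted_mean_zero_bound[OF _ _ d1, of "\<lambda>x. 1"] periodic_d_theta h) (auto simp: integral_unique)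
  also have "\<dots> \<le> ?N"
    using sobolev_norm_L1_bound[OF h(1), of 2] n by (simp add: numeral_2_eq_2 d_theta_eq)
  finally show "norm (d_theta h \<theta>) \<le> 2 * sqrt (2 * pi) * sobolev_norm n h" using Nn by simp
  define m where "m = (1 / (2 * pi)) *\<^sub>R ?I h"
  have hi: "h integrable_on {0..2 * pi}" "(\<lambda>x. norm (h x)) integrable_on {0..2 * pi}"
    using loc_sobolev_0_integrable[of h] loc_sobolev_mono[OF h(1), of 0] by auto
  have F: "((\<lambda>x. vector_derivative h (at x)) has_integral (h b - m) - (h a - m)) {a..b}" if "a \<le> b" for a b
    using loc_sobolev_has_integral[OF h(1) _ that] n by simp
  have d1': "loc_sobolev (Suc k) (\<lambda>x. vector_derivative h (at x))" using d1 by (simp add: d_theta_eq)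
  have hm: "loc_sobolev (Suc (Suc k)) (\<lambda>x. h x - m)"
    by (rule loc_sobolev_SucI(1)[OF d1' F])
  have vd: "vector_derivative (\<lambda>x. h x - m) (at x) = vector_derivative h (at x)" for x
    by (rule loc_sobolev_SucI(3)[OF d1' F]) auto
  have "norm (h \<theta> - m) \<le> ?I (\<lambda>x. norm (vector_derivative (\<lambda>x. h x - m) (at x)))"
  proof (rule weighted_mean_zero_bound[OF _ _ hm, of "\<lambda>x. 1"])
    show "periodic (\<lambda>x. h x - m)" using h(2) by (simp add: periodic_def)
    show "?I (\<lambda>x. 1 *\<^sub>R (h x - m)) = 0"
      using hi(1) by (simp, subst Henstock_Kurzweil_Integration.integral_diff) (auto simp: m_def)
  qed auto
  also have "\<dots> \<le> ?N" using sobolev_norm_L1_bound[OF h(1), of 1] n by (simp add: vd d_theta_eq)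
  finally have 1: "norm (h \<theta> - m) \<le> ?N" .
  have "norm (?I h) \<le> ?I (\<lambda>x. norm (h x))" by (rule integral_norm_bound_integral) (use hi in auto)
  also have "\<dots> \<le> ?N" using sobolev_norm_L1_bound[OF h(1), of 0] by simp
  finally have 2: "norm (?I h) \<le> ?N" .
  have "norm m \<le> norm (?I h)" using pi_gt3 mult_left_mono[of 1 "2 * pi" "norm (?I h)"]
    by (simp add: m_def divide_le_eq)
  then have "norm (h \<theta>) \<le> ?N + ?N" using 1 2 norm_triangle_sub[of "h \<theta>" m] by linarith
  then show "norm (h \<theta>) \<le> 2 * sqrt (2 * pi) * sobolev_norm n h" by (simp add: algebra_simps)
qed

subsection \<open>Paths of immersions\<close>

lemma has_vector_derivative_quotientI:
  fixes F :: "real \<Rightarrow> 'a::real_normed_vector"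
  assumes g: "(g \<longlongrightarrow> 0) (at t within S)"
    and le: "\<And>u. u \<in> S \<Longrightarrow> u \<noteq> t \<Longrightarrow> norm ((1 / (u - t)) *\<^sub>R (F u - F t) - F') \<le> g u"
  shows "(F has_vector_derivative F') (at t within S)"
  unfolding has_vector_derivative_def has_derivative_within
proof
  show "bounded_linear (\<lambda>x. x *\<^sub>R F')" by (rule bounded_linear_scaleR_left)
  show "((\<lambda>u. (1 / norm (u - t)) *\<^sub>R (F u - (F t + (u - t) *\<^sub>R F'))) \<longlongrightarrow> 0) (at t within S)"
  proof (rule Lim_null_comparison[OF _ g])
    have "norm ((1 / norm (u - t)) *\<^sub>R (F u - (F t + (u - t) *\<^sub>R F'))) \<le> g u" if u: "u \<in> S" "u \<noteq> t" for u
    proof -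
      have "F u - (F t + (u - t) *\<^sub>R F') = (u - t) *\<^sub>R ((1 / (u - t)) *\<^sub>R (F u - F t) - F')"
        using u(2) by (simp add: scaleR_diff_right)
      then have "norm ((1 / norm (u - t)) *\<^sub>R (F u - (F t + (u - t) *\<^sub>R F')))
          = norm ((1 / (u - t)) *\<^sub>R (F u - F t) - F')"
        using u(2) by simp
      then show ?thesis using le[OF u] by simp
    qed
    then show "\<forall>\<^sub>F u in at t within S. norm ((1 / norm (u - t)) *\<^sub>R (F u - (F t + (u - t) *\<^sub>R F'))) \<le> g u"
      by (auto simp: eventually_at_filter intro!: eventuallyI)
  qed
qed

lemma curve_length_dist_le:
  assumes n: "n \<ge> 2" and c: "c \<in> immersions n" "e \<in> immersions n"
    and B: "\<And>\<theta>. norm (d_theta c \<theta> - d_theta e \<theta>) \<le> B"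
  shows "\<bar>curve_length c - curve_length e\<bar> \<le> 2 * pi * B"
proof -
  have h: "((\<lambda>\<theta>. norm (d_theta c \<theta>) - norm (d_theta e \<theta>)) has_integral curve_length c - curve_length e) {0..2 * pi}"
    by (intro has_integral_diff curve_length_has_integral[OF _ n] c)
  have "norm (integral {0..2 * pi} (\<lambda>\<theta>. norm (d_theta c \<theta>) - norm (d_theta e \<theta>))) \<le> integral {0..2 * pi} (\<lambda>\<theta>. B)"
  proof (rule integral_norm_bound_integral)
    show "norm (norm (d_theta c \<theta>) - norm (d_theta e \<theta>)) \<le> B" for \<theta>
      using order_trans[OF norm_triangle_ineq3 B] by simp
  qed (use has_integral_integrable[OF h] in auto)
  then show ?thesis using integral_unique[OF h] by simp
qed

context
  fixes n :: nat and \<gamma> :: "real \<Rightarrow> real \<Rightarrow> real ^ 'd" and v :: "real \<Rightarrow> real ^ 'd" and t :: real and S :: "real set"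
  assumes n: "n \<ge> 2" and \<gamma>: "\<And>u. u \<in> S \<Longrightarrow> \<gamma> u \<in> sobolev n" and t: "t \<in> S" and v: "v \<in> sobolev n"
    and D: "has_sobolev_derivative n \<gamma> v t S"
begin

text \<open>The error of the difference quotient at time \<open>t\<close>. Its Sobolev norm tends to
  0, and the embedding turns this into convergence of its values and first derivatives, uniformly in
  the parameter.\<close>

private abbreviation (input) q where "q u \<equiv> (\<lambda>\<theta>. (1 / (u - t)) *\<^sub>R (\<gamma> u \<theta> - \<gamma> t \<theta>) - v \<theta>)"

private lemma q_loc_sobolev:
  assumes u: "u \<in> S"
  shows "loc_sobolev n (q u)" "periodic (q u)"
    "d_theta (q u) \<theta> = (1 / (u - t)) *\<^sub>R (d_theta (\<gamma> u) \<theta> - d_theta (\<gamma> t) \<theta>) - d_theta v \<theta>"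
proof -
  note l = sobolev_loc_sobolev[OF \<gamma>[OF u]] sobolev_loc_sobolev[OF \<gamma>[OF t]] sobolev_loc_sobolev[OF v]
  have n1: "1 \<le> n" "1 < n" using n by auto
  show "loc_sobolev n (q u)" by (intro loc_sobolev_diff loc_sobolev_cmul l n1)
  show "periodic (q u)" using \<gamma>[OF u] \<gamma>[OF t] v by (simp add: sobolev_def periodic_def)
  note d = l[OF n1(1), THEN loc_sobolev_has_vector_derivative, OF n1(2), of \<theta>]
  show "d_theta (q u) \<theta> = (1 / (u - t)) *\<^sub>R (d_theta (\<gamma> u) \<theta> - d_theta (\<gamma> t) \<theta>) - d_theta v \<theta>"
    unfolding d_theta_def
    by (intro vector_derivative_at has_vector_derivative_diff bounded_linear.has_vector_derivative[OF bounded_linear_scaleR_right] d)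
qed

private lemma q_tendsto: "((\<lambda>u. 2 * sqrt (2 * pi) * sobolev_norm n (q u)) \<longlongrightarrow> 0) (at t within S)"
  using tendsto_mult_left[OF D[unfolded has_sobolev_derivative_def], of "2 * sqrt (2 * pi)"] by simp

lemma sobolev_derivative_pointwise:
  "((\<lambda>u. \<gamma> u \<theta>) has_vector_derivative v \<theta>) (at t within S)"
  by (rule has_vector_derivative_quotientI[OF q_tendsto])
    (rule sobolev_embedding(2)[OF q_loc_sobolev(1,2) n])

text \<open>Time and parameter derivatives commute because the embedding also bounds the parameter
  derivative of \<open>q u\<close>.\<close>

lemma sobolev_derivative_d_theta:
  "((\<lambda>u. d_theta (\<gamma> u) \<theta>) has_vector_derivative d_theta v \<theta>) (at t within S)"
  by (rule has_vector_derivative_quotientI[OF q_tendsto])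
    (use sobolev_embedding(1)[OF q_loc_sobolev(1,2) n] q_loc_sobolev(3) in simp)

text \<open>The velocity vectors at times \<open>u\<close> and \<open>t\<close> differ by at most
  \<open>\<bar>u - t\<bar>\<close> times a quantity that stays bounded near \<open>t\<close>,
  uniformly in the parameter, and the length inherits this estimate.\<close>

lemma sobolev_derivative_curve_length:
  assumes imm: "\<And>u. u \<in> S \<Longrightarrow> \<gamma> u \<in> immersions n"
  shows "((\<lambda>u. curve_length (\<gamma> u)) \<longlongrightarrow> curve_length (\<gamma> t)) (at t within S)"
proof -
  let ?K = "2 * sqrt (2 * pi)"
  have le: "norm (curve_length (\<gamma> u) - curve_length (\<gamma> t)) \<le> 2 * pi * (\<bar>u - t\<bar> * (?K * sobolev_norm n (q u) + ?K * sobolev_norm n v))"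
    if u: "u \<in> S" "u \<noteq> t" for u
  proof -
    have "norm (d_theta (\<gamma> u) \<theta> - d_theta (\<gamma> t) \<theta>) \<le> \<bar>u - t\<bar> * (?K * sobolev_norm n (q u) + ?K * sobolev_norm n v)" for \<theta>
    proof -
      have "d_theta (\<gamma> u) \<theta> - d_theta (\<gamma> t) \<theta> = (u - t) *\<^sub>R (d_theta (q u) \<theta> + d_theta v \<theta>)"
        unfolding q_loc_sobolev(3)[OF u(1)] using u(2) by simp
      also have "norm \<dots> \<le> \<bar>u - t\<bar> * (norm (d_theta (q u) \<theta>) + norm (d_theta v \<theta>))"
        by (simp add: mult_left_mono norm_triangle_ineq)
      also have "\<dots> \<le> \<bar>u - t\<bar> * (?K * sobolev_norm n (q u) + ?K * sobolev_norm n v)"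
        using v n by (intro mult_left_mono add_mono sobolev_embedding q_loc_sobolev u sobolev_loc_sobolev) (auto simp: sobolev_def)
      finally show ?thesis .
    qed
    then show ?thesis using curve_length_dist_le[OF n imm[OF u(1)] imm[OF t]] by simp
  qed
  have "((\<lambda>u. 2 * pi * (\<bar>u - t\<bar> * (?K * sobolev_norm n (q u) + ?K * sobolev_norm n v))) \<longlongrightarrow>
      2 * pi * (\<bar>t - t\<bar> * (0 + ?K * sobolev_norm n v))) (at t within S)"
    by (intro tendsto_intros q_tendsto)
  then have "((\<lambda>u. 2 * pi * (\<bar>u - t\<bar> * (?K * sobolev_norm n (q u) + ?K * sobolev_norm n v))) \<longlongrightarrow> 0) (at t within S)" by simp
  then have "((\<lambda>u. curve_length (\<gamma> u) - curve_length (\<gamma> t)) \<longlongrightarrow> 0) (at t within S)"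
    by (rule Lim_null_comparison[rotated]) (use le in \<open>auto simp: eventually_at_filter intro!: eventuallyI\<close>)
  then show ?thesis by (simp add: LIM_zero_iff)
qed

end

lemma continuous_on_concat_intervals:
  fixes f :: "real \<Rightarrow> 'a::topological_space"
  assumes "\<And>i. i < N \<Longrightarrow> \<tau> i < \<tau> (Suc i) \<and> continuous_on {\<tau> i..\<tau> (Suc i)} f"
  shows "continuous_on {\<tau> 0..\<tau> N} f \<and> \<tau> 0 \<le> \<tau> N"
  using assms
proof (induction N)
  case (Suc N)
  then have *: "continuous_on {\<tau> 0..\<tau> N} f" "\<tau> 0 \<le> \<tau> N" "\<tau> N < \<tau> (Suc N)" "continuous_on {\<tau> N..\<tau> (Suc N)} f" by auto
  then have "continuous_on ({\<tau> 0..\<tau> N} \<union> {\<tau> N..\<tau> (Suc N)}) f" by (intro continuous_on_closed_Un) auto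
  moreover have "{\<tau> 0..\<tau> N} \<union> {\<tau> N..\<tau> (Suc N)} = {\<tau> 0..\<tau> (Suc N)}" using * by (intro ivl_disj_un_two_touch) auto
  ultimately show ?case using * by simp
qed simp

lemma interval_partition_cases:
  fixes \<tau> :: "nat \<Rightarrow> real"
  assumes "\<tau> 0 < t" "t < \<tau> N" "t \<notin> \<tau> ` {..N}"
  obtains i where "i < N" "\<tau> i < t" "t < \<tau> (Suc i)"
proof -
  have "\<exists>i<N. \<tau> i < t \<and> t < \<tau> (Suc i)"
    using assms
  proof (induction N)
    case (Suc N)
    show ?case
    proof (cases "t < \<tau> N")
      case True
      then show ?thesis using Suc less_SucI by (metis atMost_Suc image_insert insertCI)
    next
      case False
      then have "\<tau> N < t" using Suc.prems(3) by (auto simp: image_iff not_less order_less_le)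
      then show ?thesis using Suc.prems(2) by blast
    qed
  qed simp
  then show thesis using that by blast
qed

text \<open>\<open>T\<close> consists of the break points, where the one-sided derivatives may
  differ. At any other interior time the one-sided neighbourhoods in the definitions are full ones,
  so \<open>d_t\<close> is the derivative in H^n. Continuity also holds at break points, since
  adjacent closed pieces share them.\<close>

lemma immersion_path_regularity:
  fixes \<gamma> :: "real \<Rightarrow> real \<Rightarrow> real ^ 'd"
  assumes \<gamma>: "\<gamma> \<in> immersion_paths n c0 c1" and n: "n \<ge> 2"
  obtains T where "finite T" "\<And>t. t \<in> {0<..<1} - T \<Longrightarrow> d_t \<gamma> t \<in> sobolev n"
    "\<And>t \<theta>. t \<in> {0<..<1} - T \<Longrightarrow> ((\<lambda>u. d_theta (\<gamma> u) \<theta>) has_vector_derivative d_theta (d_t \<gamma> t) \<theta>) (at t)"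
    "continuous_on {0..1} (\<lambda>t. curve_length (\<gamma> t))" "\<And>\<theta>. continuous_on {0..1} (\<lambda>t. d_theta (\<gamma> t) \<theta>)"
proof -
  have imm: "\<gamma> t \<in> immersions n" if "t \<in> {0..1}" for t using \<gamma> that by (auto simp: immersion_paths_def)
  obtain N \<tau> where \<tau>: "\<tau> 0 = (0::real)" "\<tau> N = 1" "\<And>i. i < N \<Longrightarrow> \<tau> i < \<tau> (Suc i)"
    and sm: "\<And>i. i < N \<Longrightarrow> smooth_path_on n {\<tau> i..\<tau> (Suc i)} \<gamma>"
    using \<gamma> unfolding immersion_paths_def piecewise_smooth_path_def by blast
  have mono: "\<tau> i \<le> \<tau> j" if "i \<le> j" "j \<le> N" for i j
    using that by (induction rule: dec_induct) (auto intro!: order_trans[OF _ less_imp_le[OF \<tau>(3)]])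
  have sub: "{\<tau> i..\<tau> (Suc i)} \<subseteq> {0..1}" if "i < N" for i
    using mono[of 0 i] mono[of "Suc i" N] that \<tau>(1,2) by auto
  have "\<exists>v. \<forall>t\<in>{\<tau> i..\<tau> (Suc i)}. v t \<in> sobolev n \<and> has_sobolev_derivative n \<gamma> (v t) t {\<tau> i..\<tau> (Suc i)}" if iN: "i < N" for i
  proof -
    obtain \<Gamma> where \<Gamma>: "\<Gamma> 0 = \<gamma>" "\<forall>k. \<forall>t\<in>{\<tau> i..\<tau> (Suc i)}. \<Gamma> k t \<in> sobolev n \<and> has_sobolev_derivative n (\<Gamma> k) (\<Gamma> (Suc k) t) t {\<tau> i..\<tau> (Suc i)}"
      using sm[OF iN] unfolding smooth_path_on_def by blast
    have "\<forall>t\<in>{\<tau> i..\<tau> (Suc i)}. \<Gamma> (Suc 0) t \<in> sobolev n \<and> has_sobolev_derivative n \<gamma> (\<Gamma> (Suc 0) t) t {\<tau> i..\<tau> (Suc i)}"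
      using \<Gamma>(2) unfolding \<Gamma>(1)[symmetric] by blast
    then show ?thesis by (rule exI[of _ "\<Gamma> (Suc 0)"])
  qed
  then obtain v where v: "\<And>i t. i < N \<Longrightarrow> t \<in> {\<tau> i..\<tau> (Suc i)} \<Longrightarrow> v i t \<in> sobolev n"
    and D: "\<And>i t. i < N \<Longrightarrow> t \<in> {\<tau> i..\<tau> (Suc i)} \<Longrightarrow> has_sobolev_derivative n \<gamma> (v i t) t {\<tau> i..\<tau> (Suc i)}"
    by metis
  have sob: "\<gamma> t \<in> sobolev n" if "i < N" "t \<in> {\<tau> i..\<tau> (Suc i)}" for i t
    using imm sub[OF that(1)] that(2) by (auto simp: immersions_def)
  have key: "d_t \<gamma> t \<in> sobolev n \<and> (\<forall>\<theta>. ((\<lambda>u. d_theta (\<gamma> u) \<theta>) has_vector_derivative d_theta (d_t \<gamma> t) \<theta>) (at t))"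
    if t: "t \<in> {0<..<1} - \<tau> ` {..N}" for t
  proof -
    obtain i where i: "i < N" "\<tau> i < t" "t < \<tau> (Suc i)"
      using interval_partition_cases[of \<tau> t N] t \<tau>(1,2) by auto
    then have tS: "t \<in> {\<tau> i..\<tau> (Suc i)}" by auto
    have at: "at t within {\<tau> i..\<tau> (Suc i)} = at t"
      using i by (intro at_within_interior) auto
    note args = n sob[OF i(1)] tS v[OF i(1) tS] D[OF i(1) tS]
    have "d_t \<gamma> t \<theta> = v i t \<theta>" for \<theta>
      unfolding d_t_def
      by (rule vector_derivative_at_within_ivl[where a = 0 and b = 1])
        (use sobolev_derivative_pointwise[OF args, of \<theta>] t in \<open>auto simp: at\<close>)
    then have dt: "d_t \<gamma> t = v i t" by blast
    show ?thesis unfolding dt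
      using v[OF i(1) tS] sobolev_derivative_d_theta[OF args] by (simp add: at)
  qed
  have "continuous_on {\<tau> 0..\<tau> N} (\<lambda>t. curve_length (\<gamma> t)) \<and> \<tau> 0 \<le> \<tau> N"
  proof (rule continuous_on_concat_intervals)
    fix i assume i: "i < N"
    have "continuous_on {\<tau> i..\<tau> (Suc i)} (\<lambda>t. curve_length (\<gamma> t))"
      unfolding continuous_on_def using sub[OF i] imm
      by (intro ballI sobolev_derivative_curve_length[OF n sob[OF i] _ v[OF i] D[OF i]]) auto
    then show "\<tau> i < \<tau> (Suc i) \<and> continuous_on {\<tau> i..\<tau> (Suc i)} (\<lambda>t. curve_length (\<gamma> t))" using \<tau>(3)[OF i] by simp
  qed
  then have c1: "continuous_on {0..1} (\<lambda>t. curve_length (\<gamma> t))" using \<tau>(1,2) by simp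
  have "continuous_on {\<tau> 0..\<tau> N} (\<lambda>t. d_theta (\<gamma> t) \<theta>) \<and> \<tau> 0 \<le> \<tau> N" for \<theta>
  proof (rule continuous_on_concat_intervals)
    fix i assume i: "i < N"
    have "continuous_on {\<tau> i..\<tau> (Suc i)} (\<lambda>t. d_theta (\<gamma> t) \<theta>)"
      unfolding continuous_on_eq_continuous_within
    proof
      fix t assume t: "t \<in> {\<tau> i..\<tau> (Suc i)}"
      show "continuous (at t within {\<tau> i..\<tau> (Suc i)}) (\<lambda>t. d_theta (\<gamma> t) \<theta>)"
        by (rule has_vector_derivative_continuous[OF sobolev_derivative_d_theta[OF n sob[OF i] t v[OF i t] D[OF i t]]])
    qed
    then show "\<tau> i < \<tau> (Suc i) \<and> continuous_on {\<tau> i..\<tau> (Suc i)} (\<lambda>t. d_theta (\<gamma> t) \<theta>)" using \<tau>(3)[OF i] by simp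
  qed
  then have c2: "continuous_on {0..1} (\<lambda>t. d_theta (\<gamma> t) \<theta>)" for \<theta> using \<tau>(1,2) by simp
  show thesis
    by (rule that[of "\<tau> ` {..N}"]) (use key c1 c2 in auto)
qed

section \<open>Lower bounds for the length of a path\<close>

lemma has_integral_abs_le_nn_integral:
  fixes f :: "real \<Rightarrow> real"
  assumes f: "(f has_integral I) S"
  shows "ennreal \<bar>I\<bar> \<le> (\<integral>\<^sup>+t. ennreal \<bar>indicator S t * f t\<bar> \<partial>lebesgue)"
proof (cases "(\<integral>\<^sup>+t. ennreal \<bar>indicator S t * f t\<bar> \<partial>lebesgue) = \<infinity>")
  \<comment> \<open>A gauge integrable function is measurable, so a finite right side makes it
    absolutely integrable, and its two integrals agree.\<close>
  case False
  have "(\<lambda>t. indicator S t *\<^sub>R f t) \<in> borel_measurable lebesgue"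
    by (rule has_integral_implies_lebesgue_measurable[OF f])
  then have i: "integrable lebesgue (\<lambda>t. indicator S t *\<^sub>R f t)"
    using False by (intro integrableI_bounded) (auto simp: top.not_eq_extremum)
  then have "f absolutely_integrable_on S" by (simp add: set_integrable_def)
  then have "I = (LINT t:S|lebesgue. f t)"
    using has_integral_unique[OF f has_integral_set_lebesgue] by blast
  then show ?thesis
    using integral_norm_bound_ennreal[OF i] by (simp add: set_lebesgue_integral_def)
qed simp

lemma admissible_continuous:
  assumes "admissible_coefficients n a" "j \<le> n"
  shows "continuous_on {0<..} (a j)"
proof (rule continuous_at_imp_continuous_on, rule ballI)
  fix x :: real assume "x \<in> {0<..}"
  then have "(deriv ^^ 0) (a j) differentiable (at x)"
    using assms unfolding admissible_coefficients_def smooth_fun_on_def by blast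
  then show "isCont (a j) x" by (auto intro: differentiable_imp_continuous_within)
qed

text \<open>\<open>sqrt (\<Lambda> ^ (2 * n - 3) / \<alpha>)\<close> is the constant of
  \<open>D_s_norm_le_metric\<close> made uniform over the times in \<open>{s..1}\<close>. It does
  not depend on \<open>\<theta>\<close>, so a short path changes the speed by nearly the same factor
  everywhere on the circle. It stands as a divisor on the left, where the quantities are real,
  because the path length may be infinite.\<close>

lemma log_speed_change_le_path_length:
  assumes \<gamma>: "\<gamma> \<in> immersion_paths n c0 c1" and n: "n \<ge> 2" and a: "admissible_coefficients n a"
    and s: "0 \<le> s" "s \<le> 1" and \<alpha>: "\<alpha> > 0" and \<Lambda>: "\<Lambda> > 0"
    and bnd: "\<And>t. t \<in> {s..1} \<Longrightarrow> \<alpha> \<le> a n (curve_length (\<gamma> t)) \<and> curve_length (\<gamma> t) \<le> \<Lambda>"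
  shows "ennreal (\<bar>ln (norm (d_theta (\<gamma> 1) \<theta>)) - ln (norm (d_theta (\<gamma> s) \<theta>))\<bar> / sqrt (\<Lambda> ^ (2 * n - 3) / \<alpha>)) \<le> path_length n a \<gamma>"
proof -
  have imm: "\<gamma> t \<in> immersions n" if "t \<in> {0..1}" for t using \<gamma> that by (auto simp: immersion_paths_def)
  define C where "C = sqrt (\<Lambda> ^ (2 * n - 3) / \<alpha>)"
  have "C > 0" using \<alpha> \<Lambda> by (simp add: C_def)
  let ?p = "\<lambda>t. d_theta (\<gamma> t) \<theta>" and ?p' = "\<lambda>t. d_theta (d_t \<gamma> t) \<theta>"
  let ?G = "\<lambda>t. sobolev_metric n a (\<gamma> t) (d_t \<gamma> t) (d_t \<gamma> t)"
  obtain T where T: "finite T" "\<And>t. t \<in> {0<..<1} - T \<Longrightarrow> d_t \<gamma> t \<in> sobolev n"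
    "\<And>t. t \<in> {0<..<1} - T \<Longrightarrow> (?p has_vector_derivative ?p' t) (at t)"
    "continuous_on {0..1} ?p"
    by (rule immersion_path_regularity[OF \<gamma> n]) (rule that)
  have nz: "?p t \<noteq> 0" if "t \<in> {0..1}" for t using immersionsD(3)[OF imm[OF that] n] .
  define u' where "u' t = (?p t \<bullet> ?p' t) / (norm (?p t))\<^sup>2" for t
  have "(u' has_integral ln (norm (?p 1)) - ln (norm (?p s))) {s..1}"
  proof (rule fundamental_theorem_of_calculus_interior_strong[OF T(1) s(2)])
    show "continuous_on {s..1} (\<lambda>t. ln (norm (?p t)))"
      by (intro continuous_intros continuous_on_subset[OF T(4)]) (use s nz in auto)
    fix t assume "t \<in> {s<..<1} - T"
    then have t: "t \<in> {0<..<1} - T" "t \<in> {0..1}" using s by auto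
    have "(?p has_derivative (\<lambda>h. h *\<^sub>R ?p' t)) (at t)" using T(3)[OF t(1)] by (simp add: has_vector_derivative_def)
    from has_derivative_compose[OF this has_derivative_norm[OF nz[OF t(2)]]]
    have "((\<lambda>t. norm (?p t)) has_real_derivative (?p' t \<bullet> sgn (?p t))) (at t)"
      by (simp add: has_field_derivative_def mult_commute_abs)
    from DERIV_ln_divide[THEN DERIV_chain2, OF _ this]
    have "((\<lambda>t. ln (norm (?p t))) has_real_derivative 1 / norm (?p t) * (?p' t \<bullet> sgn (?p t))) (at t)"
      using nz[OF t(2)] by simp
    also have "1 / norm (?p t) * (?p' t \<bullet> sgn (?p t)) = u' t"
      by (simp add: u'_def sgn_div_norm inner_commute power2_eq_square divide_simps)
    finally show "((\<lambda>t. ln (norm (?p t))) has_vector_derivative u' t) (at t)"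
      by (simp add: has_real_derivative_iff_has_vector_derivative)
  qed
  then have "((\<lambda>t. u' t / C) has_integral (ln (norm (?p 1)) - ln (norm (?p s))) / C) {s..1}"
    by (rule has_integral_divide)
  from has_integral_abs_le_nn_integral[OF this]
  have "ennreal \<bar>(ln (norm (?p 1)) - ln (norm (?p s))) / C\<bar> \<le> (\<integral>\<^sup>+t. ennreal \<bar>indicator {s..1} t * (u' t / C)\<bar> \<partial>lebesgue)" .
  also have "\<dots> \<le> path_length n a \<gamma>"
    unfolding path_length_def
  proof (rule nn_integral_mono_AE)
    have le: "\<bar>u' t / C\<bar> \<le> sqrt (?G t)" if "t \<in> {s<..<1} - T" for t
    proof -
      have t: "t \<in> {0<..<1} - T" "t \<in> {0..1}" "t \<in> {s..1}" using that s by auto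
      note im = imm[OF t(2)]
      have pos: "norm (?p t) > 0" using nz[OF t(2)] by simp
      have ap: "a j (curve_length (\<gamma> t)) \<ge> 0" if "j \<le> n" for j
        using a that curve_length_pos[OF im n] by (auto simp: admissible_coefficients_def)
      have "\<alpha> * (norm (D_s (\<gamma> t) (d_t \<gamma> t) \<theta>))\<^sup>2 \<le> a n (curve_length (\<gamma> t)) * (norm (D_s (\<gamma> t) (d_t \<gamma> t) \<theta>))\<^sup>2"
        using bnd[OF t(3)] by (intro mult_right_mono) auto
      also have "\<dots> \<le> curve_length (\<gamma> t) ^ (2 * n - 3) * ?G t"
      proof (rule D_s_norm_le_metric[where a = a, OF im n _ _ ap])
        show "loc_sobolev n (d_t \<gamma> t)" using sobolev_loc_sobolev[OF T(2)[OF t(1)]] n by simp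
        show "periodic (d_t \<gamma> t)" using T(2)[OF t(1)] by (simp add: sobolev_def)
      qed
      also have "\<dots> \<le> \<Lambda> ^ (2 * n - 3) * ?G t"
      proof (intro mult_right_mono power_mono)
        show "curve_length (\<gamma> t) \<le> \<Lambda>" using bnd[OF t(3)] by simp
        show "0 \<le> curve_length (\<gamma> t)" using curve_length_pos[OF im n] by simp
        show "0 \<le> ?G t" unfolding sobolev_metric_def arclength_integral_def
          by (intro sum_nonneg circle_integral_nonneg mult_nonneg_nonneg ap) auto
      qed
      finally have "(norm (D_s (\<gamma> t) (d_t \<gamma> t) \<theta>))\<^sup>2 \<le> (\<Lambda> ^ (2 * n - 3) / \<alpha>) * ?G t"
        using \<alpha> by (simp add: field_simps)
      then have "norm (D_s (\<gamma> t) (d_t \<gamma> t) \<theta>) \<le> C * sqrt (?G t)"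
        unfolding C_def real_sqrt_mult[symmetric] by (rule real_le_rsqrt)
      moreover have "\<bar>u' t\<bar> \<le> norm (D_s (\<gamma> t) (d_t \<gamma> t) \<theta>)"
      proof -
        have "\<bar>u' t\<bar> = \<bar>?p t \<bullet> ?p' t\<bar> / (norm (?p t))\<^sup>2" by (simp add: u'_def abs_divide)
        also have "\<dots> \<le> norm (?p t) * norm (?p' t) / (norm (?p t))\<^sup>2"
          by (intro divide_right_mono Cauchy_Schwarz_ineq2) simp
        also have "\<dots> = norm (D_s (\<gamma> t) (d_t \<gamma> t) \<theta>)" using pos by (simp add: D_s_def power2_eq_square)
        finally show ?thesis .
      qed
      ultimately have "\<bar>u' t\<bar> \<le> C * sqrt (?G t)" by linarith
      then show ?thesis using \<open>C > 0\<close> by (simp add: abs_divide divide_le_eq mult.commute)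
    qed
    have "negligible (T \<union> {s, 1})" using T(1) by (simp add: negligible_finite)
    moreover have "ennreal \<bar>indicator {s..1} t * (u' t / C)\<bar> \<le> ennreal (sqrt (?G t)) * indicator {0..1} t" if "t \<notin> T \<union> {s, 1}" for t
      using le[of t] that s by (auto simp: indicator_def intro!: ennreal_leI)
    ultimately show "AE t in lebesgue. ennreal \<bar>indicator {s..1} t * (u' t / C)\<bar> \<le> ennreal (sqrt (?G t)) * indicator {0..1} t"
      unfolding eventually_ae_filter_negligible by blast
  qed
  finally show ?thesis using \<open>C > 0\<close> by (simp add: abs_divide C_def)
qed

lemma length_escape_cost:
  fixes l :: "real \<Rightarrow> real ^ 'd"
  assumes n: "n \<ge> 2" and a: "admissible_coefficients n a" and l: "l \<in> immersions n"
  obtains \<epsilon> :: ennreal where "\<epsilon> > 0"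
    "\<And>c. curve_length c \<notin> {curve_length l / 2<..<2 * curve_length l} \<Longrightarrow> \<epsilon> \<le> geodesic_dist n a c l"
proof -
  define L where "L = curve_length l"
  have Lpos: "L > 0" unfolding L_def by (rule curve_length_pos[OF l n])
  \<comment> \<open>The interval is compact and lies in the positive reals, so \<open>a n\<close>
    has a positive minimum there. This makes the cost depend on \<open>l\<close> alone and not on
    the path.\<close>
  have "\<exists>x\<in>{L / 2..2 * L}. \<forall>y\<in>{L / 2..2 * L}. a n x \<le> a n y"
    by (rule continuous_attains_inf) (use Lpos in \<open>auto intro!: continuous_on_subset[OF admissible_continuous[OF a order_refl]]\<close>)
  then obtain x where x: "x \<in> {L / 2..2 * L}" "\<And>y. y \<in> {L / 2..2 * L} \<Longrightarrow> a n x \<le> a n y" by blast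
  have \<alpha>: "a n x > 0" using a x(1) Lpos by (auto simp: admissible_coefficients_def)
  define C where "C = sqrt ((2 * L) ^ (2 * n - 3) / a n x)"
  have "C > 0" using \<alpha> Lpos by (simp add: C_def)
  \<comment> \<open>Half of \<open>ln 2\<close>: a cheaper path changes the speeds, and hence the
    length, by a factor of at most the square root of 2. That is strictly less than the factor 2
    which leaving the interval requires.\<close>
  define \<epsilon> where "\<epsilon> = ln 2 / 2 / C"
  have \<epsilon>: "\<epsilon> > 0" using \<open>C > 0\<close> by (simp add: \<epsilon>_def)
  have main: "ennreal \<epsilon> \<le> path_length n a \<gamma>" if out: "curve_length c \<notin> {L / 2<..<2 * L}" and \<gamma>: "\<gamma> \<in> immersion_paths n c l" for c \<gamma>
  proof (rule ccontr)
    assume "\<not> ennreal \<epsilon> \<le> path_length n a \<gamma>"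
    then have small: "path_length n a \<gamma> < ennreal \<epsilon>" by simp
    have imm: "\<gamma> t \<in> immersions n" if "t \<in> {0..1}" for t using \<gamma> that by (auto simp: immersion_paths_def)
    have ends: "\<gamma> 0 = c" "\<gamma> 1 = l" using \<gamma> by (auto simp: immersion_paths_def)
    let ?l = "\<lambda>t. curve_length (\<gamma> t)"
    have cl: "continuous_on {0..1} ?l" by (rule immersion_path_regularity[OF \<gamma> n])
    \<comment> \<open>The latest time \<open>s\<close> in this compact set is the last moment
      outside the open interval. After it the length stays in the closed interval, and by continuity
      so it does at \<open>s\<close> itself; the constant \<open>C\<close> is thus valid on
      \<open>{s..1}\<close>, and the comparison with \<open>l\<close> contradicts the choice of
      \<open>s\<close>.\<close>
    define bad where "bad = {0..1} \<inter> ?l -` ({..L / 2} \<union> {2 * L..})"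
    have "closed bad" unfolding bad_def by (intro continuous_closed_preimage[OF cl] closed_Un) auto
    moreover have "bounded bad" by (rule bounded_subset[of "{0..1}"]) (auto simp: bad_def)
    ultimately have "compact bad" by (simp add: compact_eq_bounded_closed)
    moreover have "0 \<in> bad" using out ends by (auto simp: bad_def)
    ultimately obtain s where s: "s \<in> bad" "\<And>t. t \<in> bad \<Longrightarrow> t \<le> s" using compact_attains_sup[of bad] by blast
    have s01: "0 \<le> s" "s \<le> 1" using s(1) by (auto simp: bad_def)
    have "s \<noteq> 1" using s(1) ends Lpos by (auto simp: bad_def L_def)
    then have s1: "s < 1" using s01 by simp
    have good: "?l t \<in> {L / 2..2 * L}" if "t \<in> {s<..1}" for t
      using s(2)[of t] that s01 by (force simp: bad_def)
    have "closed ({0..1} \<inter> ?l -` {L / 2..2 * L})" by (intro continuous_closed_preimage[OF cl]) auto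
    then have "closure {s<..1} \<subseteq> {0..1} \<inter> ?l -` {L / 2..2 * L}"
      by (intro closure_minimal) (use good s01 in auto)
    then have good': "?l t \<in> {L / 2..2 * L}" if "t \<in> {s..1}" for t using that s1 by auto
    have ln_bound: "\<bar>ln (norm (d_theta l \<theta>)) - ln (norm (d_theta (\<gamma> s) \<theta>))\<bar> < ln 2 / 2" for \<theta>
    proof -
      have "ennreal (\<bar>ln (norm (d_theta (\<gamma> 1) \<theta>)) - ln (norm (d_theta (\<gamma> s) \<theta>))\<bar> / C) \<le> path_length n a \<gamma>"
        unfolding C_def
        by (rule log_speed_change_le_path_length[OF \<gamma> n a s01 \<alpha>]) (use Lpos good' x(2) in auto)
      then have "ennreal (\<bar>ln (norm (d_theta (\<gamma> 1) \<theta>)) - ln (norm (d_theta (\<gamma> s) \<theta>))\<bar> / C) < ennreal \<epsilon>"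
        using small by (rule le_less_trans)
      then have "\<bar>ln (norm (d_theta (\<gamma> 1) \<theta>)) - ln (norm (d_theta (\<gamma> s) \<theta>))\<bar> / C < ln 2 / 2 / C"
        using \<open>C > 0\<close> by (subst (asm) ennreal_less_iff) (auto simp: \<epsilon>_def)
      moreover have "X < ln 2 / 2" if "X / C < ln 2 / 2 / C" for X
        using that \<open>C > 0\<close> by (metis divide_less_cancel order_less_asym)
      ultimately show ?thesis using ends by simp
    qed
    define \<mu> :: real where "\<mu> = exp (ln 2 / 2)"
    have \<mu>: "0 < \<mu>" "\<mu> < 2"
    proof -
      have "\<mu> < exp (ln 2)" unfolding \<mu>_def by (subst exp_less_cancel_iff) simp
      then show "\<mu> < 2" by simp
    qed (simp add: \<mu>_def)
    have ims: "\<gamma> s \<in> immersions n" by (rule imm) (use s01 in auto)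
    have le: "norm (d_theta (\<gamma> s) \<theta>) \<le> \<mu> * norm (d_theta l \<theta>) \<and> norm (d_theta l \<theta>) \<le> \<mu> * norm (d_theta (\<gamma> s) \<theta>)" for \<theta>
    proof -
      have A: "y \<le> \<mu> * z" if "y > 0" "z > 0" "ln y - ln z < ln 2 / 2" for y z :: real
      proof -
        have "exp (ln y) \<le> exp (ln 2 / 2 + ln z)" using that by (subst exp_le_cancel_iff) linarith
        then show ?thesis using that by (simp add: exp_add \<mu>_def)
      qed
      show ?thesis using ln_bound[of \<theta>] speed_pos[OF ims n, of \<theta>] speed_pos[OF l n, of \<theta>] by (intro conjI A) linarith+
    qed
    have "?l s \<le> \<mu> * L"
      using has_integral_le[OF curve_length_has_integral[OF ims n] has_integral_mult_right[OF curve_length_has_integral[OF l n], of \<mu>]] le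
      by (simp add: L_def)
    moreover have "L \<le> \<mu> * ?l s"
      using has_integral_le[OF curve_length_has_integral[OF l n] has_integral_mult_right[OF curve_length_has_integral[OF ims n], of \<mu>]] le
      by (simp add: L_def)
    moreover have "\<mu> * L < 2 * L" using \<mu> Lpos by simp
    moreover have "\<mu> * ?l s < 2 * ?l s" using \<mu> curve_length_pos[OF ims n] by simp
    ultimately have "?l s \<in> {L / 2<..<2 * L}" by auto
    then show False using s(1) by (auto simp: bad_def)
  qed
  show thesis
  proof (rule that[of "ennreal \<epsilon>"])
    show "ennreal \<epsilon> > 0" using \<epsilon> by simp
    fix c :: "real \<Rightarrow> real ^ 'd" assume "curve_length c \<notin> {curve_length l / 2<..<2 * curve_length l}"
    then show "ennreal \<epsilon> \<le> geodesic_dist n a c l"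
      unfolding geodesic_dist_def using main by (intro INF_greatest) (auto simp: L_def)
  qed
qed

subsection \<open>Paths of homothetic curves\<close>

lemma sobolev_scaleR:
  assumes c: "c \<in> sobolev n"
  shows "(\<lambda>\<theta>. r *\<^sub>R c \<theta>) \<in> sobolev n"
proof -
  have "\<exists>g\<in>L2_circle. weak_deriv j (\<lambda>\<theta>. r *\<^sub>R c \<theta>) g" if j: "j \<le> n" for j
  proof -
    obtain g where g: "g \<in> L2_circle" "weak_deriv j c g" using c j by (auto simp: sobolev_def)
    have ci: "circle_integral (\<lambda>\<theta>. \<phi> \<theta> *\<^sub>R (r *\<^sub>R f \<theta>)) = r *\<^sub>R circle_integral (\<lambda>\<theta>. \<phi> \<theta> *\<^sub>R f \<theta>)"
      for \<phi> and f :: "real \<Rightarrow> real ^ 'a"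
      by (simp only: circle_integral_def scaleR_left_commute[of _ r] set_integral_scaleR_right)
    have "weak_deriv j (\<lambda>\<theta>. r *\<^sub>R c \<theta>) (\<lambda>\<theta>. r *\<^sub>R g \<theta>)"
      using g(2) unfolding weak_deriv_def ci by (simp add: scaleR_left_commute[of r])
    moreover have "(\<lambda>\<theta>. r *\<^sub>R g \<theta>) \<in> L2_circle"
      using g(1) by (auto simp: L2_circle_def periodic_def power_mult_distrib)
    ultimately show ?thesis by blast
  qed
  moreover have "periodic (\<lambda>\<theta>. r *\<^sub>R c \<theta>)" "continuous_on UNIV (\<lambda>\<theta>. r *\<^sub>R c \<theta>)"
    using c by (auto simp: sobolev_def periodic_def intro!: continuous_intros)
  ultimately show ?thesis by (simp add: sobolev_def)
qed

lemma d_theta_scaleR: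
  assumes "(F has_vector_derivative D) (at \<theta>)"
  shows "d_theta (\<lambda>\<theta>. k *\<^sub>R F \<theta>) \<theta> = k *\<^sub>R d_theta F \<theta>"
proof -
  have "((\<lambda>\<theta>. k *\<^sub>R F \<theta>) has_vector_derivative k *\<^sub>R D) (at \<theta>)"
    using bounded_linear.has_vector_derivative[OF bounded_linear_scaleR_right assms] .
  then show ?thesis using assms by (simp add: d_theta_def vector_derivative_at)
qed

lemma sobolev_norm_zero: "sobolev_norm n (\<lambda>\<theta>. 0 :: real ^ 'd) = 0"
proof -
  have "(d_theta ^^ j) (\<lambda>\<theta>. 0 :: real ^ 'd) = (\<lambda>\<theta>. 0)" for j
  proof (induction j)
    case (Suc j)
    then show ?case by (simp add: d_theta_eq)
  qed simp
  then show ?thesis by (simp add: sobolev_norm_def circle_integral_def)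
qed

lemma sqrt_sum_le_sum_sqrt:
  assumes "\<And>i. i \<in> A \<Longrightarrow> 0 \<le> f i"
  shows "sqrt (\<Sum>i\<in>A. f i) \<le> (\<Sum>i\<in>A. sqrt (f i))"
proof -
  have "sqrt (\<Sum>i\<in>A. f i) = L2_set (\<lambda>i. sqrt (f i)) A" using assms by (simp add: L2_set_def)
  also have "\<dots> \<le> (\<Sum>i\<in>A. sqrt (f i))" using assms by (intro L2_set_le_sum) simp
  finally show ?thesis .
qed

definition arclength_energy :: "(real \<Rightarrow> real ^ 'd) \<Rightarrow> nat \<Rightarrow> real" where
  "arclength_energy c j = integral {0..2 * pi} (\<lambda>\<theta>. norm (d_theta c \<theta>) * (norm ((D_s c ^^ j) c \<theta>))\<^sup>2)"

text \<open>For a curve of length 1 this bounds the speed of the path of multiples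
  \<open>r c\<close> at \<open>r\<close>. The root of the sum is replaced by the sum of the roots so
  that the integrands of the theorem appear one by one.\<close>

definition radial_speed :: "(real \<Rightarrow> real ^ 'd) \<Rightarrow> nat \<Rightarrow> (nat \<Rightarrow> real \<Rightarrow> real) \<Rightarrow> real \<Rightarrow> real" where
  "radial_speed c n a r = (\<Sum>j\<le>n. sqrt (arclength_energy c j) * (r powr (1/2 - real j) * sqrt (a j r)))"

context
  fixes c :: "real \<Rightarrow> real ^ 'd" and n :: nat
  assumes c: "c \<in> immersions n" and n: "n \<ge> 2"
begin

lemma d_theta_homothetic: "d_theta (\<lambda>\<theta>. r *\<^sub>R c \<theta>) \<theta> = r *\<^sub>R d_theta c \<theta>"
  by (rule d_theta_scaleR[OF loc_sobolev_has_vector_derivative[OF immersionsD(1)[OF c n]]]) (use n in simp)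

lemma homothetic_immersion:
  assumes "r > 0"
  shows "(\<lambda>\<theta>. r *\<^sub>R c \<theta>) \<in> immersions n"
  using assms sobolev_scaleR[of c n r] c by (simp add: immersions_def d_theta_homothetic)

lemma curve_length_homothetic:
  assumes "r > 0"
  shows "curve_length (\<lambda>\<theta>. r *\<^sub>R c \<theta>) = r * curve_length c"
proof (rule has_integral_unique)
  show "((\<lambda>\<theta>. norm (d_theta (\<lambda>\<theta>. r *\<^sub>R c \<theta>) \<theta>)) has_integral curve_length (\<lambda>\<theta>. r *\<^sub>R c \<theta>)) {0..2 * pi}"
    by (rule curve_length_has_integral[OF homothetic_immersion[OF assms] n])
  show "((\<lambda>\<theta>. norm (d_theta (\<lambda>\<theta>. r *\<^sub>R c \<theta>) \<theta>)) has_integral r * curve_length c) {0..2 * pi}"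
    using has_integral_mult_right[OF curve_length_has_integral[OF c n], of r] assms by (simp add: d_theta_homothetic)
qed

lemma D_s_homothetic:
  assumes "r > 0" "(F has_vector_derivative D) (at \<theta>)"
  shows "D_s (\<lambda>\<theta>. r *\<^sub>R c \<theta>) (\<lambda>\<theta>. k *\<^sub>R F \<theta>) \<theta> = (k / r) *\<^sub>R D_s c F \<theta>"
  using assms(1) by (simp add: D_s_def d_theta_homothetic d_theta_scaleR[OF assms(2)])

text \<open>Below order \<open>n\<close> all derivatives exist everywhere and scale. At order
  \<open>n\<close> the derivative may fail to exist, and default values do not scale with the curve;
  the next lemma therefore excludes a null set.\<close>

lemma funpow_D_s_homothetic:
  assumes r: "r > 0" and "j < n"
  shows "(D_s (\<lambda>\<theta>. r *\<^sub>R c \<theta>) ^^ j) (\<lambda>\<theta>. g *\<^sub>R c \<theta>) = (\<lambda>\<theta>. (g / r ^ j) *\<^sub>R (D_s c ^^ j) c \<theta>)"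
  using assms(2)
proof (induction j)
  case (Suc j)
  have "((D_s c ^^ j) c has_vector_derivative vector_derivative ((D_s c ^^ j) c) (at \<theta>)) (at \<theta>)" for \<theta>
    by (rule loc_sobolev_has_vector_derivative[OF loc_sobolev_funpow_D_s[OF c n immersionsD(1)[OF c n]]])
      (use Suc.prems in auto)
  note D_s_homothetic[OF r this, of "g / r ^ j"]
  moreover have "(D_s (\<lambda>\<theta>. r *\<^sub>R c \<theta>) ^^ j) (\<lambda>\<theta>. g *\<^sub>R c \<theta>) = (\<lambda>\<theta>. (g / r ^ j) *\<^sub>R (D_s c ^^ j) c \<theta>)"
    using Suc by simp
  ultimately show ?case by (intro ext) (simp add: mult.commute)
qed simp

lemma funpow_D_s_homothetic_negligible:
  assumes r: "r > 0" and j: "j \<le> n"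
  shows "negligible {\<theta>. (D_s (\<lambda>\<theta>. r *\<^sub>R c \<theta>) ^^ j) (\<lambda>\<theta>. g *\<^sub>R c \<theta>) \<theta> \<noteq> (g / r ^ j) *\<^sub>R (D_s c ^^ j) c \<theta>}"
proof (cases "j < n")
  case True
  then show ?thesis using funpow_D_s_homothetic[OF r True] by simp
next
  case False
  then obtain i where i: "j = Suc i" "i < n" using j n by (cases j) auto
  have "negligible {\<theta>. \<not> ((D_s c ^^ i) c has_vector_derivative vector_derivative ((D_s c ^^ i) c) (at \<theta>)) (at \<theta>)}"
    by (rule loc_sobolev_negligible[OF loc_sobolev_funpow_D_s[OF c n immersionsD(1)[OF c n]]]) (use i in auto)
  then show ?thesis
  proof (rule negligible_subset)
    have "(D_s (\<lambda>\<theta>. r *\<^sub>R c \<theta>) ^^ j) (\<lambda>\<theta>. g *\<^sub>R c \<theta>) \<theta> = (g / r ^ j) *\<^sub>R (D_s c ^^ j) c \<theta>"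
      if "((D_s c ^^ i) c has_vector_derivative vector_derivative ((D_s c ^^ i) c) (at \<theta>)) (at \<theta>)" for \<theta>
      using D_s_homothetic[OF r that, of "g / r ^ i"] funpow_D_s_homothetic[OF r i(2), of g]
      by (simp add: i(1) mult.commute)
    then show "{\<theta>. (D_s (\<lambda>\<theta>. r *\<^sub>R c \<theta>) ^^ j) (\<lambda>\<theta>. g *\<^sub>R c \<theta>) \<theta> \<noteq> (g / r ^ j) *\<^sub>R (D_s c ^^ j) c \<theta>}
      \<subseteq> {\<theta>. \<not> ((D_s c ^^ i) c has_vector_derivative vector_derivative ((D_s c ^^ i) c) (at \<theta>)) (at \<theta>)}" by blast
  qed
qed

lemma sobolev_metric_homothetic:
  assumes r: "r > 0"
  shows "sobolev_metric n a (\<lambda>\<theta>. r *\<^sub>R c \<theta>) (\<lambda>\<theta>. g *\<^sub>R c \<theta>) (\<lambda>\<theta>. g *\<^sub>R c \<theta>)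
    = (\<Sum>j\<le>n. a j (r * curve_length c) * (r * (g / r ^ j)\<^sup>2 * arclength_energy c j))"
proof -
  have "integral {0..2 * pi} (\<lambda>\<theta>. norm (d_theta (\<lambda>\<theta>. r *\<^sub>R c \<theta>) \<theta>) * (norm ((D_s (\<lambda>\<theta>. r *\<^sub>R c \<theta>) ^^ j) (\<lambda>\<theta>. g *\<^sub>R c \<theta>) \<theta>))\<^sup>2)
     = r * (g / r ^ j)\<^sup>2 * arclength_energy c j" if "j \<le> n" for j
  proof -
    have "integral {0..2 * pi} (\<lambda>\<theta>. norm (d_theta (\<lambda>\<theta>. r *\<^sub>R c \<theta>) \<theta>) * (norm ((D_s (\<lambda>\<theta>. r *\<^sub>R c \<theta>) ^^ j) (\<lambda>\<theta>. g *\<^sub>R c \<theta>) \<theta>))\<^sup>2)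
      = integral {0..2 * pi} (\<lambda>\<theta>. (r * (g / r ^ j)\<^sup>2) * (norm (d_theta c \<theta>) * (norm ((D_s c ^^ j) c \<theta>))\<^sup>2))"
    proof (rule integral_spike[OF funpow_D_s_homothetic_negligible[OF r that, of g]])
      fix \<theta> assume "\<theta> \<in> {0..2 * pi} - {\<theta>. (D_s (\<lambda>\<theta>. r *\<^sub>R c \<theta>) ^^ j) (\<lambda>\<theta>. g *\<^sub>R c \<theta>) \<theta> \<noteq> (g / r ^ j) *\<^sub>R (D_s c ^^ j) c \<theta>}"
      then have e: "(D_s (\<lambda>\<theta>. r *\<^sub>R c \<theta>) ^^ j) (\<lambda>\<theta>. g *\<^sub>R c \<theta>) \<theta> = (g / r ^ j) *\<^sub>R (D_s c ^^ j) c \<theta>" by simp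
      show "(r * (g / r ^ j)\<^sup>2) * (norm (d_theta c \<theta>) * (norm ((D_s c ^^ j) c \<theta>))\<^sup>2)
        = norm (d_theta (\<lambda>\<theta>. r *\<^sub>R c \<theta>) \<theta>) * (norm ((D_s (\<lambda>\<theta>. r *\<^sub>R c \<theta>) ^^ j) (\<lambda>\<theta>. g *\<^sub>R c \<theta>) \<theta>))\<^sup>2"
        unfolding e d_theta_homothetic norm_scaleR power_mult_distrib power2_abs using r by simp
    qed
    then show ?thesis by (simp add: arclength_energy_def)
  qed
  then show ?thesis
    using sobolev_metric_eq[OF homothetic_immersion[OF r] n loc_sobolev_cmul[OF immersionsD(1)[OF c n]], of a g]
    by (simp add: curve_length_homothetic[OF r])
qed

lemma arclength_energy_nonneg: "arclength_energy c j \<ge> 0"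
  unfolding arclength_energy_def by (rule arclength_square_nonneg[OF c n])

text \<open>As \<open>c\<close> has length 1, the coefficients are evaluated at \<open>r\<close>
  itself. The arc length element contributes \<open>r\<close> and the squared derivatives of order
  \<open>j\<close> contribute \<open>r\<close> to the power \<open>- 2 * j\<close>; the root gives
  the exponent \<open>1/2 - j\<close>.\<close>

lemma sqrt_sobolev_metric_homothetic_le:
  assumes r: "r > 0" and l: "curve_length c = 1" and a: "admissible_coefficients n a"
  shows "sqrt (sobolev_metric n a (\<lambda>\<theta>. r *\<^sub>R c \<theta>) (\<lambda>\<theta>. g *\<^sub>R c \<theta>) (\<lambda>\<theta>. g *\<^sub>R c \<theta>)) \<le> \<bar>g\<bar> * radial_speed c n a r"
proof -
  have aj: "a j r \<ge> 0" if "j \<le> n" for j using a r that by (simp add: admissible_coefficients_def)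
  have t: "sqrt (a j r * (r * (g / r ^ j)\<^sup>2 * arclength_energy c j))
    = \<bar>g\<bar> * (sqrt (arclength_energy c j) * (r powr (1/2 - real j) * sqrt (a j r)))" for j
  proof -
    have "r powr (1/2 - real j) = sqrt r / r ^ j" using r by (simp add: powr_diff powr_half_sqrt powr_realpow)
    then show ?thesis using r by (simp add: real_sqrt_mult real_sqrt_abs abs_divide)
  qed
  have "sqrt (\<Sum>j\<le>n. a j r * (r * (g / r ^ j)\<^sup>2 * arclength_energy c j))
      \<le> (\<Sum>j\<le>n. sqrt (a j r * (r * (g / r ^ j)\<^sup>2 * arclength_energy c j)))"
    using r arclength_energy_nonneg aj by (intro sqrt_sum_le_sum_sqrt mult_nonneg_nonneg) auto
  then show ?thesis
    by (simp add: sobolev_metric_homothetic[OF r] l t radial_speed_def sum_distrib_left)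
qed

lemma radial_speed_continuous:
  assumes a: "admissible_coefficients n a"
  shows "continuous_on {0<..} (radial_speed c n a)"
  unfolding radial_speed_def[abs_def]
  by (intro continuous_intros admissible_continuous[OF a]) auto

lemma radial_path:
  assumes r: "r1 > 0" "r2 > 0"
  defines "\<gamma> \<equiv> \<lambda>t \<theta>. (r1 + t * (r2 - r1)) *\<^sub>R c \<theta>"
  shows "\<gamma> \<in> immersion_paths n (\<lambda>\<theta>. r1 *\<^sub>R c \<theta>) (\<lambda>\<theta>. r2 *\<^sub>R c \<theta>)"
    and "t \<in> {0..1} \<Longrightarrow> d_t \<gamma> t = (\<lambda>\<theta>. (r2 - r1) *\<^sub>R c \<theta>)"
    and "t \<in> {0..1} \<Longrightarrow> r1 + t * (r2 - r1) > 0"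
proof -
  show pos: "r1 + t * (r2 - r1) > 0" if t: "t \<in> {0..1}" for t
  proof -
    have "r1 + t * (r2 - r1) = (1 - t) * r1 + t * r2" by (simp add: algebra_simps)
    moreover have "0 \<le> (1 - t) * r1" "0 \<le> t * r2" using t r by auto
    moreover have "0 < (1 - t) * r1 \<or> 0 < t * r2" using t r by (cases "t = 0") auto
    ultimately show ?thesis by linarith
  qed
  have cs: "c \<in> sobolev n" by (rule immersionsD(4)[OF c n])
  \<comment> \<open>The path is affine in time, so its derivatives from the second on vanish. The
    zero curve is written as \<open>0 *\<^sub>R c \<theta>\<close> so that
    \<open>sobolev_scaleR\<close> applies to it too.\<close>
  define \<Gamma> where "\<Gamma> k = (if k = 0 then \<gamma> else if k = 1 then (\<lambda>t \<theta>. (r2 - r1) *\<^sub>R c \<theta>) else (\<lambda>t \<theta>. 0 *\<^sub>R c \<theta>))" for k :: nat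
  have "\<Gamma> k t \<in> sobolev n" for k t
    using sobolev_scaleR[OF cs] by (simp add: \<Gamma>_def \<gamma>_def del: scaleR_zero_left)
  moreover have "has_sobolev_derivative n (\<Gamma> k) (\<Gamma> (Suc k) t) t {0..1}" for k t
    unfolding has_sobolev_derivative_def
  proof (rule tendsto_eventually)
    have "(\<lambda>\<theta>. (1 / (u - t)) *\<^sub>R (\<Gamma> k u \<theta> - \<Gamma> k t \<theta>) - \<Gamma> (Suc k) t \<theta>) = (\<lambda>\<theta>. 0)" if "u \<noteq> t" for u
    proof
      fix \<theta>
      have "\<gamma> u \<theta> - \<gamma> t \<theta> = ((u - t) * (r2 - r1)) *\<^sub>R c \<theta>" by (simp add: \<gamma>_def algebra_simps)
      then show "(1 / (u - t)) *\<^sub>R (\<Gamma> k u \<theta> - \<Gamma> k t \<theta>) - \<Gamma> (Suc k) t \<theta> = 0"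
        using that by (simp add: \<Gamma>_def)
    qed
    then show "\<forall>\<^sub>F u in at t within {0..1}. sobolev_norm n (\<lambda>\<theta>. (1 / (u - t)) *\<^sub>R (\<Gamma> k u \<theta> - \<Gamma> k t \<theta>) - \<Gamma> (Suc k) t \<theta>) = 0"
      by (auto simp: eventually_at_filter sobolev_norm_zero intro!: eventuallyI)
  qed
  ultimately have "smooth_path_on n {0..1} \<gamma>"
    unfolding smooth_path_on_def by (intro exI[of _ \<Gamma>]) (auto simp: \<Gamma>_def)
  then have "piecewise_smooth_path n \<gamma>"
    unfolding piecewise_smooth_path_def by (intro exI[of _ 1] exI[of _ real]) simp
  then show "\<gamma> \<in> immersion_paths n (\<lambda>\<theta>. r1 *\<^sub>R c \<theta>) (\<lambda>\<theta>. r2 *\<^sub>R c \<theta>)"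
    using homothetic_immersion[OF pos] by (simp add: immersion_paths_def \<gamma>_def)
  show "d_t \<gamma> t = (\<lambda>\<theta>. (r2 - r1) *\<^sub>R c \<theta>)" if t: "t \<in> {0..1}" for t
  proof
    fix \<theta>
    have "((\<lambda>u. \<gamma> u \<theta>) has_vector_derivative (r2 - r1) *\<^sub>R c \<theta>) (at t)"
      unfolding \<gamma>_def by (auto intro!: derivative_eq_intros simp: algebra_simps)
    then show "d_t \<gamma> t \<theta> = (r2 - r1) *\<^sub>R c \<theta>"
      unfolding d_t_def by (rule vector_derivative_at_within_ivl) (use t in auto)
  qed
qed

text \<open>The affine radial path is an admissible competitor, and its radius becomes the variable
  of integration. \<open>min\<close> and \<open>max\<close> treat growing and shrinking paths
  alike.\<close>

lemma geodesic_dist_homothetic_le: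
  assumes r: "r1 > 0" "r2 > 0" and l: "curve_length c = 1" and a: "admissible_coefficients n a"
  shows "geodesic_dist n a (\<lambda>\<theta>. r1 *\<^sub>R c \<theta>) (\<lambda>\<theta>. r2 *\<^sub>R c \<theta>)
    \<le> (\<integral>\<^sup>+x. ennreal (indicator {min r1 r2..max r1 r2} x * radial_speed c n a x) \<partial>lborel)"
proof -
  let ?\<gamma> = "\<lambda>t \<theta>. (r1 + t * (r2 - r1)) *\<^sub>R c \<theta>"
  let ?f = "\<lambda>x. ennreal (indicator {min r1 r2..max r1 r2} x * radial_speed c n a x)"
  have "(\<lambda>x. indicator {min r1 r2..max r1 r2} x *\<^sub>R radial_speed c n a x) \<in> borel_measurable borel"
    using r by (intro borel_measurable_continuous_on_indicator continuous_on_subset[OF radial_speed_continuous[OF a]]) auto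
  then have meas: "?f \<in> borel_measurable borel" by simp
  have "geodesic_dist n a (\<lambda>\<theta>. r1 *\<^sub>R c \<theta>) (\<lambda>\<theta>. r2 *\<^sub>R c \<theta>) \<le> path_length n a ?\<gamma>"
    unfolding geodesic_dist_def by (rule INF_lower[OF radial_path(1)[OF r]])
  also have "\<dots> \<le> (\<integral>\<^sup>+t. ennreal \<bar>r2 - r1\<bar> * ?f (r1 + (r2 - r1) * t) \<partial>lborel)"
    unfolding path_length_def nn_integral_completion
  proof (rule nn_integral_mono)
    fix t :: real
    show "ennreal (sqrt (sobolev_metric n a (?\<gamma> t) (d_t ?\<gamma> t) (d_t ?\<gamma> t))) * indicator {0..1} t
        \<le> ennreal \<bar>r2 - r1\<bar> * ?f (r1 + (r2 - r1) * t)"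
    proof (cases "t \<in> {0..1}")
      case True
      define x where "x = r1 + t * (r2 - r1)"
      have x0: "x > 0" unfolding x_def by (rule radial_path(3)[OF r True])
      have "x = (1 - t) * r1 + t * r2" by (simp add: x_def algebra_simps)
      then have "x \<in> closed_segment r1 r2" using True by (auto simp: closed_segment_def)
      then have mm: "x \<in> {min r1 r2..max r1 r2}" by (auto simp: closed_segment_eq_real_ivl split: if_splits)
      have xeq: "r1 + (r2 - r1) * t = x" by (simp add: x_def mult.commute)
      have "sqrt (sobolev_metric n a (?\<gamma> t) (d_t ?\<gamma> t) (d_t ?\<gamma> t)) \<le> \<bar>r2 - r1\<bar> * radial_speed c n a x"
        unfolding radial_path(2)[OF r True] x_def[symmetric] by (rule sqrt_sobolev_metric_homothetic_le[OF x0 l a])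
      then have "ennreal (sqrt (sobolev_metric n a (?\<gamma> t) (d_t ?\<gamma> t) (d_t ?\<gamma> t))) \<le> ennreal (\<bar>r2 - r1\<bar> * radial_speed c n a x)"
        by (rule ennreal_leI)
      then show ?thesis unfolding xeq using True mm by (simp add: ennreal_mult')
    qed simp
  qed
  also have "\<dots> \<le> (\<integral>\<^sup>+x. ?f x \<partial>lborel)"
  proof (cases "r1 = r2")
    \<comment> \<open>The substitution needs a nonzero slope; for equal radii the factor
      \<open>\<bar>r2 - r1\<bar>\<close> makes the left side 0.\<close>
    case False
    have "(\<integral>\<^sup>+t. ennreal \<bar>r2 - r1\<bar> * ?f (r1 + (r2 - r1) * t) \<partial>lborel)
        = ennreal \<bar>r2 - r1\<bar> * (\<integral>\<^sup>+t. ?f (r1 + (r2 - r1) * t) \<partial>lborel)"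
      by (rule nn_integral_cmult) (use meas in measurable)
    also have "\<dots> = (\<integral>\<^sup>+x. ?f x \<partial>lborel)"
      by (rule nn_integral_real_affine[OF meas, symmetric]) (use False in simp)
    finally show ?thesis by simp
  qed simp
  finally show ?thesis .
qed

end

section \<open>From finite integrals to incompleteness\<close>

lemma nn_integral_decseq_tail:
  fixes g :: "real \<Rightarrow> ennreal"
  assumes g: "g \<in> borel_measurable borel" and fin: "(\<integral>\<^sup>+x. g x \<partial>lborel) \<noteq> \<infinity>"
    and A: "decseq A" "\<And>N. A N \<in> sets borel" "(\<Inter>N. A N) = {}" and e: "e > 0"
  obtains N where "(\<integral>\<^sup>+x. g x * indicator (A N) x \<partial>lborel) < e"
proof -
  \<comment> \<open>The density defines a finite measure on these sets, so continuity from above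
    applies to them.\<close>
  let ?M = "density lborel g"
  have em: "emeasure ?M (A N) = (\<integral>\<^sup>+x. g x * indicator (A N) x \<partial>lborel)" for N
    using g A(2) by (simp add: emeasure_density)
  have "emeasure ?M (A N) \<noteq> \<infinity>" for N
  proof -
    have "emeasure ?M (A N) \<le> (\<integral>\<^sup>+x. g x \<partial>lborel)"
      unfolding em by (intro nn_integral_mono) (auto simp: indicator_def)
    then show ?thesis using fin by (auto simp: top_unique)
  qed
  then have "(\<lambda>N. emeasure ?M (A N)) \<longlonglongrightarrow> emeasure ?M (\<Inter>N. A N)"
    using A by (intro Lim_emeasure_decseq) auto
  then have "(\<lambda>N. emeasure ?M (A N)) \<longlonglongrightarrow> 0" using A(3) by simp
  then have "\<forall>\<^sub>F N in sequentially. emeasure ?M (A N) < e" using e by (rule order_tendstoD(2))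
  then obtain N where "emeasure ?M (A N) < e" by (auto simp: eventually_sequentially)
  then show thesis using that unfolding em by blast
qed

text \<open>Both ends, infinity and 0, are treated together: \<open>\<rho> i\<close> is the length
  of the \<open>i\<close>-th curve, and the sets \<open>A N\<close> shrink towards the end. The
  sequence is Cauchy because the radial integrals over \<open>A N\<close> tend to 0. It has no limit
  by \<open>length_escape_cost\<close>, because its lengths finally leave every interval from half
  to twice a positive number.\<close>

lemma not_metrically_complete_homothetic:
  fixes c :: "real \<Rightarrow> real ^ 'd"
  assumes c: "c \<in> immersions n" and n: "n \<ge> 2" and l: "curve_length c = 1" and a: "admissible_coefficients n a"
    and \<rho>: "\<And>i. \<rho> i > 0" and leave: "\<And>L. L > 0 \<Longrightarrow> \<forall>\<^sub>F i in sequentially. \<rho> i \<notin> {L / 2<..<2 * L}"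
    and A: "decseq A" "\<And>N. A N \<in> sets borel" "(\<Inter>N. A N) = {}" "A 0 \<subseteq> {0<..}"
    and seg: "\<And>N i j. N \<le> i \<Longrightarrow> N \<le> j \<Longrightarrow> {min (\<rho> i) (\<rho> j)..max (\<rho> i) (\<rho> j)} \<subseteq> A N"
    and fin: "\<And>k. k \<le> n \<Longrightarrow> (\<integral>\<^sup>+r\<in>A 0. ennreal (r powr (1/2 - real k) * sqrt (a k r)) \<partial>lborel) \<noteq> \<infinity>"
  shows "\<not> metrically_complete (immersions n :: (real \<Rightarrow> real ^ 'd) set) (geodesic_dist n a)"
proof
  assume "metrically_complete (immersions n :: (real \<Rightarrow> real ^ 'd) set) (geodesic_dist n a)"
  define x where "x i = (\<lambda>\<theta>. \<rho> i *\<^sub>R c \<theta>)" for i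
  let ?W = "radial_speed c n a"
  let ?w = "\<lambda>k r. r powr (1/2 - real k) * sqrt (a k r)"
  have w0: "?w k r \<ge> 0" if "k \<le> n" "r > 0" for k r using a that by (simp add: admissible_coefficients_def)
  have mw: "(\<lambda>r. ennreal (indicator (A 0) r *\<^sub>R ?w k r)) \<in> borel_measurable borel" if "k \<le> n" for k
  proof -
    have "continuous_on {0<..} (?w k)" by (intro continuous_intros admissible_continuous[OF a that]) auto
    then have "continuous_on (A 0) (?w k)" by (rule continuous_on_subset[OF _ A(4)])
    then have "(\<lambda>r. indicator (A 0) r *\<^sub>R ?w k r) \<in> borel_measurable borel"
      by (rule borel_measurable_continuous_on_indicator[OF A(2)])
    then show ?thesis by measurable
  qed
  \<comment> \<open>The cutoff to \<open>A 0\<close> keeps to positive radii, where the coefficients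
    are continuous, and to the set over which the integrals are assumed finite.\<close>
  define g where "g r = ennreal (indicator (A 0) r * ?W r)" for r
  have gsum: "g r = (\<Sum>k\<le>n. ennreal (sqrt (arclength_energy c k)) * ennreal (indicator (A 0) r *\<^sub>R ?w k r))" for r
  proof (cases "r \<in> A 0")
    case True
    then have "r > 0" using A(4) by auto
    have "g r = ennreal (\<Sum>k\<le>n. sqrt (arclength_energy c k) * ?w k r)"
      using True by (simp add: g_def radial_speed_def)
    also have "\<dots> = (\<Sum>k\<le>n. ennreal (sqrt (arclength_energy c k) * ?w k r))"
      using w0 \<open>r > 0\<close> arclength_energy_nonneg[OF c n]
      by (intro sum_ennreal[symmetric] mult_nonneg_nonneg[OF _ w0]) auto
    also have "\<dots> = (\<Sum>k\<le>n. ennreal (sqrt (arclength_energy c k)) * ennreal (indicator (A 0) r *\<^sub>R ?w k r))"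
      using True arclength_energy_nonneg[OF c n] by (simp add: ennreal_mult')
    finally show ?thesis .
  qed (simp add: g_def)
  have mg: "g \<in> borel_measurable borel" unfolding gsum[abs_def] using mw by measurable
  have "(\<integral>\<^sup>+r. g r \<partial>lborel) = (\<Sum>k\<le>n. ennreal (sqrt (arclength_energy c k)) * (\<integral>\<^sup>+r. ennreal (indicator (A 0) r *\<^sub>R ?w k r) \<partial>lborel))"
    unfolding gsum using mw by (subst nn_integral_sum) (auto simp: nn_integral_cmult)
  also have "\<dots> = (\<Sum>k\<le>n. ennreal (sqrt (arclength_energy c k)) * (\<integral>\<^sup>+r\<in>A 0. ennreal (?w k r) \<partial>lborel))"
    by (intro sum.cong refl arg_cong2[where f = "(*)"] nn_integral_cong) (auto simp: indicator_def)
  also have "\<dots> \<noteq> \<infinity>"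
    using fin by (auto simp: ennreal_mult_eq_top_iff ennreal_sum_eq_top)
  finally have fg: "(\<integral>\<^sup>+r. g r \<partial>lborel) \<noteq> \<infinity>" .
  have imm: "x i \<in> immersions n" for i unfolding x_def by (rule homothetic_immersion[OF c n \<rho>])
  have "\<exists>N. \<forall>i\<ge>N. \<forall>j\<ge>N. geodesic_dist n a (x i) (x j) < e" if e: "e > 0" for e
  proof -
    obtain N where N: "(\<integral>\<^sup>+r. g r * indicator (A N) r \<partial>lborel) < e"
      using nn_integral_decseq_tail[OF mg fg A(1-3) e] by blast
    have "geodesic_dist n a (x i) (x j) < e" if ij: "i \<ge> N" "j \<ge> N" for i j
    proof -
      have "A N \<subseteq> A 0" using A(1) by (simp add: decseq_def)
      then have sub: "{min (\<rho> i) (\<rho> j)..max (\<rho> i) (\<rho> j)} \<subseteq> A N" "{min (\<rho> i) (\<rho> j)..max (\<rho> i) (\<rho> j)} \<subseteq> A 0"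
        using seg[OF ij] by auto
      have "geodesic_dist n a (x i) (x j) \<le> (\<integral>\<^sup>+r. ennreal (indicator {min (\<rho> i) (\<rho> j)..max (\<rho> i) (\<rho> j)} r * ?W r) \<partial>lborel)"
        unfolding x_def by (rule geodesic_dist_homothetic_le[OF c n \<rho> \<rho> l a])
      also have "\<dots> \<le> (\<integral>\<^sup>+r. g r * indicator (A N) r \<partial>lborel)"
        by (rule nn_integral_mono) (use sub in \<open>auto simp: g_def indicator_def\<close>)
      finally show ?thesis using N by simp
    qed
    then show ?thesis by blast
  qed
  then obtain y where y: "y \<in> immersions n" "(\<lambda>i. geodesic_dist n a (x i) y) \<longlonglongrightarrow> 0"
    using \<open>metrically_complete _ _\<close> imm unfolding metrically_complete_def by blast
  obtain \<epsilon> :: ennreal where \<epsilon>: "\<epsilon> > 0"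
    "\<And>z. curve_length z \<notin> {curve_length y / 2<..<2 * curve_length y} \<Longrightarrow> \<epsilon> \<le> geodesic_dist n a z y"
    by (rule length_escape_cost[OF n a y(1)]) (rule that)
  have "\<forall>\<^sub>F i in sequentially. geodesic_dist n a (x i) y < \<epsilon>" using y(2) \<epsilon>(1) by (rule order_tendstoD(2))
  moreover have "\<forall>\<^sub>F i in sequentially. \<epsilon> \<le> geodesic_dist n a (x i) y"
    using leave[OF curve_length_pos[OF y(1) n]]
  proof eventually_elim
    case (elim i)
    have "curve_length (x i) = \<rho> i" unfolding x_def by (simp add: curve_length_homothetic[OF c n \<rho>] l)
    then show ?case using elim \<epsilon>(2) by simp
  qed
  ultimately have "\<forall>\<^sub>F i in sequentially. False" by eventually_elim auto
  then show False by simp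
qed

theorem mainTheorem2:
  fixes n :: nat and a :: "nat \<Rightarrow> real \<Rightarrow> real"
  assumes "n \<ge> 2"
    and "admissible_coefficients n a"
    and "(immersions n :: (real \<Rightarrow> real ^ 'd) set) \<noteq> {}"
    and "metrically_complete (immersions n :: (real \<Rightarrow> real ^ 'd) set) (geodesic_dist n a)"
  shows "(\<exists>k\<le>n. (\<integral>\<^sup>+r\<in>{1..}. ennreal (r powr (1/2 - real k) * sqrt (a k r)) \<partial>lborel) = \<infinity>) \<and>
         (\<exists>k\<le>n. (\<integral>\<^sup>+r\<in>{0<..1}. ennreal (r powr (1/2 - real k) * sqrt (a k r)) \<partial>lborel) = \<infinity>)"
proof -
  obtain b :: "real \<Rightarrow> real ^ 'd" where b: "b \<in> immersions n" using assms(3) by blast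
  \<comment> \<open>Scaling to length 1 makes the radius of a multiple equal to its length.\<close>
  define c where "c = (\<lambda>\<theta>. (1 / curve_length b) *\<^sub>R b \<theta>)"
  have lb: "1 / curve_length b > 0" using curve_length_pos[OF b assms(1)] by simp
  have c: "c \<in> immersions n" unfolding c_def by (rule homothetic_immersion[OF b assms(1) lb])
  have l: "curve_length c = 1"
    unfolding c_def curve_length_homothetic[OF b assms(1) lb] using lb by simp
  note * = not_metrically_complete_homothetic[OF c assms(1) l assms(2)]
  have "\<exists>k\<le>n. (\<integral>\<^sup>+r\<in>{1..}. ennreal (r powr (1/2 - real k) * sqrt (a k r)) \<partial>lborel) = \<infinity>"
  proof (rule ccontr)
    assume fin: "\<not> ?thesis"
    have "\<not> metrically_complete (immersions n :: (real \<Rightarrow> real ^ 'd) set) (geodesic_dist n a)"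
    \<comment> \<open>The shift by 1 makes \<open>A 0\<close> equal to \<open>{1..}\<close>, the
      domain of the integrals in the claim.\<close>
    proof (rule *[of "\<lambda>i. real i + 1" "\<lambda>N. {real N + 1..}"])
      fix L :: real
      obtain N :: nat where N: "2 * L \<le> real N" using real_arch_simple by blast
      show "\<forall>\<^sub>F i in sequentially. real i + 1 \<notin> {L / 2<..<2 * L}"
        using eventually_ge_at_top[of N] by eventually_elim (use N in auto)
      have "x \<notin> (\<Inter>N. {real N + 1..})" for x
      proof -
        obtain N :: nat where "x < real N" using reals_Archimedean2 by blast
        then have "x \<notin> {real N + 1..}" by simp
        then show ?thesis by blast
      qed
      then show "(\<Inter>N. {real N + 1..}) = {}" by blast
    qed (use fin in \<open>auto simp: decseq_def\<close>)
    then show False using assms(4) by simp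
  qed
  moreover have "\<exists>k\<le>n. (\<integral>\<^sup>+r\<in>{0<..1}. ennreal (r powr (1/2 - real k) * sqrt (a k r)) \<partial>lborel) = \<infinity>"
  proof (rule ccontr)
    assume fin: "\<not> ?thesis"
    have "\<not> metrically_complete (immersions n :: (real \<Rightarrow> real ^ 'd) set) (geodesic_dist n a)"
    \<comment> \<open>Here \<open>A 0\<close> is \<open>{0<..1}\<close>. Its left end is open
      because the coefficients are only controlled at positive lengths, and also so that the sets
      have empty intersection.\<close>
    proof (rule *[of "\<lambda>i. 1 / (real i + 1)" "\<lambda>N. {0<..1 / (real N + 1)}"])
      fix L :: real assume L: "L > 0"
      obtain N :: nat where N: "2 / L \<le> real N" using real_arch_simple by blast
      show "\<forall>\<^sub>F i in sequentially. 1 / (real i + 1) \<notin> {L / 2<..<2 * L}"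
        using eventually_ge_at_top[of N]
      proof eventually_elim
        case (elim i)
        then have "2 / L \<le> real i + 1" using N by linarith
        then have "1 / (real i + 1) \<le> L / 2" using L by (simp add: field_simps)
        then show ?case by auto
      qed
    next
      have "x \<notin> (\<Inter>N. {0<..1 / (real N + 1)})" for x
      proof (cases "x > 0")
        case True
        obtain N :: nat where "1 / x < real N" using reals_Archimedean2 by blast
        then have "1 / (real N + 1) < x" using True by (simp add: field_simps)
        then have "x \<notin> {0<..1 / (real N + 1)}" by simp
        then show ?thesis by blast
      qed auto
      then show "(\<Inter>N. {0<..1 / (real N + 1)}) = {}" by blast
    next
      have "1 / (real j + 1) \<le> 1 / (real i + 1)" if "i \<le> j" for i j :: nat
        using that by (simp add: frac_le)
      then show "decseq (\<lambda>N. {0<..1 / (real N + 1)})"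
        unfolding decseq_def by fastforce
    next
      fix N i j :: nat assume ij: "N \<le> i" "N \<le> j"
      have "{min p q..max p q} \<subseteq> {0<..m}" if "0 < p" "0 < q" "p \<le> m" "q \<le> m" for p q m :: real
        using that by (auto simp: min_def max_def split: if_splits)
      then show "{min (1 / (real i + 1)) (1 / (real j + 1))..max (1 / (real i + 1)) (1 / (real j + 1))} \<subseteq> {0<..1 / (real N + 1)}"
        using ij by (simp add: frac_le)
    qed (use fin in auto)
    then show False using assms(4) by simp
  qed
  ultimately show ?thesis by blast
qed

end
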